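(* Let $\mathcal{A}$ be a simplicial arrangement of $n\ge 15$ lines in $\mathbb{RP}^2$ that differs by at most $k<\frac{1}{13}n-\frac{14}{13}$ lines from a regular simplicial arrangement $\mathcal{A}_r$ formed by the sides and symmetry axes of a regular $m$-gon $\mathcal{P}$ ($m\ge 3$). Then $\mathcal{A}$ coincides either with $\mathcal{A}_r$ or with the union of $\mathcal{A}_r$ with the line at infinity.
   Context: A line arrangement is a finite set $\mathcal{A}$ of lines in the real projective plane $\mathbb{RP}^2$. It is simplicial if every connected component of $\mathbb{RP}^2\setminus\bigcup_{L\in\mathcal{A}}L$ is a triangle. The regular $m$-gon $\mathcal{P}$ lies in the Euclidean plane $\mathbb{R}^2\subset\mathbb{RP}^2$; $\mathcal{A}_r$ is the set of $2m$ lines consisting of the $m$ lines containing the sides of $\mathcal{P}$ and the $m$ symmetry axes of $\mathcal{P}$. The line at infinity is $\mathbb{RP}^2\setminus\mathbb{R}^2$ for this affine chart (the one in which $\mathcal{P}$ is a Euclidean regular polygon). "$\mathcal{A}$ differs by at most $k$ lines from $\mathcal{A}_r$" means that the symmetric difference satisfies $|\mathcal{A}\,\Delta\,\mathcal{A}_r|\le k$. *)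

theory Defs
  imports "HOL-Analysis.Analysis"
begin

definition proportional :: "real^3 \<Rightarrow> real^3 \<Rightarrow> bool" where
  "proportional x y \<longleftrightarrow> x \<noteq> 0 \<and> y \<noteq> 0 \<and> (\<exists>s. s \<noteq> 0 \<and> y = s *\<^sub>R x)"

lemma part_equivp_proportional: "part_equivp proportional"
proof (rule part_equivpI)
  show "\<exists>x. proportional x x"
    unfolding proportional_def by (rule exI[of _ "axis 1 1"]) (auto intro: exI[of _ 1])
  show "symp proportional"
  proof (rule sympI)
    fix x y assume "proportional x y"
    then obtain s where "x \<noteq> 0" "y \<noteq> 0" "s \<noteq> 0" "y = s *\<^sub>R x"
      unfolding proportional_def by blast
    moreover from this have "x = inverse s *\<^sub>R y" by simp
    ultimately show "proportional y x"
      unfolding proportional_def using nonzero_imp_inverse_nonzero by blast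
  qed
  show "transp proportional"
  proof (rule transpI)
    fix x y z assume "proportional x y" "proportional y z"
    then obtain s t where "x \<noteq> 0" "z \<noteq> 0" "s \<noteq> 0" "t \<noteq> 0" "y = s *\<^sub>R x" "z = t *\<^sub>R y"
      unfolding proportional_def by blast
    moreover from this have "t * s \<noteq> 0" "z = (t * s) *\<^sub>R x" by simp_all
    ultimately show "proportional x z"
      unfolding proportional_def by blast
  qed
qed

quotient_type rp2 = "real^3" / partial: proportional
  by (rule part_equivp_proportional)

text \<open>The point with homogeneous coordinates \<open>x\<close>; meaningful only for \<open>x \<noteq> 0\<close>.\<close>

definition proj :: "real^3 \<Rightarrow> rp2" where
  "proj x = abs_rp2 x"

lemma proj_eq_iff:
  assumes "x \<noteq> 0" "y \<noteq> 0"
  shows "proj x = proj y \<longleftrightarrow> (\<exists>s. s \<noteq> 0 \<and> y = s *\<^sub>R x)"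
proof -
  have refl: "proportional z z" if "z \<noteq> 0" for z
    unfolding proportional_def using that by (auto intro: exI[of _ 1])
  have "proj x = proj y \<longleftrightarrow> proportional x y"
    using Quotient3_rel[OF Quotient3_rp2, of x y] refl assms unfolding proj_def by simp
  then show ?thesis
    using assms unfolding proportional_def by simp
qed

lemma proj_surj: "\<exists>x. x \<noteq> 0 \<and> p = proj x"
proof -
  have "proportional (rep_rp2 p) (rep_rp2 p)"
    using Quotient3_rep_reflp[OF Quotient3_rp2] .
  moreover have "p = proj (rep_rp2 p)"
    using Quotient3_abs_rep[OF Quotient3_rp2] unfolding proj_def by simp
  ultimately show ?thesis
    unfolding proportional_def by blast
qed

text \<open>The quotient topology of \<open>real^3\<close> without the origin.\<close>

instantiation rp2 :: topological_space
begin

definition open_rp2 :: "rp2 set \<Rightarrow> bool" where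
  "open_rp2 U \<longleftrightarrow> open {x. x \<noteq> 0 \<and> proj x \<in> U}"

instance
proof
  have "{x :: real^3. x \<noteq> 0 \<and> proj x \<in> UNIV} = - {0}" by auto
  then show "open (UNIV :: rp2 set)"
    unfolding open_rp2_def by (simp add: open_Compl)
next
  fix S T :: "rp2 set" assume "open S" "open T"
  moreover have "{x. x \<noteq> 0 \<and> proj x \<in> S \<inter> T} =
      {x. x \<noteq> 0 \<and> proj x \<in> S} \<inter> {x. x \<noteq> 0 \<and> proj x \<in> T}" by auto
  ultimately show "open (S \<inter> T)"
    unfolding open_rp2_def by (simp add: open_Int)
next
  fix K :: "rp2 set set" assume "\<forall>S\<in>K. open S"
  moreover have "{x. x \<noteq> 0 \<and> proj x \<in> \<Union>K} = (\<Union>S\<in>K. {x. x \<noteq> 0 \<and> proj x \<in> S})" by auto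
  ultimately show "open (\<Union>K)"
    unfolding open_rp2_def by auto
qed

end

definition is_line :: "rp2 set \<Rightarrow> bool" where
  "is_line L \<longleftrightarrow> (\<exists>a :: real^3. a \<noteq> 0 \<and> L = proj ` {x. x \<noteq> 0 \<and> a \<bullet> x = 0})"

text \<open>An open triangle with vertices \<open>proj u\<close>, \<open>proj v\<close>, \<open>proj w\<close>. Replacing \<open>u\<close>, \<open>v\<close>, \<open>w\<close>
  by their negatives yields the four triangles into which the three lines joining these
  vertices divide the projective plane.\<close>

definition is_triangle :: "rp2 set \<Rightarrow> bool" where
  "is_triangle T \<longleftrightarrow> (\<exists>u v w :: real^3. det (vector [u, v, w]) \<noteq> 0 \<and>
     T = {proj (a *\<^sub>R u + b *\<^sub>R v + c *\<^sub>R w) | a b c. a > 0 \<and> b > 0 \<and> c > 0})"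

definition line_arrangement :: "rp2 set set \<Rightarrow> bool" where
  "line_arrangement A \<longleftrightarrow> finite A \<and> (\<forall>L\<in>A. is_line L)"

definition simplicial :: "rp2 set set \<Rightarrow> bool" where
  "simplicial A \<longleftrightarrow> (\<forall>C\<in>components (UNIV - \<Union>A). is_triangle C)"

definition embed :: "real^2 \<Rightarrow> rp2" where
  "embed x = proj (vector [x $ 1, x $ 2, 1])"

definition line_at_infinity :: "rp2 set" where
  "line_at_infinity = UNIV - range embed"

text \<open>Vertices, in cyclic order, of the regular \<open>m\<close>-gon with centre \<open>c\<close>, circumradius \<open>r\<close>
  and the vertex \<open>0\<close> in direction \<open>t\<close>.\<close>

definition ngon_vertex :: "nat \<Rightarrow> real^2 \<Rightarrow> real \<Rightarrow> real \<Rightarrow> nat \<Rightarrow> real^2" where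
  "ngon_vertex m c r t j =
     c + r *\<^sub>R vector [cos (t + 2 * pi * real j / real m), sin (t + 2 * pi * real j / real m)]"

definition ngon :: "nat \<Rightarrow> real^2 \<Rightarrow> real \<Rightarrow> real \<Rightarrow> (real^2) set" where
  "ngon m c r t = convex hull (ngon_vertex m c r t ` {..<m})"

definition ngon_sides :: "nat \<Rightarrow> real^2 \<Rightarrow> real \<Rightarrow> real \<Rightarrow> (real^2) set set" where
  "ngon_sides m c r t =
     (\<lambda>j. closed_segment (ngon_vertex m c r t j) (ngon_vertex m c r t (Suc j))) ` {..<m}"

text \<open>For a line \<open>l\<close>, \<open>closest_point l x\<close> is the foot of the perpendicular from \<open>x\<close>.\<close>

definition reflection :: "(real^2) set \<Rightarrow> real^2 \<Rightarrow> real^2" where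
  "reflection l x = 2 *\<^sub>R closest_point l x - x"

definition symmetry_axis :: "(real^2) set \<Rightarrow> (real^2) set \<Rightarrow> bool" where
  "symmetry_axis P l \<longleftrightarrow> affine l \<and> aff_dim l = 1 \<and> reflection l ` P = P"

definition regular_arrangement :: "nat \<Rightarrow> real^2 \<Rightarrow> real \<Rightarrow> real \<Rightarrow> rp2 set set" where
  "regular_arrangement m c r t =
     {L. is_line L \<and> (\<exists>s\<in>ngon_sides m c r t. embed ` s \<subseteq> L)} \<union>
     {L. is_line L \<and> (\<exists>l. symmetry_axis (ngon m c r t) l \<and> embed ` l \<subseteq> L)}"

end

theory Submission
  imports Defs
begin

text \<open>Let \<open>D\<close> and \<open>E\<close> be the sets of missing and additional lines; the hypothesis on \<open>k\<close> gives
  \<open>m > 7 |D| + 6 |E| + 7\<close>.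

  If a line \<open>L\<close> of the regular arrangement is missing, most of its vertices still lie on two lines of
  \<open>A\<close>, so two of them are consecutive among the points where \<open>L\<close> meets \<open>A\<close>. The cell containing the
  open segment between them has both of them as corners, which is impossible for a triangle.

  So \<open>A\<close> contains the regular arrangement. Let \<open>l\<close> be an additional line. If \<open>l\<close> misses the centre,
  counting intersections yields two axes that meet \<open>l\<close> in double points of \<open>A\<close> such that no other
  additional line contains or bounds a cell at these points. At such a point the four adjacent
  triangles are bounded by lines of the regular arrangement, whose symmetry in the axis forces \<open>l\<close> to
  be mirror symmetric, that is, orthogonal to the axis or at infinity. Being orthogonal to two axes is
  possible only for the line at infinity. If \<open>l\<close> passes through the centre, the same count for the
  sides yields two consecutive double points on \<open>l\<close>, which is impossible.\<close>

section \<open>Lines and cells in homogeneous coordinates\<close>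

text \<open>Points and lines are vectors and covectors of \<open>real^3\<close>, and all order
  information sits in the signs of products \<open>(f \<bullet> x) * (f \<bullet> y)\<close>.
  Rescaling \<open>f\<close> does not affect such a sign, so lines need no orientation and points at
  infinity need no separate treatment. That these products are nonnegative for all \<open>f\<close>
  means that no line of \<open>A\<close> separates the chosen representatives; for two vertices on a
  line this expresses that they are neighbours.

  Missing lines have to be excluded first, because the mirror argument reflects a line that bounds a
  cell and uses that its image belongs to \<open>A\<close> again.

  An additional line disturbs at most three candidate points on \<open>l\<close>: its own
  intersection with \<open>l\<close> and the two neighbours of that point. Up to about half of the
  axes may meet \<open>l\<close> on a side and are lost as candidates, so 3 |E| has to stay below
  about m / 2, which accounts for the coefficient 6.\<close>

definition pline :: "real^3 \<Rightarrow> rp2 set" where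
  "pline a = proj ` {x. x \<noteq> 0 \<and> a \<bullet> x = 0}"

text \<open>Every nonzero multiple is included, so rescaled and sign-reversed covectors remain
  available; \<open>finite_cov_rep\<close> recovers finiteness.\<close>

definition cov :: "rp2 set set \<Rightarrow> (real^3) set" where
  "cov A = {a. a \<noteq> 0 \<and> pline a \<in> A}"

lemma is_line_pline: "is_line L \<longleftrightarrow> (\<exists>a. a \<noteq> 0 \<and> L = pline a)"
  by (simp add: is_line_def pline_def)

lemma proj_in_pline: "x \<noteq> 0 \<Longrightarrow> proj x \<in> pline a \<longleftrightarrow> a \<bullet> x = 0"
proof
  assume "x \<noteq> 0" "proj x \<in> pline a"
  then obtain y where "y \<noteq> 0" "a \<bullet> y = 0" "proj y = proj x" by (auto simp: pline_def)
  then show "a \<bullet> x = 0" using proj_eq_iff \<open>x \<noteq> 0\<close> by fastforce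
qed (auto simp: pline_def)

text \<open>The part of \<open>b\<close> orthogonal to \<open>a\<close> lies in the kernel of
  \<open>a\<close>, hence of \<open>b\<close>, and is therefore orthogonal to itself.\<close>

lemma pline_subset_imp:
  assumes "a \<noteq> 0" "\<And>x. a \<bullet> x = 0 \<Longrightarrow> b \<bullet> x = 0"
  shows "\<exists>s. b = s *\<^sub>R a"
proof -
  define x where "x = b - ((a \<bullet> b) / (a \<bullet> a)) *\<^sub>R a"
  have "a \<bullet> x = 0" using assms(1) by (simp add: x_def inner_diff_right)
  moreover from this have "b \<bullet> x = 0" by (rule assms(2))
  moreover have "x \<bullet> x = b \<bullet> x - ((a \<bullet> b) / (a \<bullet> a)) * (a \<bullet> x)"
    by (subst (1) x_def) (simp add: inner_diff_left)
  ultimately have "x = 0" by simp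
  then show ?thesis unfolding x_def by (metis eq_iff_diff_eq_0)
qed

lemma pline_eq_iff:
  assumes "a \<noteq> 0" "b \<noteq> 0"
  shows "pline a = pline b \<longleftrightarrow> (\<exists>s. s \<noteq> 0 \<and> b = s *\<^sub>R a)"
proof
  assume eq: "pline a = pline b"
  have "b \<bullet> x = 0" if "a \<bullet> x = 0" for x
    using that eq proj_in_pline[of x a] proj_in_pline[of x b] by (cases "x = 0") auto
  then obtain s where "b = s *\<^sub>R a" using pline_subset_imp assms(1) by blast
  then show "\<exists>s. s \<noteq> 0 \<and> b = s *\<^sub>R a" using assms(2) by auto
next
  assume "\<exists>s. s \<noteq> 0 \<and> b = s *\<^sub>R a"
  then show "pline a = pline b" by (auto simp: pline_def)
qed

lemma pline_scale: "s \<noteq> 0 \<Longrightarrow> pline (s *\<^sub>R a) = pline a"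
  by (simp add: pline_def)

lemma cov_scale: "f \<in> cov A \<Longrightarrow> s \<noteq> 0 \<Longrightarrow> s *\<^sub>R f \<in> cov A"
  by (simp add: cov_def pline_scale)

lemma pline_neqD:
  assumes "a \<noteq> 0" "b \<noteq> 0" "pline a \<noteq> pline b"
  shows "cross3 a b \<noteq> 0"
proof
  assume "cross3 a b = 0"
  then obtain s where "b = s *\<^sub>R a" using assms(1) by (auto simp: cross_eq_0 collinear_lemma)
  with assms show False using pline_scale by force
qed

text \<open>By the expansion of the triple product, every common zero of \<open>a\<close> and
  \<open>b\<close> is parallel to \<open>cross3 a b\<close>, which is nonzero for distinct
  lines.\<close>

lemma meet_unique:
  assumes "a \<noteq> 0" "b \<noteq> 0" "pline a \<noteq> pline b" "x \<noteq> 0"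
    and "a \<bullet> x = 0" "b \<bullet> x = 0" "a \<bullet> y = 0" "b \<bullet> y = 0"
  shows "\<exists>s. y = s *\<^sub>R x"
proof -
  have c: "cross3 a b \<noteq> 0" using pline_neqD assms by blast
  have *: "\<exists>s. z = s *\<^sub>R cross3 a b" if "a \<bullet> z = 0" "b \<bullet> z = 0" for z
  proof -
    have "cross3 (cross3 a b) z = (a \<bullet> z) *\<^sub>R b - (b \<bullet> z) *\<^sub>R a"
      by (simp add: cross3_simps forall_3)
    then have "cross3 (cross3 a b) z = 0" using that by simp
    then show ?thesis using c by (auto simp: cross_eq_0 collinear_lemma)
  qed
  obtain s s' where s: "x = s *\<^sub>R cross3 a b" "y = s' *\<^sub>R cross3 a b" using * assms by meson
  then have "y = (s' / s) *\<^sub>R x" using assms(4) by auto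
  then show ?thesis ..
qed

lemma meet_exists:
  assumes "a \<noteq> 0" "b \<noteq> 0" "pline a \<noteq> pline b"
  shows "\<exists>x. x \<noteq> 0 \<and> a \<bullet> x = 0 \<and> b \<bullet> x = 0"
  using pline_neqD[OF assms] dot_cross_self by blast

text \<open>Linear combinations of \<open>u\<close>, \<open>v\<close>, \<open>w\<close> are row
  vectors times the matrix with these rows; its inverse yields spanning and independence at
  once.\<close>

lemma det_basis:
  fixes u v w :: "real^3"
  assumes "det (vector [u, v, w]) \<noteq> 0"
  shows "\<exists>a b c. y = a *\<^sub>R u + b *\<^sub>R v + c *\<^sub>R w"
    and "a *\<^sub>R u + b *\<^sub>R v + c *\<^sub>R w = 0 \<Longrightarrow> a = 0 \<and> b = 0 \<and> c = 0"
proof -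
  let ?M = "vector [u, v, w] :: real^3^3"
  have vm: "z v* ?M = (z$1) *\<^sub>R u + (z$2) *\<^sub>R v + (z$3) *\<^sub>R w" for z
    by (simp add: vec_eq_iff vector_matrix_mult_def sum_3 vector_3 mult.commute)
  obtain B where B: "?M ** B = mat 1" "B ** ?M = mat 1"
    using assms invertible_det_nz[of ?M] by (auto simp: invertible_def)
  have "y = (y v* B) v* ?M" by (simp add: vector_matrix_mul_assoc B)
  then show "\<exists>a b c. y = a *\<^sub>R u + b *\<^sub>R v + c *\<^sub>R w" using vm by metis
  assume z: "a *\<^sub>R u + b *\<^sub>R v + c *\<^sub>R w = 0"
  have "vector [a, b, c] v* ?M = 0" using vm[of "vector [a,b,c]"] z by (simp add: vector_3)
  then have "(vector [a, b, c] v* ?M) v* B = 0" by simp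
  then have "vector [a, b, c] = (0 :: real^3)" by (simp add: vector_matrix_mul_assoc B)
  then show "a = 0 \<and> b = 0 \<and> c = 0" by (simp add: vec_eq_iff forall_3 vector_3)
qed

text \<open>Reduces conditions on all of \<open>cov A\<close> to finitely many, as openness of cones
  and small perturbations require.\<close>

lemma finite_cov_rep:
  assumes "line_arrangement A"
  shows "\<exists>G. finite G \<and> G \<subseteq> cov A \<and> (\<forall>f\<in>cov A. \<exists>g\<in>G. \<exists>s. s \<noteq> 0 \<and> f = s *\<^sub>R g)"
proof -
  have "\<forall>L\<in>A. \<exists>a. a \<noteq> 0 \<and> L = pline a"
    using assms by (auto simp: line_arrangement_def is_line_pline)
  then obtain h where h: "\<And>L. L \<in> A \<Longrightarrow> h L \<noteq> 0 \<and> L = pline (h L)" by metis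
  have "finite (h ` A)" using assms by (simp add: line_arrangement_def)
  moreover have "h ` A \<subseteq> cov A" using h by (auto simp: cov_def)
  moreover have "\<exists>g\<in>h ` A. \<exists>s. s \<noteq> 0 \<and> f = s *\<^sub>R g" if "f \<in> cov A" for f
  proof -
    have f: "f \<noteq> 0" "pline f \<in> A" using that by (auto simp: cov_def)
    then have "h (pline f) \<noteq> 0" "pline (h (pline f)) = pline f" using h by simp_all
    then have "\<exists>s. s \<noteq> 0 \<and> f = s *\<^sub>R h (pline f)" using pline_eq_iff f(1) by blast
    then show ?thesis using f(2) by blast
  qed
  ultimately show ?thesis by (intro exI[of _ "h ` A"] conjI ballI)
qed

section \<open>Cells as images of pairs of opposite open cones\<close>

definition cell_cone :: "rp2 set set \<Rightarrow> real^3 \<Rightarrow> (real^3) set" where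
  "cell_cone A x = {y. \<forall>f\<in>cov A. (f \<bullet> x) * (f \<bullet> y) > 0}"

lemma cov_nonempty:
  assumes "line_arrangement A" "A \<noteq> {}"
  shows "\<exists>f. f \<in> cov A"
proof -
  obtain L where "L \<in> A" using assms(2) by blast
  moreover from this obtain f where "f \<noteq> 0" "L = pline f"
    using assms(1) unfolding line_arrangement_def is_line_pline by blast
  ultimately show ?thesis unfolding cov_def by blast
qed

lemma convex_cell_cone: "convex (cell_cone A x)"
proof -
  have "convex {y. (f \<bullet> x) * (f \<bullet> y) > 0}" for f
  proof -
    have "{y. (f \<bullet> x) * (f \<bullet> y) > 0} = {y. ((f \<bullet> x) *\<^sub>R f) \<bullet> y > 0}" by simp
    then show ?thesis using convex_halfspace_gt by metis
  qed
  moreover have "cell_cone A x = (\<Inter>f\<in>cov A. {y. (f \<bullet> x) * (f \<bullet> y) > 0})"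
    by (auto simp: cell_cone_def)
  ultimately show ?thesis by (simp add: convex_INT)
qed

lemma open_cell_cone:
  assumes "line_arrangement A"
  shows "open (cell_cone A x)"
proof -
  obtain G where G: "finite G" "G \<subseteq> cov A" "\<forall>f\<in>cov A. \<exists>g\<in>G. \<exists>s. s \<noteq> 0 \<and> f = s *\<^sub>R g"
    using finite_cov_rep[OF assms] by blast
  have eq: "cell_cone A x = (\<Inter>g\<in>G. {y. (g \<bullet> x) * (g \<bullet> y) > 0})"
  proof (intro equalityI subsetI)
    fix y assume y: "y \<in> (\<Inter>g\<in>G. {y. (g \<bullet> x) * (g \<bullet> y) > 0})"
    have "(f \<bullet> x) * (f \<bullet> y) > 0" if f: "f \<in> cov A" for f
    proof -
      obtain g s where "g \<in> G" "s \<noteq> 0" "f = s *\<^sub>R g" using G f by blast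
      then have "(f \<bullet> x) * (f \<bullet> y) = (s * s) * ((g \<bullet> x) * (g \<bullet> y))" by simp
      moreover have "0 < s * s" using \<open>s \<noteq> 0\<close> by (simp add: zero_less_mult_iff) linarith
      ultimately show ?thesis using y \<open>g \<in> G\<close> by (simp add: zero_less_mult_iff)
    qed
    then show "y \<in> cell_cone A x" by (simp add: cell_cone_def)
  qed (use G in \<open>auto simp: cell_cone_def\<close>)
  have "open {y. (g \<bullet> x) * (g \<bullet> y) > 0}" for g
    by (intro open_Collect_less continuous_intros)
  then show ?thesis unfolding eq using G(1) by blast
qed

lemma continuous_on_proj: "S \<subseteq> - {0} \<Longrightarrow> continuous_on S proj"
proof (rule continuous_on_subset)
  show "continuous_on (- {0}) proj"
    unfolding continuous_on_open_vimage[OF open_Compl[OF closed_singleton]]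
  proof (intro allI impI)
    fix B :: "rp2 set" assume "open B"
    moreover have "proj -` B \<inter> - {0} = {x. x \<noteq> 0 \<and> proj x \<in> B}" by auto
    ultimately show "open (proj -` B \<inter> - {0})" by (simp add: open_rp2_def)
  qed
qed

lemma cell_cone_sym: "y \<in> cell_cone A x \<Longrightarrow> x \<in> cell_cone A y"
  by (simp add: cell_cone_def mult.commute)

lemma cell_cone_trans:
  assumes "y \<in> cell_cone A x" "z \<in> cell_cone A y"
  shows "z \<in> cell_cone A x"
  unfolding cell_cone_def
proof safe
  fix f assume "f \<in> cov A"
  then have "(f \<bullet> x) * (f \<bullet> y) > 0" "(f \<bullet> y) * (f \<bullet> z) > 0" using assms by (auto simp: cell_cone_def)
  then show "(f \<bullet> x) * (f \<bullet> z) > 0" by (auto simp: zero_less_mult_iff)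
qed

lemma cell_cone_uminus: "y \<in> cell_cone A (- x) \<longleftrightarrow> - y \<in> cell_cone A x"
  by (simp add: cell_cone_def)

lemma cell_cone_nonzero: 
  assumes "line_arrangement A" "A \<noteq> {}" 
  shows "0 \<notin> cell_cone A x"
  using cov_nonempty[OF assms] by (auto simp: cell_cone_def)

lemma cell_cone_scale:
  assumes "s > 0"
  shows "s *\<^sub>R y \<in> cell_cone A x \<longleftrightarrow> y \<in> cell_cone A x"
proof -
  have "(f \<bullet> x) * (f \<bullet> (s *\<^sub>R y)) = s * ((f \<bullet> x) * (f \<bullet> y))" for f by simp
  moreover have "s * a > 0 \<longleftrightarrow> a > 0" for a using assms by (simp add: zero_less_mult_iff)
  ultimately show ?thesis by (simp only: cell_cone_def mem_Collect_eq)
qed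

lemma self_in_cell_cone: "x \<in> cell_cone A x \<longleftrightarrow> (\<forall>f\<in>cov A. f \<bullet> x \<noteq> 0)"
proof -
  have "(a :: real) * a > 0 \<longleftrightarrow> a \<noteq> 0" for a by (metis not_real_square_gt_zero)
  then show ?thesis by (simp only: cell_cone_def mem_Collect_eq)
qed

lemma proj_minus: "y \<noteq> 0 \<Longrightarrow> proj (- y) = proj y"
  using proj_eq_iff[of "- y" y] by (auto intro!: exI[of _ "-1"])

lemma proj_in_cell_iff:
  assumes "line_arrangement A" "A \<noteq> {}" "y \<noteq> 0"
  shows "proj y \<in> proj ` cell_cone A x \<longleftrightarrow> y \<in> cell_cone A x \<or> - y \<in> cell_cone A x"
proof
  assume "proj y \<in> proj ` cell_cone A x"
  then obtain z where z: "z \<in> cell_cone A x" "proj z = proj y" by force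
  then have "z \<noteq> 0" using cell_cone_nonzero[OF assms(1,2)] by metis
  then obtain s where s: "s \<noteq> 0" "y = s *\<^sub>R z" using z proj_eq_iff assms(3) by metis
  show "y \<in> cell_cone A x \<or> - y \<in> cell_cone A x"
  proof (cases "s > 0")
    case True
    then show ?thesis using z s cell_cone_scale by blast
  next
    case False
    then have "- s > 0" "- y = (- s) *\<^sub>R z" using s by auto
    then show ?thesis using z cell_cone_scale by metis
  qed
next
  show "y \<in> cell_cone A x \<or> - y \<in> cell_cone A x \<Longrightarrow> proj y \<in> proj ` cell_cone A x"
    using proj_minus[OF assms(3)] by (metis imageI)
qed

lemma open_proj_cell:
  assumes "line_arrangement A" "A \<noteq> {}"
  shows "open (proj ` cell_cone A x)"
proof -
  have "{y. y \<noteq> 0 \<and> proj y \<in> proj ` cell_cone A x} = cell_cone A x \<union> cell_cone A (- x)"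
  proof (intro set_eqI)
    fix y
    show "y \<in> {y. y \<noteq> 0 \<and> proj y \<in> proj ` cell_cone A x} \<longleftrightarrow>
        y \<in> cell_cone A x \<union> cell_cone A (- x)"
      using proj_in_cell_iff[OF assms, of y x] cell_cone_nonzero[OF assms]
      by (cases "y = 0") (simp_all add: cell_cone_uminus)
  qed
  then show ?thesis unfolding open_rp2_def using open_cell_cone[OF assms(1)] by auto
qed

lemma proj_in_Union_iff:
  assumes "line_arrangement A" "y \<noteq> 0"
  shows "proj y \<in> \<Union>A \<longleftrightarrow> (\<exists>f\<in>cov A. f \<bullet> y = 0)"
proof
  assume "proj y \<in> \<Union>A"
  then obtain L where L: "L \<in> A" "proj y \<in> L" by blast
  then obtain f where "f \<noteq> 0" "L = pline f"
    using assms(1) unfolding line_arrangement_def is_line_pline by blast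
  then show "\<exists>f\<in>cov A. f \<bullet> y = 0"
    using L proj_in_pline[OF assms(2)] by (auto simp: cov_def)
next
  assume "\<exists>f\<in>cov A. f \<bullet> y = 0"
  then show "proj y \<in> \<Union>A" using proj_in_pline[OF assms(2)] by (auto simp: cov_def)
qed

text \<open>The images of the cones are open, connected and pairwise equal or disjoint. Hence the
  component of \<open>proj x\<close> cannot leave its cell for the union \<open>W\<close> of the
  others.\<close>

lemma component_eq_cell:
  assumes "line_arrangement A" "A \<noteq> {}" and x: "\<And>f. f \<in> cov A \<Longrightarrow> f \<bullet> x \<noteq> 0"
  shows "proj ` cell_cone A x \<in> components (UNIV - \<Union>A)"
proof -
  have xK: "x \<in> cell_cone A x" using x self_in_cell_cone by blast
  then have x0: "x \<noteq> 0" using cell_cone_nonzero[OF assms(1,2)] by metis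
  have compl: "proj y \<notin> \<Union>A \<longleftrightarrow> (\<forall>f\<in>cov A. f \<bullet> y \<noteq> 0)" if "y \<noteq> 0" for y
    unfolding proj_in_Union_iff[OF assms(1) that] by simp
  have sub: "proj ` cell_cone A x \<subseteq> UNIV - \<Union>A"
  proof safe
    fix y L assume y: "y \<in> cell_cone A x" and L: "proj y \<in> L" "L \<in> A"
    then have "y \<noteq> 0" using cell_cone_nonzero[OF assms(1,2)] by metis
    moreover have "\<forall>f\<in>cov A. f \<bullet> y \<noteq> 0" using y by (auto simp: cell_cone_def)
    ultimately show False using compl L by blast
  qed simp
  have con: "connected (proj ` cell_cone A x)"
    using convex_connected[OF convex_cell_cone] continuous_on_proj
      cell_cone_nonzero[OF assms(1,2)] connected_continuous_image by (metis ComplI singletonD subsetI)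
  have px: "proj x \<in> UNIV - \<Union>A" using sub xK by blast
  define C where "C = connected_component_set (UNIV - \<Union>A) (proj x)"
  have C: "C \<in> components (UNIV - \<Union>A)" using px unfolding C_def components_def by blast
  have CK: "proj ` cell_cone A x \<subseteq> C"
    unfolding C_def using connected_component_maximal[OF _ con sub] xK by blast
  define W where "W = \<Union>{proj ` cell_cone A y | y. y \<noteq> 0 \<and> proj y \<notin> proj ` cell_cone A x}"
  have W_open: "open W" unfolding W_def using open_proj_cell[OF assms(1,2)] by auto
  have C_sub: "C \<subseteq> proj ` cell_cone A x \<union> W"
  proof
    fix p assume "p \<in> C"
    then have "p \<notin> \<Union>A" unfolding C_def using connected_component_subset by fastforce
    obtain y where y: "y \<noteq> 0" "p = proj y" using proj_surj by blast
    then have "y \<in> cell_cone A y" unfolding self_in_cell_cone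
      using compl[OF y(1)] \<open>p \<notin> \<Union>A\<close> by simp
    then have py: "p \<in> proj ` cell_cone A y" using y(2) by simp
    show "p \<in> proj ` cell_cone A x \<union> W"
    proof (cases "p \<in> proj ` cell_cone A x")
      case False
      then have "proj ` cell_cone A y \<subseteq> W" unfolding W_def using y by blast
      then show ?thesis using py by blast
    qed simp
  qed
  \<comment> \<open>A common point puts \<open>y\<close> or \<open>- y\<close> into the cone of
    \<open>x\<close>; the projection forgets which of the two.\<close>
  have disj: "proj ` cell_cone A x \<inter> W = {}"
  proof -
    have False if yz: "y \<noteq> 0" "proj y \<notin> proj ` cell_cone A x" "z \<in> cell_cone A y"
      "proj z \<in> proj ` cell_cone A x" for y z
    proof -
      have "z \<noteq> 0" using yz(3) cell_cone_nonzero[OF assms(1,2)] by metis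
      then have z: "z \<in> cell_cone A x \<or> - z \<in> cell_cone A x"
        using yz(4) proj_in_cell_iff[OF assms(1,2)] by simp
      have "y \<in> cell_cone A z" using yz(3) cell_cone_sym by simp
      moreover have "- y \<in> cell_cone A (- z)" using calculation by (simp add: cell_cone_uminus)
      ultimately have "y \<in> cell_cone A x \<or> - y \<in> cell_cone A x"
        using z cell_cone_trans by metis
      then show False using yz(2) proj_in_cell_iff[OF assms(1,2) yz(1)] by simp
    qed
    then have *: "proj z \<notin> proj ` cell_cone A x" if "y \<noteq> 0" "proj y \<notin> proj ` cell_cone A x" "z \<in> cell_cone A y" for y z
      using that by metis
    have "p \<notin> proj ` cell_cone A x" if "p \<in> W" for p
      using that unfolding W_def by (auto dest: *)
    then show ?thesis by (simp only: disjoint_iff) metis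
  qed
  have "proj ` cell_cone A x \<inter> C = {} \<or> W \<inter> C = {}"
  proof (rule connectedD)
    show "connected C" unfolding C_def by (rule connected_connected_component)
    show "proj ` cell_cone A x \<inter> W \<inter> C = {}" using disj by simp
  qed (use open_proj_cell[OF assms(1,2)] W_open C_sub in simp_all)
  moreover have "proj x \<in> proj ` cell_cone A x \<inter> C" using xK CK by auto
  ultimately have "W \<inter> C = {}" by fastforce
  then have "C = proj ` cell_cone A x" using C_sub CK by (auto simp only:)
  then show ?thesis using C by simp
qed

definition pos_cone :: "real^3 \<Rightarrow> real^3 \<Rightarrow> real^3 \<Rightarrow> (real^3) set" where
  "pos_cone u v w = {a *\<^sub>R u + b *\<^sub>R v + c *\<^sub>R w | a b c. a > 0 \<and> b > 0 \<and> c > 0}"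

lemma is_triangle_iff:
  "is_triangle T \<longleftrightarrow> (\<exists>u v w. det (vector [u, v, w]) \<noteq> 0 \<and> T = proj ` pos_cone u v w)"
proof -
  have "proj ` pos_cone u v w = {proj (a *\<^sub>R u + b *\<^sub>R v + c *\<^sub>R w) | a b c. a > 0 \<and> b > 0 \<and> c > 0}" for u v w
    unfolding pos_cone_def by blast
  then show ?thesis by (simp only: is_triangle_def)
qed

text \<open>The hypothesis \<open>simplicial\<close> only equates projective images. The equality
  lifts to the cones once \<open>x\<close> is a positive combination of \<open>u\<close>,
  \<open>v\<close>, \<open>w\<close>; otherwise all three are negated.\<close>

lemma simplicial_cell_cone:
  assumes "line_arrangement A" "simplicial A" "A \<noteq> {}" and x: "\<And>f. f \<in> cov A \<Longrightarrow> f \<bullet> x \<noteq> 0"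
  obtains u v w where "det (vector [u, v, w]) \<noteq> 0"
    and "cell_cone A x = pos_cone u v w"
proof -
  let ?K = "cell_cone A x"
  have xK: "x \<in> ?K" using x self_in_cell_cone by blast
  have cone: "\<exists>u v w. det (vector [u, v, w]) \<noteq> 0 \<and> proj ` ?K = proj ` pos_cone u v w"
    using component_eq_cell[OF assms(1,3) x] assms(2) by (auto simp: simplicial_def is_triangle_iff)
  have T0: "0 \<notin> pos_cone u v w" if "det (vector [u, v, w]) \<noteq> 0" for u v w
    using det_basis(2)[OF that] by (auto simp: pos_cone_def)
  have main: "?K = pos_cone u v w" if d: "det (vector [u, v, w]) \<noteq> 0" and e: "proj ` ?K = proj ` pos_cone u v w"
     and xT: "x \<in> pos_cone u v w" for u v w
  proof
    have in_T: "y \<in> ?K \<or> - y \<in> ?K" if "y \<in> pos_cone u v w" for y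
      using proj_in_cell_iff[OF assms(1,3), of y x] that T0[OF d] e by (metis (no_types, lifting) imageI)
    have conv: "s *\<^sub>R y + t *\<^sub>R z \<in> pos_cone u v w" if yz: "y \<in> pos_cone u v w" "z \<in> pos_cone u v w" and st: "s > 0" "t > 0" for y z s t
    proof -
      obtain a b c a' b' c' where abc: "y = a *\<^sub>R u + b *\<^sub>R v + c *\<^sub>R w" "z = a' *\<^sub>R u + b' *\<^sub>R v + c' *\<^sub>R w"
        "a > 0" "b > 0" "c > 0" "a' > 0" "b' > 0" "c' > 0" using yz by (auto simp: pos_cone_def)
      have "s *\<^sub>R y + t *\<^sub>R z = (s*a+t*a') *\<^sub>R u + (s*b+t*b') *\<^sub>R v + (s*c+t*c') *\<^sub>R w"
        by (simp add: abc algebra_simps)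
      moreover have "s*a+t*a' > 0" "s*b+t*b' > 0" "s*c+t*c' > 0" using abc st by (simp_all add: add_pos_pos)
      ultimately show ?thesis unfolding pos_cone_def by blast
    qed
    obtain f where f: "f \<in> cov A" using cov_nonempty assms(1,3) by blast
    show TK: "pos_cone u v w \<subseteq> ?K"
    proof
      fix y assume y: "y \<in> pos_cone u v w"
      show "y \<in> ?K"
      proof (rule ccontr)
        assume "y \<notin> ?K"
        then have "(f \<bullet> x) * (f \<bullet> (- y)) > 0" using in_T[OF y] f by (auto simp: cell_cone_def)
        then have fs: "f \<bullet> x > 0 \<and> f \<bullet> y < 0 \<or> f \<bullet> x < 0 \<and> f \<bullet> y > 0"
          by (auto simp: zero_less_mult_iff mult_less_0_iff)
        \<comment> \<open>If \<open>y\<close> were in the opposite cone, the line \<open>f\<close>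
          would separate it from \<open>x\<close>, and this positive combination would be a point of
          the triangle on that line.\<close>
        define z where "z = \<bar>f \<bullet> y\<bar> *\<^sub>R x + \<bar>f \<bullet> x\<bar> *\<^sub>R y"
        have "z \<in> pos_cone u v w" unfolding z_def by (rule conv[OF xT y]) (use fs in auto)
        moreover have "f \<bullet> z = 0"
          unfolding z_def inner_add_right inner_scaleR_right using fs
          by (elim disjE) (simp_all add: mult.commute)
        ultimately show False using in_T[of z] f unfolding cell_cone_def by force
      qed
    qed
    show "?K \<subseteq> pos_cone u v w"
    proof
      fix y assume y: "y \<in> ?K"
      then have y0: "y \<noteq> 0" using cell_cone_nonzero[OF assms(1,3)] by metis
      have "proj y \<in> proj ` pos_cone u v w" using e y by blast
      then obtain z where z: "z \<in> pos_cone u v w" "proj z = proj y" by force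
      then have "z \<noteq> 0" using T0[OF d] by metis
      then obtain s where s: "s \<noteq> 0" "y = s *\<^sub>R z" using z y0 proj_eq_iff by metis
      have "z \<in> ?K" using z TK by blast
      then have "(f \<bullet> x) * (f \<bullet> z) > 0" "(f \<bullet> x) * (f \<bullet> y) > 0" using y f by (auto simp: cell_cone_def)
      moreover have "(f \<bullet> x) * (f \<bullet> y) = s * ((f \<bullet> x) * (f \<bullet> z))" using s by simp
      ultimately have "s > 0" by (metis zero_less_mult_pos2)
      obtain a b c where abc: "z = a *\<^sub>R u + b *\<^sub>R v + c *\<^sub>R w" "a > 0" "b > 0" "c > 0" using z by (auto simp: pos_cone_def)
      have "y = (s*a) *\<^sub>R u + (s*b) *\<^sub>R v + (s*c) *\<^sub>R w" using s abc by (simp add: algebra_simps)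
      moreover have "s*a > 0" "s*b > 0" "s*c > 0" using abc \<open>s > 0\<close> by auto
      ultimately show "y \<in> pos_cone u v w" unfolding pos_cone_def by blast
    qed
  qed
  obtain u v w where d: "det (vector [u, v, w]) \<noteq> 0" and e: "proj ` ?K = proj ` pos_cone u v w" using cone by blast
  have x0: "x \<noteq> 0" using xK cell_cone_nonzero[OF assms(1,3)] by metis
  have "proj x \<in> proj ` pos_cone u v w" using e xK by blast
  then obtain z where z: "z \<in> pos_cone u v w" "proj z = proj x" by force
  then have "z \<noteq> 0" using T0[OF d] by metis
  then obtain s where s: "s \<noteq> 0" "x = s *\<^sub>R z" using z x0 proj_eq_iff by metis
  obtain a b c where abc: "z = a *\<^sub>R u + b *\<^sub>R v + c *\<^sub>R w" "a > 0" "b > 0" "c > 0" using z by (auto simp: pos_cone_def)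
  show thesis
  proof (cases "s > 0")
    case True
    have "x = (s*a) *\<^sub>R u + (s*b) *\<^sub>R v + (s*c) *\<^sub>R w" using s abc by (simp add: algebra_simps)
    moreover have "s*a > 0" "s*b > 0" "s*c > 0" using abc True by auto
    ultimately have "x \<in> pos_cone u v w" unfolding pos_cone_def by blast
    then show ?thesis by (rule that[OF d main[OF d e]])
  next
    case False
    have "x = (-s*a) *\<^sub>R (-u) + (-s*b) *\<^sub>R (-v) + (-s*c) *\<^sub>R (-w)" using s abc by (simp add: algebra_simps)
    moreover have "-s*a > 0" "-s*b > 0" "-s*c > 0" using abc False s by (auto simp: mult_less_0_iff)
    ultimately have xT: "x \<in> pos_cone (-u) (-v) (-w)" unfolding pos_cone_def by blast
    have "det (vector [-u, -v, -w]) = - det (vector [u, v, w])"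
      by (simp add: det_3 vector_3)
    then have d': "det (vector [-u, -v, -w]) \<noteq> 0" using d by simp
    have "pos_cone (-u) (-v) (-w) = uminus ` pos_cone u v w"
    proof -
      have "a *\<^sub>R (-u) + b *\<^sub>R (-v) + c *\<^sub>R (-w) = - (a *\<^sub>R u + b *\<^sub>R v + c *\<^sub>R w)" for a b c
        by simp
      then have "pos_cone (-u) (-v) (-w) =
          {- (a *\<^sub>R u + b *\<^sub>R v + c *\<^sub>R w) | a b c. a > 0 \<and> b > 0 \<and> c > 0}"
        unfolding pos_cone_def by (simp only:)
      then show ?thesis unfolding pos_cone_def by blast
    qed
    then have "proj ` pos_cone (-u) (-v) (-w) = (\<lambda>y. proj (- y)) ` pos_cone u v w" by (simp only: image_image)
    also have "\<dots> = proj ` pos_cone u v w"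
    proof (rule image_cong[OF refl])
      fix y assume "y \<in> pos_cone u v w"
      then have "y \<noteq> 0" using T0[OF d] by metis
      then show "proj (- y) = proj y" by (rule proj_minus)
    qed
    finally have e': "proj ` ?K = proj ` pos_cone (-u) (-v) (-w)" using e by simp
    show ?thesis by (rule that[OF d' main[OF d' e' xT]])
  qed
qed

section \<open>Corners of a triangular cell\<close>

lemma det_basis_unique:
  fixes u v w :: "real^3"
  assumes "det (vector [u, v, w]) \<noteq> 0"
    and "a *\<^sub>R u + b *\<^sub>R v + c *\<^sub>R w = a' *\<^sub>R u + b' *\<^sub>R v + c' *\<^sub>R w"
  shows "a = a' \<and> b = b' \<and> c = c'"
proof -
  have "(a - a') *\<^sub>R u + (b - b') *\<^sub>R v + (c - c') *\<^sub>R w = 0"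
    using assms(2) by (simp add: algebra_simps)
  then show ?thesis using det_basis(2)[OF assms(1)] by fastforce
qed

text \<open>An elementary form of letting \<open>e\<close> tend to 0, for passing from open to
  closed cones.\<close>

lemma nonneg_if_perturbed_pos:
  fixes p q :: real
  assumes "\<And>e. e > 0 \<Longrightarrow> p + e * q > 0"
  shows "p \<ge> 0"
proof (rule field_le_epsilon)
  fix e :: real assume e: "e > 0"
  show "0 \<le> p + e"
  proof (cases "q > 0")
    case True
    then show ?thesis using assms[of "e / q"] e by simp
  next
    case False
    then show ?thesis using assms[of 1] e by simp
  qed
qed

text \<open>For \<open>x\<close> off all lines, this is the closure of
  \<open>cell_cone A x\<close>.\<close>

definition closed_cell :: "rp2 set set \<Rightarrow> real^3 \<Rightarrow> (real^3) set" where
  "closed_cell A x = {y. \<forall>f\<in>cov A. (f \<bullet> x) * (f \<bullet> y) \<ge> 0}"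

lemma closed_cellD: "y \<in> closed_cell A x \<Longrightarrow> f \<in> cov A \<Longrightarrow> (f \<bullet> x) * (f \<bullet> y) \<ge> 0"
  by (simp add: closed_cell_def)

locale cell_triangle =
  fixes A x u v w
  assumes det_nz: "det (vector [u, v, w :: real^3]) \<noteq> 0"
    and cell: "cell_cone A x = pos_cone u v w"
    and off: "\<And>f. f \<in> cov A \<Longrightarrow> f \<bullet> x \<noteq> 0"
begin

lemma in_cell: "a > 0 \<Longrightarrow> b > 0 \<Longrightarrow> c > 0 \<Longrightarrow> f \<in> cov A \<Longrightarrow>
    (f \<bullet> x) * (f \<bullet> (a *\<^sub>R u + b *\<^sub>R v + c *\<^sub>R w)) > 0"
proof -
  assume "a > 0" "b > 0" "c > 0" "f \<in> cov A"
  then have "a *\<^sub>R u + b *\<^sub>R v + c *\<^sub>R w \<in> cell_cone A x" unfolding cell pos_cone_def by blast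
  then show ?thesis using \<open>f \<in> cov A\<close> by (simp only: cell_cone_def mem_Collect_eq)
qed

lemma corners: "u \<in> closed_cell A x" "v \<in> closed_cell A x" "w \<in> closed_cell A x"
proof -
  have "(f \<bullet> x) * (f \<bullet> u) \<ge> 0 \<and> (f \<bullet> x) * (f \<bullet> v) \<ge> 0 \<and> (f \<bullet> x) * (f \<bullet> w) \<ge> 0" if f: "f \<in> cov A" for f
  proof (intro conjI)
    \<comment> \<open>\<open>u\<close> is approached from inside the cone by
      \<open>u + e *\<^sub>R (v + w)\<close>, and likewise for the other corners.\<close>
    have "(f \<bullet> x) * (f \<bullet> u) + e * ((f \<bullet> x) * (f \<bullet> (v + w))) > 0" if "e > 0" for e
      using in_cell[of 1 e e f] that f by (simp add: inner_add_right algebra_simps)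
    then show "(f \<bullet> x) * (f \<bullet> u) \<ge> 0" by (rule nonneg_if_perturbed_pos)
    have "(f \<bullet> x) * (f \<bullet> v) + e * ((f \<bullet> x) * (f \<bullet> (u + w))) > 0" if "e > 0" for e
      using in_cell[of e 1 e f] that f by (simp add: inner_add_right algebra_simps)
    then show "(f \<bullet> x) * (f \<bullet> v) \<ge> 0" by (rule nonneg_if_perturbed_pos)
    have "(f \<bullet> x) * (f \<bullet> w) + e * ((f \<bullet> x) * (f \<bullet> (u + v))) > 0" if "e > 0" for e
      using in_cell[of e e 1 f] that f by (simp add: inner_add_right algebra_simps)
    then show "(f \<bullet> x) * (f \<bullet> w) \<ge> 0" by (rule nonneg_if_perturbed_pos)
  qed
  then show "u \<in> closed_cell A x" "v \<in> closed_cell A x" "w \<in> closed_cell A x"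
    by (simp_all only: closed_cell_def mem_Collect_eq) metis+
qed

text \<open>Adding \<open>e *\<^sub>R x\<close> moves \<open>P\<close> into the open cone, where all
  coordinates are positive; then \<open>e\<close> tends to 0.\<close>

lemma closed_cell_coords:
  assumes "P \<in> closed_cell A x"
  shows "\<exists>a b c. a \<ge> 0 \<and> b \<ge> 0 \<and> c \<ge> 0 \<and> P = a *\<^sub>R u + b *\<^sub>R v + c *\<^sub>R w"
proof -
  obtain a b c where P: "P = a *\<^sub>R u + b *\<^sub>R v + c *\<^sub>R w" using det_basis(1)[OF det_nz] by metis
  have "x \<in> pos_cone u v w" using off self_in_cell_cone[of x A] cell by simp
  then obtain a' b' c' where x: "x = a' *\<^sub>R u + b' *\<^sub>R v + c' *\<^sub>R w"
    by (auto simp: pos_cone_def)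
  have "a + e * a' > 0 \<and> b + e * b' > 0 \<and> c + e * c' > 0" if e: "e > 0" for e
  proof -
    have "(f \<bullet> x) * (f \<bullet> (P + e *\<^sub>R x)) > 0" if f: "f \<in> cov A" for f
    proof -
      have "(f \<bullet> x) * (f \<bullet> (P + e *\<^sub>R x)) = (f \<bullet> x) * (f \<bullet> P) + e * ((f \<bullet> x) * (f \<bullet> x))"
        by (simp add: inner_add_right algebra_simps)
      moreover have "(f \<bullet> x) * (f \<bullet> x) > 0" using off[OF f] by (metis not_real_square_gt_zero)
      ultimately show ?thesis using closed_cellD[OF assms f] e by (simp add: add_nonneg_pos)
    qed
    then have "P + e *\<^sub>R x \<in> pos_cone u v w" unfolding cell[symmetric] cell_cone_def by simp
    then obtain a'' b'' c'' where *: "P + e *\<^sub>R x = a'' *\<^sub>R u + b'' *\<^sub>R v + c'' *\<^sub>R w"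
      "a'' > 0" "b'' > 0" "c'' > 0" by (auto simp: pos_cone_def)
    have "P + e *\<^sub>R x = (a + e * a') *\<^sub>R u + (b + e * b') *\<^sub>R v + (c + e * c') *\<^sub>R w"
      by (simp add: P x algebra_simps)
    then show ?thesis using det_basis_unique[OF det_nz, of a'' b'' c''] * by metis
  qed
  then have "a \<ge> 0" "b \<ge> 0" "c \<ge> 0" using nonneg_if_perturbed_pos by metis+
  then show ?thesis using P by blast
qed

lemma common_zero_coords:
  assumes "f1 \<in> cov A" "f2 \<in> cov A" "pline f1 \<noteq> pline f2"
    and "y \<noteq> 0" "f1 \<bullet> y = 0" "f2 \<bullet> y = 0" "f1 \<bullet> z = 0" "f2 \<bullet> z = 0"
  shows "\<exists>s. z = s *\<^sub>R y"
  using meet_unique[of f1 f2 y z] assms by (simp add: cov_def)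

text \<open>A line through \<open>P\<close> vanishes at every corner with positive coefficient,
  because the signed values at the corners are nonnegative and their weighted sum is 0. Two distinct
  lines cannot share two independent zeros, so only one coefficient is positive.\<close>

lemma vertex_is_corner:
  assumes "P \<in> closed_cell A x" "P \<noteq> 0"
    and f: "f1 \<in> cov A" "f2 \<in> cov A" "pline f1 \<noteq> pline f2" "f1 \<bullet> P = 0" "f2 \<bullet> P = 0"
  shows "\<exists>s>0. P = s *\<^sub>R u \<or> P = s *\<^sub>R v \<or> P = s *\<^sub>R w"
proof -
  obtain a b c where abc: "a \<ge> 0" "b \<ge> 0" "c \<ge> 0" "P = a *\<^sub>R u + b *\<^sub>R v + c *\<^sub>R w"
    using closed_cell_coords[OF assms(1)] by metis
  have zero: "(a > 0 \<longrightarrow> g \<bullet> u = 0) \<and> (b > 0 \<longrightarrow> g \<bullet> v = 0) \<and> (c > 0 \<longrightarrow> g \<bullet> w = 0)"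
    if g: "g \<in> cov A" "g \<bullet> P = 0" for g
  proof -
    have "(g \<bullet> x) * (g \<bullet> P) = a * ((g \<bullet> x) * (g \<bullet> u)) + b * ((g \<bullet> x) * (g \<bullet> v)) + c * ((g \<bullet> x) * (g \<bullet> w))"
      by (simp add: abc inner_add_right algebra_simps)
    then have "a * ((g \<bullet> x) * (g \<bullet> u)) + b * ((g \<bullet> x) * (g \<bullet> v)) + c * ((g \<bullet> x) * (g \<bullet> w)) = 0"
      using g by simp
    moreover have "a * ((g \<bullet> x) * (g \<bullet> u)) \<ge> 0" "b * ((g \<bullet> x) * (g \<bullet> v)) \<ge> 0" "c * ((g \<bullet> x) * (g \<bullet> w)) \<ge> 0"
      using abc(1-3) corners[THEN closed_cellD, OF g(1)] by simp_all
    ultimately have "a * ((g \<bullet> x) * (g \<bullet> u)) = 0" "b * ((g \<bullet> x) * (g \<bullet> v)) = 0" "c * ((g \<bullet> x) * (g \<bullet> w)) = 0"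
      by linarith+
    then show ?thesis using off[OF g(1)] by auto
  qed
  have nz: "u \<noteq> 0" "v \<noteq> 0" "w \<noteq> 0"
    using det_basis(2)[OF det_nz, of 1 0 0] det_basis(2)[OF det_nz, of 0 1 0] det_basis(2)[OF det_nz, of 0 0 1]
    by auto
  have "\<not> (a > 0 \<and> b > 0)"
  proof
    assume "a > 0 \<and> b > 0"
    then have "\<exists>s. v = s *\<^sub>R u" using common_zero_coords[OF f(1-3) nz(1)] zero f by simp
    then obtain s where "v = s *\<^sub>R u" by blast
    then show False using det_basis(2)[OF det_nz, of s "-1" 0] by simp
  qed
  moreover have "\<not> (a > 0 \<and> c > 0)"
  proof
    assume "a > 0 \<and> c > 0"
    then have "\<exists>s. w = s *\<^sub>R u" using common_zero_coords[OF f(1-3) nz(1)] zero f by simp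
    then obtain s where "w = s *\<^sub>R u" by blast
    then show False using det_basis(2)[OF det_nz, of s 0 "-1"] by simp
  qed
  moreover have "\<not> (b > 0 \<and> c > 0)"
  proof
    assume "b > 0 \<and> c > 0"
    then have "\<exists>s. w = s *\<^sub>R v" using common_zero_coords[OF f(1-3) nz(2)] zero f by simp
    then obtain s where "w = s *\<^sub>R v" by blast
    then show False using det_basis(2)[OF det_nz, of 0 s "-1"] by simp
  qed
  moreover have "\<not> (a = 0 \<and> b = 0 \<and> c = 0)" using abc assms(2) by auto
  ultimately consider "a > 0" "b = 0" "c = 0" | "b > 0" "a = 0" "c = 0" | "c > 0" "a = 0" "b = 0"
    using abc(1-3) by linarith
  then show ?thesis
  proof cases
    case 1 then show ?thesis using abc(4) by (intro exI[of _ a]) simp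
  next
    case 2 then show ?thesis using abc(4) by (intro exI[of _ b]) simp
  next
    case 3 then show ?thesis using abc(4) by (intro exI[of _ c]) simp
  qed
qed

lemma facet_vanishing:
  assumes "y \<in> closed_cell A x" "y \<notin> pos_cone u v w"
  shows "\<exists>f\<in>cov A. f \<bullet> y = 0"
proof (rule ccontr)
  assume *: "\<not> (\<exists>f\<in>cov A. f \<bullet> y = 0)"
  have "(f \<bullet> x) * (f \<bullet> y) > 0" if f: "f \<in> cov A" for f
  proof -
    have "(f \<bullet> x) * (f \<bullet> y) \<noteq> 0" using f off * by simp
    then show ?thesis using closed_cellD[OF assms(1) f] by (metis order_le_less)
  qed
  then have "y \<in> cell_cone A x" by (simp add: cell_cone_def)
  then show False using assms(2) cell by simp
qed

lemma not_in_pos_cone: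
  assumes "a *\<^sub>R u + b *\<^sub>R v + c *\<^sub>R w \<in> pos_cone u v w"
  shows "a > 0 \<and> b > 0 \<and> c > 0"
proof -
  obtain a' b' c' where "a *\<^sub>R u + b *\<^sub>R v + c *\<^sub>R w = a' *\<^sub>R u + b' *\<^sub>R v + c' *\<^sub>R w"
      "a' > 0" "b' > 0" "c' > 0" using assms unfolding pos_cone_def by blast
  then show ?thesis using det_basis_unique[OF det_nz] by metis
qed

end

lemma simplicial_cell_triangle:
  assumes "line_arrangement A" "simplicial A" "A \<noteq> {}" "\<And>f. f \<in> cov A \<Longrightarrow> f \<bullet> x \<noteq> 0"
  shows "\<exists>u v w. cell_triangle A x u v w"
  using simplicial_cell_cone[OF assms] assms(4) unfolding cell_triangle_def by metis

text \<open>\<open>P\<close> and \<open>Q\<close> would be corners of the triangular cell of \<open>P + Q\<close>, but the open segment joining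
  two corners of a triangle lies on its boundary.\<close>

lemma adjacent_vertices_impossible:
  assumes A: "line_arrangement A" "simplicial A" "A \<noteq> {}"
    and PQ: "P \<noteq> 0" "Q \<noteq> 0"
    and same: "\<And>f. f \<in> cov A \<Longrightarrow> (f \<bullet> P) * (f \<bullet> Q) \<ge> 0"
    and off: "\<And>f. f \<in> cov A \<Longrightarrow> f \<bullet> (P + Q) \<noteq> 0"
    and f: "f1 \<in> cov A" "f2 \<in> cov A" "pline f1 \<noteq> pline f2" "f1 \<bullet> P = 0" "f2 \<bullet> P = 0"
    and g: "g1 \<in> cov A" "g2 \<in> cov A" "pline g1 \<noteq> pline g2" "g1 \<bullet> Q = 0" "g2 \<bullet> Q = 0"
  shows False
proof -
  obtain u v w where "cell_triangle A (P + Q) u v w"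
    using simplicial_cell_triangle[OF A off] by metis
  then interpret cell_triangle A "P + Q" u v w .
  have "P \<in> closed_cell A (P + Q)" "Q \<in> closed_cell A (P + Q)"
    using same by (simp_all add: closed_cell_def inner_add_right algebra_simps)
  then obtain s t where s: "s > 0" "P = s *\<^sub>R u \<or> P = s *\<^sub>R v \<or> P = s *\<^sub>R w"
    and t: "t > 0" "Q = t *\<^sub>R u \<or> Q = t *\<^sub>R v \<or> Q = t *\<^sub>R w"
    using vertex_is_corner[OF _ PQ(1) f] vertex_is_corner[OF _ PQ(2) g] by metis
  have "P + Q \<in> pos_cone u v w" using self_in_cell_cone[of "P + Q" A] off cell by simp
  then obtain a b c where abc: "P + Q = a *\<^sub>R u + b *\<^sub>R v + c *\<^sub>R w" "a > 0" "b > 0" "c > 0"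
    unfolding pos_cone_def by blast
  have coords: "a' > 0 \<and> b' > 0 \<and> c' > 0" if "P + Q = a' *\<^sub>R u + b' *\<^sub>R v + c' *\<^sub>R w" for a' b' c'
    using det_basis_unique[OF det_nz trans[OF that[symmetric] abc(1)]] abc(2-4) by simp
  \<comment> \<open>Whichever corners \<open>P\<close> and \<open>Q\<close> are, some coordinate of
    \<open>P + Q\<close> is 0.\<close>
  consider "P + Q = (s + t) *\<^sub>R u + 0 *\<^sub>R v + 0 *\<^sub>R w" | "P + Q = s *\<^sub>R u + t *\<^sub>R v + 0 *\<^sub>R w"
    | "P + Q = s *\<^sub>R u + 0 *\<^sub>R v + t *\<^sub>R w" | "P + Q = t *\<^sub>R u + s *\<^sub>R v + 0 *\<^sub>R w"
    | "P + Q = 0 *\<^sub>R u + (s + t) *\<^sub>R v + 0 *\<^sub>R w" | "P + Q = 0 *\<^sub>R u + s *\<^sub>R v + t *\<^sub>R w"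
    | "P + Q = t *\<^sub>R u + 0 *\<^sub>R v + s *\<^sub>R w" | "P + Q = 0 *\<^sub>R u + t *\<^sub>R v + s *\<^sub>R w"
    | "P + Q = 0 *\<^sub>R u + 0 *\<^sub>R v + (s + t) *\<^sub>R w"
    using s(2) t(2) by (elim disjE) (simp_all add: scaleR_add_left)
  then show False by cases (drule coords; simp)+
qed

lemma pos_cone_swap: "pos_cone u v w = pos_cone v u w" "pos_cone u v w = pos_cone w v u"
proof -
  have "a *\<^sub>R u + b *\<^sub>R v + c *\<^sub>R w = b *\<^sub>R v + a *\<^sub>R u + c *\<^sub>R w"
    "a *\<^sub>R u + b *\<^sub>R v + c *\<^sub>R w = c *\<^sub>R w + b *\<^sub>R v + a *\<^sub>R u" for a b c by (simp_all add: ac_simps)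
  then show "pos_cone u v w = pos_cone v u w" "pos_cone u v w = pos_cone w v u"
    unfolding pos_cone_def by (intro set_eqI; simp only: mem_Collect_eq; metis)+
qed

lemma pos_cone_scale:
  assumes "s > 0"
  shows "pos_cone (s *\<^sub>R u) v w = pos_cone u v w"
proof -
  have 1: "y \<in> pos_cone (s *\<^sub>R u) v w \<Longrightarrow> y \<in> pos_cone u v w" if "s > 0" for s u y
  proof -
    assume "y \<in> pos_cone (s *\<^sub>R u) v w"
    then obtain a b c where "y = (a * s) *\<^sub>R u + b *\<^sub>R v + c *\<^sub>R w" "a > 0" "b > 0" "c > 0"
      by (auto simp: pos_cone_def)
    moreover have "a * s > 0" using that calculation by simp
    ultimately show "y \<in> pos_cone u v w" unfolding pos_cone_def by blast
  qed
  have "y \<in> pos_cone (s *\<^sub>R u) v w" if "y \<in> pos_cone u v w" for y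
    using 1[of "1 / s" y "s *\<^sub>R u"] assms that by simp
  then show ?thesis using 1[OF assms] by (intro set_eqI iffI)
qed

lemma det_vector_swap:
  fixes u v w :: "real^3"
  shows "det (vector [v, u, w]) = - det (vector [u, v, w])"
    "det (vector [w, v, u]) = - det (vector [u, v, w])"
    "det (vector [s *\<^sub>R u, v, w]) = s * det (vector [u, v, w])"
  by (simp_all add: det_3 vector_3 algebra_simps)

text \<open>Permuting and rescaling the generators makes \<open>P\<close> itself the first one; a
  swap changes the determinant only by its sign.\<close>

lemma cell_triangle_at_vertex:
  assumes A: "line_arrangement A" "simplicial A" "A \<noteq> {}" "\<And>f. f \<in> cov A \<Longrightarrow> f \<bullet> x \<noteq> 0"
    and P: "P \<in> closed_cell A x" "P \<noteq> 0"
    and f: "f1 \<in> cov A" "f2 \<in> cov A" "pline f1 \<noteq> pline f2" "f1 \<bullet> P = 0" "f2 \<bullet> P = 0"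
  shows "\<exists>v w. cell_triangle A x P v w"
proof -
  obtain u v w where "cell_triangle A x u v w"
    using simplicial_cell_triangle[OF A] by metis
  then interpret cell_triangle A x u v w .
  obtain s where s: "s > 0" "P = s *\<^sub>R u \<or> P = s *\<^sub>R v \<or> P = s *\<^sub>R w"
    using vertex_is_corner[OF P f] by metis
  consider "P = s *\<^sub>R u" | "P = s *\<^sub>R v" | "P = s *\<^sub>R w" using s(2) by blast
  then show ?thesis
  proof cases
    case 1
    have "det (vector [P, v, w]) \<noteq> 0"
      unfolding 1 det_vector_swap(3) using s(1) det_nz by simp
    moreover have "cell_cone A x = pos_cone P v w"
      unfolding 1 pos_cone_scale[OF s(1)] by (rule cell)
    ultimately show ?thesis using off unfolding cell_triangle_def by metis
  next
    case 2
    have "det (vector [P, u, w]) \<noteq> 0"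
      unfolding 2 det_vector_swap(3) det_vector_swap(1)[of v u] using s(1) det_nz by simp
    moreover have "cell_cone A x = pos_cone P u w"
      unfolding 2 pos_cone_scale[OF s(1)] cell by (rule pos_cone_swap(1))
    ultimately show ?thesis using off unfolding cell_triangle_def by metis
  next
    case 3
    have "det (vector [P, v, u]) \<noteq> 0"
      unfolding 3 det_vector_swap(3) det_vector_swap(2)[of w v u] using s(1) det_nz by simp
    moreover have "cell_cone A x = pos_cone P v u"
      unfolding 3 pos_cone_scale[OF s(1)] cell by (rule pos_cone_swap(2))
    ultimately show ?thesis using off unfolding cell_triangle_def by metis
  qed
qed

text \<open>Serves to choose a direction into any prescribed sector formed by \<open>l\<close> and
  \<open>n\<close>.\<close>

lemma exists_prescribed_values:
  fixes l n :: "real^3"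
  assumes "l \<noteq> 0" "n \<noteq> 0" "pline l \<noteq> pline n"
  shows "\<exists>y. l \<bullet> y = a \<and> n \<bullet> y = b"
proof -
  have 1: "\<exists>y. p \<bullet> y = 1 \<and> q \<bullet> y = 0" if "p \<noteq> 0" "q \<noteq> 0" "pline p \<noteq> pline q" for p q
  proof -
    have "\<exists>y. q \<bullet> y = 0 \<and> p \<bullet> y \<noteq> 0"
    proof (rule ccontr)
      assume "\<nexists>y. q \<bullet> y = 0 \<and> p \<bullet> y \<noteq> 0"
      then obtain s where "p = s *\<^sub>R q" using pline_subset_imp[of q p] \<open>q \<noteq> 0\<close> by metis
      then show False using that pline_scale by force
    qed
    then obtain y where "q \<bullet> y = 0" "p \<bullet> y \<noteq> 0" by metis
    then show ?thesis by (intro exI[of _ "(1 / (p \<bullet> y)) *\<^sub>R y"]) simp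
  qed
  obtain y z where "l \<bullet> y = 1" "n \<bullet> y = 0" "n \<bullet> z = 1" "l \<bullet> z = 0"
    using 1[OF assms] 1[OF assms(2,1)] assms(3) by metis
  then show ?thesis by (intro exI[of _ "a *\<^sub>R y + b *\<^sub>R z"]) (simp add: inner_add_right)
qed

text \<open>On a short step away from \<open>P\<close> only lines through \<open>P\<close> can be
  met; finitely many representatives allow one common step size.\<close>

lemma perturbed_point:
  assumes "line_arrangement A"
  shows "\<exists>e>0. \<forall>f\<in>cov A. f \<bullet> P \<noteq> 0 \<longrightarrow> (f \<bullet> P) * (f \<bullet> (P + e *\<^sub>R y)) > 0"
proof -
  obtain G where G: "finite G" "G \<subseteq> cov A" "\<forall>f\<in>cov A. \<exists>g\<in>G. \<exists>s. s \<noteq> 0 \<and> f = s *\<^sub>R g"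
    using finite_cov_rep[OF assms] by metis
  have "eventually (\<lambda>e. g \<bullet> P \<noteq> 0 \<longrightarrow> (g \<bullet> P) * (g \<bullet> (P + e *\<^sub>R y)) > 0) (at_right 0)" for g
  proof (cases "g \<bullet> P = 0")
    case False
    have "((\<lambda>e. (g \<bullet> P) * (g \<bullet> (P + e *\<^sub>R y))) \<longlongrightarrow> (g \<bullet> P) * (g \<bullet> (P + 0 *\<^sub>R y))) (at_right 0)"
      by (intro tendsto_intros)
    moreover have "(g \<bullet> P) * (g \<bullet> (P + 0 *\<^sub>R y)) > 0"
      using False by (simp) (metis not_real_square_gt_zero)
    ultimately have "eventually (\<lambda>e. (g \<bullet> P) * (g \<bullet> (P + e *\<^sub>R y)) > 0) (at_right 0)"
      by (rule order_tendstoD(1))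
    then show ?thesis by (rule eventually_mono) simp
  qed simp
  then have "eventually (\<lambda>e. \<forall>g\<in>G. g \<bullet> P \<noteq> 0 \<longrightarrow> (g \<bullet> P) * (g \<bullet> (P + e *\<^sub>R y)) > 0) (at_right 0)"
    using G(1) by (simp add: eventually_ball_finite)
  then have "eventually (\<lambda>e. 0 < e \<and> (\<forall>g\<in>G. g \<bullet> P \<noteq> 0 \<longrightarrow> (g \<bullet> P) * (g \<bullet> (P + e *\<^sub>R y)) > 0)) (at_right (0::real))"
    using eventually_at_right_less by (rule eventually_conj[rotated])
  then obtain e :: real where e: "e > 0" "\<forall>g\<in>G. g \<bullet> P \<noteq> 0 \<longrightarrow> (g \<bullet> P) * (g \<bullet> (P + e *\<^sub>R y)) > 0"
    using eventually_happens trivial_limit_at_right_real by blast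
  have "(f \<bullet> P) * (f \<bullet> (P + e *\<^sub>R y)) > 0" if f: "f \<in> cov A" "f \<bullet> P \<noteq> 0" for f
  proof -
    obtain g s where g: "g \<in> G" "s \<noteq> 0" "f = s *\<^sub>R g" using G(3) f(1) by metis
    then have "g \<bullet> P \<noteq> 0" using f(2) by auto
    then have "(g \<bullet> P) * (g \<bullet> (P + e *\<^sub>R y)) > 0" using e(2) g by simp
    moreover have "(f \<bullet> P) * (f \<bullet> (P + e *\<^sub>R y)) = (s * s) * ((g \<bullet> P) * (g \<bullet> (P + e *\<^sub>R y)))"
      using g(3) by simp
    moreover have "s * s > 0" using g(2) by (metis not_real_square_gt_zero)
    ultimately show ?thesis by (metis mult_pos_pos)
  qed
  then show ?thesis using e(1) by blast
qed

section \<open>The neighbourhood of a double point\<close>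

text \<open>In the applications \<open>l\<close> is an additional line and \<open>n\<close> an axis
  or a side of the polygon.\<close>

locale double_point =
  fixes A l n P
  assumes arr: "line_arrangement A" and smp: "simplicial A"
    and l: "l \<in> cov A" and n: "n \<in> cov A" and ln: "pline l \<noteq> pline n"
    and P: "P \<noteq> 0" and lP: "l \<bullet> P = 0" and nP: "n \<bullet> P = 0"
    and only: "\<And>f. f \<in> cov A \<Longrightarrow> f \<bullet> P = 0 \<Longrightarrow> pline f = pline l \<or> pline f = pline n"
begin

lemma nonempty: "A \<noteq> {}"
  using l by (auto simp: cov_def)

lemma nz: "l \<noteq> 0" "n \<noteq> 0"
  using l n by (auto simp: cov_def)

lemma proportional_to:
  assumes "f \<in> cov A" "g \<in> cov A" "pline f = pline g"
  shows "\<exists>s. s \<noteq> 0 \<and> f = s *\<^sub>R g"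
  using assms pline_eq_iff[of g f] unfolding cov_def by simp

text \<open>The signs select one of the four sectors at \<open>P\<close>. A small step into it
  reaches a cell with corner \<open>P\<close>; as only \<open>l\<close> and \<open>n\<close> pass
  through \<open>P\<close>, the other corners \<open>U\<close> and \<open>Y\<close> lie on them, and
  \<open>\<mu>\<close> is the side opposite to \<open>P\<close>. Prescribing
  \<open>n \<bullet> U\<close> and \<open>l \<bullet> Y\<close> determines the two vectors up to
  multiples of \<open>P\<close>.\<close>

lemma quadrant:
  assumes "\<sigma> * \<sigma> = (1::real)" "\<tau> * \<tau> = (1::real)"
  shows "\<exists>U Y \<mu>. l \<bullet> U = 0 \<and> n \<bullet> U = \<sigma> \<and> n \<bullet> Y = 0 \<and> l \<bullet> Y = \<tau> \<and>
    \<mu> \<in> cov A \<and> \<mu> \<bullet> U = 0 \<and> \<mu> \<bullet> Y = 0 \<and> \<mu> \<bullet> P = 1 \<and>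
    (\<forall>f\<in>cov A. (f \<bullet> P) * (f \<bullet> U) \<ge> 0 \<and> (f \<bullet> P) * (f \<bullet> Y) \<ge> 0)"
proof -
  obtain y where y: "l \<bullet> y = \<tau>" "n \<bullet> y = \<sigma>" using exists_prescribed_values[OF nz ln] by metis
  obtain e where e: "e > 0" "\<And>f. f \<in> cov A \<Longrightarrow> f \<bullet> P \<noteq> 0 \<Longrightarrow> (f \<bullet> P) * (f \<bullet> (P + e *\<^sub>R y)) > 0"
    using perturbed_point[OF arr] by metis
  define x where "x = P + e *\<^sub>R y"
  have lx: "l \<bullet> x = e * \<tau>" and nx: "n \<bullet> x = e * \<sigma>"
    using y lP nP by (simp_all add: x_def inner_add_right)
  have st: "\<sigma> \<noteq> 0" "\<tau> \<noteq> 0" using assms by auto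
  have off: "f \<bullet> x \<noteq> 0" if f: "f \<in> cov A" for f
  proof (cases "f \<bullet> P = 0")
    case True
    then have "(\<exists>s. s \<noteq> 0 \<and> f = s *\<^sub>R l) \<or> (\<exists>s. s \<noteq> 0 \<and> f = s *\<^sub>R n)"
      using only[OF f] proportional_to[OF f l] proportional_to[OF f n] by metis
    then show ?thesis using lx nx e(1) st by auto
  next
    case False
    then show ?thesis using e(2)[OF f] unfolding x_def by (metis mult_zero_right less_irrefl)
  qed
  have Pc: "P \<in> closed_cell A x"
    unfolding closed_cell_def
  proof safe
    fix f assume f: "f \<in> cov A"
    show "0 \<le> f \<bullet> x * (f \<bullet> P)"
    proof (cases "f \<bullet> P = 0")
      case False
      then show ?thesis using e(2)[OF f] unfolding x_def by (metis mult.commute less_imp_le)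
    qed simp
  qed
  obtain v w where "cell_triangle A x P v w"
    using cell_triangle_at_vertex[OF arr smp nonempty off Pc P l n ln lP nP] by metis
  then interpret cell_triangle A x P v w .
  have closed_add: "y + z \<in> closed_cell A x" if "y \<in> closed_cell A x" "z \<in> closed_cell A x" for y z
    using that by (simp add: closed_cell_def inner_add_right distrib_left)
  have zero: "f \<bullet> y = 0 \<and> f \<bullet> z = 0"
    if "f \<in> cov A" "f \<bullet> (y + z) = 0" "y \<in> closed_cell A x" "z \<in> closed_cell A x" for f y z
  proof -
    have "(f \<bullet> x) * (f \<bullet> y) + (f \<bullet> x) * (f \<bullet> z) = 0"
      using that(2) by (simp add: inner_add_right distrib_left[symmetric])
    then have "(f \<bullet> x) * (f \<bullet> y) = 0 \<and> (f \<bullet> x) * (f \<bullet> z) = 0"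
      using closed_cellD[OF that(3,1)] closed_cellD[OF that(4,1)] by linarith
    then show ?thesis using off that(1) by simp
  qed
  have facet: "\<exists>f\<in>cov A. f \<bullet> y = 0 \<and> f \<bullet> z = 0"
    if "y \<in> closed_cell A x" "z \<in> closed_cell A x" "y + z \<notin> pos_cone P v w" for y z
    using facet_vanishing[OF closed_add[OF that(1,2)] that(3)] zero[OF _ _ that(1,2)] by metis
  \<comment> \<open>Each sum of two corners has a vanishing coordinate, so it lies on a line of
    \<open>A\<close>; by nonnegativity that line contains both corners.\<close>
  have "P + w \<notin> pos_cone P v w" "P + v \<notin> pos_cone P v w" "v + w \<notin> pos_cone P v w"
    using not_in_pos_cone[of 1 0 1] not_in_pos_cone[of 1 1 0] not_in_pos_cone[of 0 1 1] by auto
  then obtain f1 f2 \<mu> where f1: "f1 \<in> cov A" "f1 \<bullet> P = 0" "f1 \<bullet> w = 0"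
    and f2: "f2 \<in> cov A" "f2 \<bullet> P = 0" "f2 \<bullet> v = 0"
    and \<mu>: "\<mu> \<in> cov A" "\<mu> \<bullet> v = 0" "\<mu> \<bullet> w = 0"
    using facet[OF corners(1) corners(3)] facet[OF corners(1) corners(2)] facet[OF corners(2) corners(3)]
    by metis
  have all0: "f = 0" if "f \<bullet> P = 0" "f \<bullet> v = 0" "f \<bullet> w = 0" for f
  proof -
    obtain a b c where abc: "f = a *\<^sub>R P + b *\<^sub>R v + c *\<^sub>R w" using det_basis(1)[OF det_nz] by metis
    have "f \<bullet> f = f \<bullet> (a *\<^sub>R P + b *\<^sub>R v + c *\<^sub>R w)" by (rule arg_cong[OF abc])
    also have "\<dots> = 0" using that by (simp add: inner_add_right)
    finally show ?thesis by simp
  qed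
  have "\<mu> \<bullet> P \<noteq> 0" using all0 \<mu> by (auto simp: cov_def)
  have sides: "(\<exists>s. s \<noteq> 0 \<and> f = s *\<^sub>R l) \<or> (\<exists>s. s \<noteq> 0 \<and> f = s *\<^sub>R n)" if "f \<in> cov A" "f \<bullet> P = 0" for f
    using only[OF that] proportional_to[OF that(1) l] proportional_to[OF that(1) n] by metis
  have "(l \<bullet> w = 0 \<and> n \<bullet> v = 0) \<or> (n \<bullet> w = 0 \<and> l \<bullet> v = 0)"
  proof -
    have "l \<bullet> w = 0 \<or> n \<bullet> w = 0" using sides[OF f1(1,2)] f1(3) by auto
    moreover have "l \<bullet> v = 0 \<or> n \<bullet> v = 0" using sides[OF f2(1,2)] f2(3) by auto
    moreover have "\<not> (l \<bullet> w = 0 \<and> l \<bullet> v = 0)" using all0[of l] lP nz by blast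
    moreover have "\<not> (n \<bullet> w = 0 \<and> n \<bullet> v = 0)" using all0[of n] nP nz by blast
    ultimately show ?thesis by blast
  qed
  then obtain U Y where U: "U = v \<and> Y = w \<or> U = w \<and> Y = v" and lU: "l \<bullet> U = 0" and nY: "n \<bullet> Y = 0"
    by metis
  have Uc: "U \<in> closed_cell A x" and Yc: "Y \<in> closed_cell A x" and \<mu>U: "\<mu> \<bullet> U = 0" and \<mu>Y: "\<mu> \<bullet> Y = 0"
    using U corners \<mu> by auto
  have "n \<bullet> U \<noteq> 0" "l \<bullet> Y \<noteq> 0"
    using all0[of n] all0[of l] U lU nY nz lP nP by auto
  have "e * (\<sigma> * (n \<bullet> U)) \<ge> 0" "e * (\<tau> * (l \<bullet> Y)) \<ge> 0"
    using closed_cellD[OF Uc n] closed_cellD[OF Yc l] unfolding nx lx by (simp_all add: mult.assoc)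
  then have pos: "\<sigma> * (n \<bullet> U) > 0" "\<tau> * (l \<bullet> Y) > 0"
    using e(1) st \<open>n \<bullet> U \<noteq> 0\<close> \<open>l \<bullet> Y \<noteq> 0\<close>
    by (auto simp: zero_le_mult_iff less_le)
  \<comment> \<open>\<open>P\<close> and \<open>x\<close> have the same sign on every line that
    misses \<open>P\<close>, so the sign conditions of the cell can be expressed with
    \<open>P\<close> in place of \<open>x\<close>.\<close>
  have compat: "(f \<bullet> P) * (f \<bullet> z) \<ge> 0" if f: "f \<in> cov A" and z: "z \<in> closed_cell A x" for f z
  proof (cases "f \<bullet> P = 0")
    case False
    then have "(f \<bullet> P) * (f \<bullet> x) > 0" using e(2)[OF f] unfolding x_def by metis
    moreover have "(f \<bullet> x) * (f \<bullet> z) \<ge> 0" using closed_cellD[OF z f] .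
    ultimately show ?thesis by (auto simp: zero_less_mult_iff zero_le_mult_iff)
  qed simp
  define a where "a = 1 / (\<sigma> * (n \<bullet> U))"
  define b where "b = 1 / (\<tau> * (l \<bullet> Y))"
  have ab: "a > 0" "b > 0" using pos by (simp_all add: a_def b_def)
  show ?thesis
  proof (intro exI conjI ballI)
    show "l \<bullet> (a *\<^sub>R U) = 0" "n \<bullet> (b *\<^sub>R Y) = 0" using lU nY by simp_all
    show "n \<bullet> (a *\<^sub>R U) = \<sigma>" "l \<bullet> (b *\<^sub>R Y) = \<tau>"
      using pos assms by (auto simp: a_def b_def square_eq_1_iff)
    show "(1 / (\<mu> \<bullet> P)) *\<^sub>R \<mu> \<in> cov A" using cov_scale \<mu>(1) \<open>\<mu> \<bullet> P \<noteq> 0\<close> by simp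
    show "(1 / (\<mu> \<bullet> P)) *\<^sub>R \<mu> \<bullet> (a *\<^sub>R U) = 0" "(1 / (\<mu> \<bullet> P)) *\<^sub>R \<mu> \<bullet> (b *\<^sub>R Y) = 0"
      "(1 / (\<mu> \<bullet> P)) *\<^sub>R \<mu> \<bullet> P = 1"
      using \<mu>U \<mu>Y \<open>\<mu> \<bullet> P \<noteq> 0\<close> by simp_all
    fix f assume f: "f \<in> cov A"
    have "(f \<bullet> P) * (f \<bullet> (a *\<^sub>R U)) = a * ((f \<bullet> P) * (f \<bullet> U))" "(f \<bullet> P) * (f \<bullet> (b *\<^sub>R Y)) = b * ((f \<bullet> P) * (f \<bullet> Y))"
      by simp_all
    then show "(f \<bullet> P) * (f \<bullet> (a *\<^sub>R U)) \<ge> 0" "(f \<bullet> P) * (f \<bullet> (b *\<^sub>R Y)) \<ge> 0"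
      using compat[OF f Uc] compat[OF f Yc] ab by (metis mult_nonneg_nonneg less_imp_le)+
  qed
qed

lemma common_zero: "l \<bullet> y = 0 \<Longrightarrow> n \<bullet> y = 0 \<Longrightarrow> \<exists>s. y = s *\<^sub>R P"
  using meet_unique[OF nz ln P lP nP] by blast

text \<open>The candidates differ by \<open>s *\<^sub>R P\<close>. The third side
  \<open>\<mu>\<close> through \<open>U\<close> has value \<open>s\<close> at \<open>U'\<close>, and
  \<open>\<mu>'\<close> has value \<open>- s\<close> at \<open>U\<close>; the sign conditions leave
  only \<open>s = 0\<close>. So adjacent sectors share their corner on the common line.\<close>

lemma neighbour_unique:
  assumes "n \<bullet> U = n \<bullet> U'" "l \<bullet> U = l \<bullet> U'"
    and "\<mu> \<in> cov A" "\<mu> \<bullet> U = 0" "\<mu> \<bullet> P = 1" "\<forall>f\<in>cov A. (f \<bullet> P) * (f \<bullet> U) \<ge> 0"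
    and "\<mu>' \<in> cov A" "\<mu>' \<bullet> U' = 0" "\<mu>' \<bullet> P = 1" "\<forall>f\<in>cov A. (f \<bullet> P) * (f \<bullet> U') \<ge> 0"
  shows "U = U'"
proof -
  obtain s where "U' - U = s *\<^sub>R P" using common_zero[of "U' - U"] assms(1,2) by (auto simp: inner_diff_right)
  then have s: "U' = U + s *\<^sub>R P" by (simp add: algebra_simps)
  have "\<mu> \<bullet> U' = s" "\<mu>' \<bullet> U = - s" using assms unfolding s by (simp_all add: inner_add_right)
  then have "s \<ge> 0" "- s \<ge> 0" using assms by (metis mult_1)+
  then show ?thesis using s by simp
qed

text \<open>\<open>U\<close> and \<open>c P - U\<close> are the neighbours of \<open>P\<close> on \<open>l\<close>, \<open>Y\<close> and \<open>d P - Y\<close> those on \<open>n\<close>, each with the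
  sign for which the cells at \<open>P\<close> are cones; the \<open>\<mu>\<close>'s are the third sides of the four cells.\<close>

lemma quadrants:
  "\<exists>U Y c d \<mu>1 \<mu>2 \<mu>3 \<mu>4. l \<bullet> U = 0 \<and> n \<bullet> U = 1 \<and> n \<bullet> Y = 0 \<and> l \<bullet> Y = 1 \<and>
    \<mu>1 \<in> cov A \<and> \<mu>1 \<bullet> P = 1 \<and> \<mu>1 \<bullet> U = 0 \<and> \<mu>1 \<bullet> Y = 0 \<and>
    \<mu>2 \<in> cov A \<and> \<mu>2 \<bullet> P = 1 \<and> \<mu>2 \<bullet> U = c \<and> \<mu>2 \<bullet> Y = 0 \<and>
    \<mu>3 \<in> cov A \<and> \<mu>3 \<bullet> P = 1 \<and> \<mu>3 \<bullet> U = 0 \<and> \<mu>3 \<bullet> Y = d \<and>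
    \<mu>4 \<in> cov A \<and> \<mu>4 \<bullet> P = 1 \<and> \<mu>4 \<bullet> U = c \<and> \<mu>4 \<bullet> Y = d \<and>
    (\<forall>f\<in>cov A. (f \<bullet> P) * (f \<bullet> U) \<ge> 0 \<and> (f \<bullet> P) * (f \<bullet> Y) \<ge> 0 \<and>
       (f \<bullet> P) * (f \<bullet> (c *\<^sub>R P - U)) \<ge> 0 \<and> (f \<bullet> P) * (f \<bullet> (d *\<^sub>R P - Y)) \<ge> 0)"
proof -
  obtain U Y \<mu>1 where 1: "l \<bullet> U = 0" "n \<bullet> U = 1" "n \<bullet> Y = 0" "l \<bullet> Y = 1" "\<mu>1 \<in> cov A"
      "\<mu>1 \<bullet> U = 0" "\<mu>1 \<bullet> Y = 0" "\<mu>1 \<bullet> P = 1"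
      "\<forall>f\<in>cov A. (f \<bullet> P) * (f \<bullet> U) \<ge> 0" "\<forall>f\<in>cov A. (f \<bullet> P) * (f \<bullet> Y) \<ge> 0"
    using quadrant[of 1 1] by auto
  obtain V Y2 \<mu>2 where 2: "l \<bullet> V = 0" "n \<bullet> V = - 1" "n \<bullet> Y2 = 0" "l \<bullet> Y2 = 1" "\<mu>2 \<in> cov A"
      "\<mu>2 \<bullet> V = 0" "\<mu>2 \<bullet> Y2 = 0" "\<mu>2 \<bullet> P = 1"
      "\<forall>f\<in>cov A. (f \<bullet> P) * (f \<bullet> V) \<ge> 0" "\<forall>f\<in>cov A. (f \<bullet> P) * (f \<bullet> Y2) \<ge> 0"
    using quadrant[of "-1" 1] by auto
  obtain U3 W \<mu>3 where 3: "l \<bullet> U3 = 0" "n \<bullet> U3 = 1" "n \<bullet> W = 0" "l \<bullet> W = - 1" "\<mu>3 \<in> cov A"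
      "\<mu>3 \<bullet> U3 = 0" "\<mu>3 \<bullet> W = 0" "\<mu>3 \<bullet> P = 1"
      "\<forall>f\<in>cov A. (f \<bullet> P) * (f \<bullet> U3) \<ge> 0" "\<forall>f\<in>cov A. (f \<bullet> P) * (f \<bullet> W) \<ge> 0"
    using quadrant[of 1 "-1"] by auto
  obtain V4 W4 \<mu>4 where 4: "l \<bullet> V4 = 0" "n \<bullet> V4 = - 1" "n \<bullet> W4 = 0" "l \<bullet> W4 = - 1" "\<mu>4 \<in> cov A"
      "\<mu>4 \<bullet> V4 = 0" "\<mu>4 \<bullet> W4 = 0" "\<mu>4 \<bullet> P = 1"
      "\<forall>f\<in>cov A. (f \<bullet> P) * (f \<bullet> V4) \<ge> 0" "\<forall>f\<in>cov A. (f \<bullet> P) * (f \<bullet> W4) \<ge> 0"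
    using quadrant[of "-1" "-1"] by auto
  have eq: "Y2 = Y" "U3 = U" "V4 = V" "W4 = W"
    using neighbour_unique[of Y2 Y \<mu>2 \<mu>1] neighbour_unique[of U3 U \<mu>3 \<mu>1] neighbour_unique[of V4 V \<mu>4 \<mu>2]
      neighbour_unique[of W4 W \<mu>4 \<mu>3] 1 2 3 4 by simp_all
  \<comment> \<open>\<open>U\<close> and \<open>V\<close> are normalised to opposite values of
    \<open>n\<close>, so both \<open>l\<close> and \<open>n\<close> vanish at their sum.\<close>
  obtain c where "V + U = c *\<^sub>R P" using common_zero[of "V + U"] 1 2 by (auto simp: inner_add_right)
  then have c: "V = c *\<^sub>R P - U" by (simp add: algebra_simps)
  obtain d where "W + Y = d *\<^sub>R P" using common_zero[of "W + Y"] 1 3 by (auto simp: inner_add_right)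
  then have d: "W = d *\<^sub>R P - Y" by (simp add: algebra_simps)
  have "\<mu>2 \<bullet> U = c" "\<mu>3 \<bullet> Y = d" "\<mu>4 \<bullet> U = c" "\<mu>4 \<bullet> Y = d"
    using 2(6,8) 3(7,8) 4(6,7,8) unfolding eq c d by (simp_all add: inner_diff_right)
  moreover have "\<forall>f\<in>cov A. (f \<bullet> P) * (f \<bullet> U) \<ge> 0 \<and> (f \<bullet> P) * (f \<bullet> Y) \<ge> 0 \<and>
       (f \<bullet> P) * (f \<bullet> (c *\<^sub>R P - U)) \<ge> 0 \<and> (f \<bullet> P) * (f \<bullet> (d *\<^sub>R P - Y)) \<ge> 0"
    unfolding ball_conj_distrib using 1(9,10) 2(9)[unfolded c] 3(10)[unfolded d] by (intro conjI)
  ultimately show ?thesis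
    using 1(1-8) 2(5,7,8)[unfolded eq] 3(5,6,8)[unfolded eq] 4(5,8)
    by (intro exI[of _ U] exI[of _ Y] exI[of _ c] exI[of _ d] exI[of _ \<mu>1] exI[of _ \<mu>2] exI[of _ \<mu>3] exI[of _ \<mu>4] conjI)
qed

text \<open>For \<open>d = 0\<close> the two neighbours on \<open>n\<close> are \<open>Y\<close> and
  \<open>- Y\<close>, that is, one projective point. The two sign conditions are then opposite and
  force every further line through it.\<close>

lemma degenerate_neighbours:
  assumes "\<forall>f\<in>cov A. (f \<bullet> P) * (f \<bullet> Y) \<ge> 0 \<and> (f \<bullet> P) * (f \<bullet> (d *\<^sub>R P - Y)) \<ge> 0" "d = 0"
    and "f \<in> cov A" "pline f \<noteq> pline l" "pline f \<noteq> pline n"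
  shows "f \<bullet> Y = 0"
proof -
  have "f \<bullet> P \<noteq> 0" using only assms by blast
  moreover have "(f \<bullet> P) * (f \<bullet> Y) \<ge> 0" "(f \<bullet> P) * (f \<bullet> Y) \<le> 0" using assms(1-3) by auto
  ultimately show ?thesis by simp
qed

text \<open>Among the lines through a neighbour \<open>Y\<close> of \<open>P\<close> on \<open>n\<close>, the third sides of the two cells at \<open>Y\<close> are
  the first ones on either side of \<open>n\<close>. Mirror images of lines being lines, they are mirror images
  of each other; hence so are the two neighbours of \<open>P\<close> on \<open>l\<close>. The hypothesis \<open>gen\<close> says that \<open>n\<close>
  carries a vertex other than \<open>P\<close> and \<open>Y\<close>.\<close>

lemma orthogonal_if_mirror:
  assumes N: "n \<bullet> N = 1"
    and gen: "\<And>Y. n \<bullet> Y = 0 \<Longrightarrow> l \<bullet> Y = 1 \<Longrightarrow> \<exists>f\<in>cov A. pline f \<noteq> pline l \<and> pline f \<noteq> pline n \<and> f \<bullet> Y \<noteq> 0"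
    and mirror: "\<And>\<mu> U. \<mu> \<in> cov A \<Longrightarrow> U \<noteq> 0 \<Longrightarrow> l \<bullet> U = 0 \<Longrightarrow> \<mu> \<bullet> U = 0 \<Longrightarrow> \<mu> \<bullet> P \<noteq> 0 \<Longrightarrow>
      \<forall>f\<in>cov A. (f \<bullet> P) * (f \<bullet> U) \<ge> 0 \<Longrightarrow> \<mu> - (2 * (\<mu> \<bullet> N)) *\<^sub>R n \<in> cov A"
  shows "l \<bullet> N = 0"
proof -
  obtain U Y c d \<mu>1 \<mu>2 \<mu>3 \<mu>4 where U: "l \<bullet> U = 0" "n \<bullet> U = 1" and Y: "n \<bullet> Y = 0" "l \<bullet> Y = 1"
    and 1: "\<mu>1 \<in> cov A" "\<mu>1 \<bullet> P = 1" "\<mu>1 \<bullet> U = 0" "\<mu>1 \<bullet> Y = 0"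
    and 2: "\<mu>2 \<in> cov A" "\<mu>2 \<bullet> P = 1" "\<mu>2 \<bullet> U = c" "\<mu>2 \<bullet> Y = 0"
    and 3: "\<mu>3 \<in> cov A" "\<mu>3 \<bullet> P = 1" "\<mu>3 \<bullet> U = 0" "\<mu>3 \<bullet> Y = d"
    and 4: "\<mu>4 \<in> cov A" "\<mu>4 \<bullet> P = 1" "\<mu>4 \<bullet> U = c" "\<mu>4 \<bullet> Y = d"
    and pos: "\<forall>f\<in>cov A. (f \<bullet> P) * (f \<bullet> U) \<ge> 0 \<and> (f \<bullet> P) * (f \<bullet> Y) \<ge> 0 \<and>
       (f \<bullet> P) * (f \<bullet> (c *\<^sub>R P - U)) \<ge> 0 \<and> (f \<bullet> P) * (f \<bullet> (d *\<^sub>R P - Y)) \<ge> 0"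
    using quadrants by metis
  define \<nu> where "\<nu> = l \<bullet> N"
  obtain \<kappa> where "N - U - \<nu> *\<^sub>R Y = \<kappa> *\<^sub>R P"
    using common_zero[of "N - U - \<nu> *\<^sub>R Y"] U Y N by (auto simp: inner_diff_right \<nu>_def)
  then have Neq: "N = U + \<nu> *\<^sub>R Y + \<kappa> *\<^sub>R P" by (simp add: algebra_simps)
  have U0: "U \<noteq> 0" "c *\<^sub>R P - U \<noteq> 0" using U nP by (auto simp: inner_diff_right)
  have lV: "l \<bullet> (c *\<^sub>R P - U) = 0" using U lP by (simp add: inner_diff_right)
  have m1: "\<mu>1 - (2 * (\<mu>1 \<bullet> N)) *\<^sub>R n \<in> cov A" using mirror[of \<mu>1 U] 1 U U0 pos by simp
  have m3: "\<mu>3 - (2 * (\<mu>3 \<bullet> N)) *\<^sub>R n \<in> cov A" using mirror[of \<mu>3 U] 3 U U0 pos by simp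
  have m2: "\<mu>2 - (2 * (\<mu>2 \<bullet> N)) *\<^sub>R n \<in> cov A"
    by (rule mirror[of \<mu>2 "c *\<^sub>R P - U"]) (use 2 lV U0 pos in \<open>simp_all add: inner_diff_right\<close>)
  have m4: "\<mu>4 - (2 * (\<mu>4 \<bullet> N)) *\<^sub>R n \<in> cov A"
    by (rule mirror[of \<mu>4 "c *\<^sub>R P - U"]) (use 4 lV U0 pos in \<open>simp_all add: inner_diff_right\<close>)
  \<comment> \<open>Every mirror image still has value 1 at \<open>P\<close>, since
    \<open>n \<bullet> P = 0\<close>. Testing the images of \<open>\<mu>1\<close> and
    \<open>\<mu>2\<close> at the neighbours on \<open>l\<close> gives
    \<open>c + 2 * \<kappa> = 0\<close>; those of \<open>\<mu>3\<close> and \<open>\<mu>4\<close>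
    give \<open>c + 2 * (\<kappa> + \<nu> * d) = 0\<close>.\<close>
  have "c + 2 * \<kappa> \<ge> 0"
    using bspec[OF pos m1] 1 U nP by (simp add: inner_diff_left inner_diff_right inner_add_right Neq)
  moreover have "- (c + 2 * \<kappa>) \<ge> 0"
    using bspec[OF pos m2] 2 U nP by (simp add: inner_diff_left inner_diff_right inner_add_right Neq)
  moreover have "c + 2 * (\<kappa> + \<nu> * d) \<ge> 0"
    using bspec[OF pos m3] 3 U nP by (simp add: inner_diff_left inner_diff_right inner_add_right Neq algebra_simps)
  moreover have "c - 2 * (c + \<kappa> + \<nu> * d) \<ge> 0"
    using bspec[OF pos m4] 4 U nP by (simp add: inner_diff_left inner_diff_right inner_add_right Neq algebra_simps)
  ultimately have "\<nu> * d = 0" by argo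
  moreover have "d \<noteq> 0"
  proof
    assume d: "d = 0"
    obtain f where "f \<in> cov A" "pline f \<noteq> pline l" "pline f \<noteq> pline n" "f \<bullet> Y \<noteq> 0" using gen[OF Y] by metis
    then show False using degenerate_neighbours[of Y d f] pos d by simp
  qed
  ultimately show ?thesis by (simp add: \<nu>_def)
qed

text \<open>These are the third sides of the two cells that share the edge from \<open>P\<close> to
  \<open>U\<close>. They meet \<open>n\<close> in \<open>Y\<close> and in
  \<open>d *\<^sub>R P - Y\<close>, which are different points unless \<open>d = 0\<close>.\<close>

lemma distinct_quadrant_lines:
  assumes gen: "\<And>Y. n \<bullet> Y = 0 \<Longrightarrow> l \<bullet> Y = 1 \<Longrightarrow> \<exists>f\<in>cov A. pline f \<noteq> pline l \<and> pline f \<noteq> pline n \<and> f \<bullet> Y \<noteq> 0"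
  shows "\<exists>U \<mu> \<mu>'. U \<noteq> 0 \<and> l \<bullet> U = 0 \<and> (\<forall>f\<in>cov A. (f \<bullet> P) * (f \<bullet> U) \<ge> 0) \<and>
    \<mu> \<in> cov A \<and> \<mu> \<bullet> U = 0 \<and> \<mu> \<bullet> P \<noteq> 0 \<and> \<mu>' \<in> cov A \<and> \<mu>' \<bullet> U = 0 \<and> \<mu>' \<bullet> P \<noteq> 0 \<and> pline \<mu> \<noteq> pline \<mu>'"
proof -
  obtain U Y c d \<mu>1 \<mu>2 \<mu>3 \<mu>4 where U: "l \<bullet> U = 0" "n \<bullet> U = 1" and Y: "n \<bullet> Y = 0" "l \<bullet> Y = 1"
    and 1: "\<mu>1 \<in> cov A" "\<mu>1 \<bullet> P = 1" "\<mu>1 \<bullet> U = 0" "\<mu>1 \<bullet> Y = 0"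
    and 3: "\<mu>3 \<in> cov A" "\<mu>3 \<bullet> P = 1" "\<mu>3 \<bullet> U = 0" "\<mu>3 \<bullet> Y = d"
    and pos: "\<forall>f\<in>cov A. (f \<bullet> P) * (f \<bullet> U) \<ge> 0 \<and> (f \<bullet> P) * (f \<bullet> Y) \<ge> 0 \<and>
       (f \<bullet> P) * (f \<bullet> (c *\<^sub>R P - U)) \<ge> 0 \<and> (f \<bullet> P) * (f \<bullet> (d *\<^sub>R P - Y)) \<ge> 0"
    using quadrants by metis
  have "d \<noteq> 0"
  proof
    assume d: "d = 0"
    obtain f where "f \<in> cov A" "pline f \<noteq> pline l" "pline f \<noteq> pline n" "f \<bullet> Y \<noteq> 0" using gen[OF Y] by metis
    then show False using degenerate_neighbours[of Y d f] pos d by simp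
  qed
  have "pline \<mu>1 \<noteq> pline \<mu>3"
  proof
    assume "pline \<mu>1 = pline \<mu>3"
    then obtain s where "\<mu>3 = s *\<^sub>R \<mu>1" using proportional_to[of \<mu>3 \<mu>1] 1 3 by auto
    then show False using 1 3 \<open>d \<noteq> 0\<close> by simp
  qed
  moreover have "U \<noteq> 0" using U by auto
  ultimately show ?thesis using U 1 3 pos
    by (intro exI[of _ U] exI[of _ \<mu>1] exI[of _ \<mu>3]) simp
qed

end

section \<open>Mirror symmetric systems of sides and axes\<close>

lemma card_le_2I:
  assumes "\<And>x y z. x \<in> S \<Longrightarrow> y \<in> S \<Longrightarrow> z \<in> S \<Longrightarrow> x = y \<or> y = z \<or> x = z"
  shows "card S \<le> 2"
proof (rule ccontr)
  assume "\<not> card S \<le> 2"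
  then have "3 \<le> card S" by simp
  then obtain T where "T \<subseteq> S" "card T = 3" by (metis obtain_subset_with_card_n)
  then obtain x y z where "T = {x, y, z}" "x \<noteq> y" "y \<noteq> z" "x \<noteq> z" by (auto simp: card_3_iff)
  then show False using assms[of x y z] \<open>T \<subseteq> S\<close> by auto
qed

lemma card_le_1I:
  assumes "\<And>x y. x \<in> S \<Longrightarrow> y \<in> S \<Longrightarrow> x = y"
  shows "card S \<le> 1"
proof (cases "S = {}")
  case False
  then obtain x where "x \<in> S" by blast
  then have "S = {x}" using assms by blast
  then show ?thesis by simp
qed simp

lemma card_subset_le: "A \<subseteq> B \<Longrightarrow> card B \<le> k \<Longrightarrow> finite B \<Longrightarrow> card A \<le> k \<and> finite A"
  using card_mono[of B A] finite_subset[of A B] by simp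

lemma card_UN_le_mult:
  assumes "finite I" "\<And>i. i \<in> I \<Longrightarrow> card (F i) \<le> k"
  shows "card (\<Union>i\<in>I. F i) \<le> k * card I"
proof -
  have "card (\<Union>i\<in>I. F i) \<le> (\<Sum>i\<in>I. card (F i))" by (rule card_UN_le[OF assms(1)])
  also have "\<dots> \<le> (\<Sum>i\<in>I. k)" by (rule sum_mono) (rule assms(2))
  finally show ?thesis by (simp add: mult.commute)
qed

text \<open>The successor in \<open>X\<close> maps \<open>V\<close> without its maximum injectively
  into \<open>X - V\<close>; the maximum accounts for the summand 1.\<close>

lemma card_no_consecutive:
  fixes X V :: "real set"
  assumes "finite X" "V \<subseteq> X"
    and gap: "\<And>x y. x \<in> V \<Longrightarrow> y \<in> V \<Longrightarrow> x < y \<Longrightarrow> \<exists>z\<in>X. x < z \<and> z < y"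
  shows "card X \<le> 2 * card (X - V) + 1"
proof -
  have finV: "finite V" using assms finite_subset by blast
  define nxt where "nxt v = Min {z \<in> X. v < z}" for v
  define V' where "V' = V - {Max V}"
  have less_Max: "v < Max V" if "v \<in> V'" for v
    using that finV unfolding V'_def by (simp add: less_le)
  have nxt: "nxt v \<in> X" "v < nxt v" "\<And>z. z \<in> X \<Longrightarrow> v < z \<Longrightarrow> nxt v \<le> z" if "v \<in> V'" for v
  proof -
    have "Max V \<in> V" using that finV by (auto simp: V'_def intro: Max_in)
    then have "Max V \<in> {z \<in> X. v < z}" using less_Max[OF that] assms(2) by auto
    then have ne: "{z \<in> X. v < z} \<noteq> {}" by blast
    have fin: "finite {z \<in> X. v < z}" using assms(1) by simp
    show "nxt v \<in> X" "v < nxt v" using Min_in[OF fin ne] unfolding nxt_def by simp_all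
    show "\<And>z. z \<in> X \<Longrightarrow> v < z \<Longrightarrow> nxt v \<le> z" unfolding nxt_def using fin by simp
  qed
  have "nxt ` V' \<subseteq> X - V"
  proof safe
    fix v assume v: "v \<in> V'"
    show "nxt v \<in> X" by (rule nxt(1)[OF v])
    assume "nxt v \<in> V"
    then obtain z where "z \<in> X" "v < z" "z < nxt v" using gap[of v "nxt v"] nxt(2)[OF v] v by (auto simp: V'_def)
    then show False using nxt(3)[OF v] by fastforce
  qed
  moreover have "inj_on nxt V'"
  proof (rule linorder_inj_onI)
    fix x y assume "x < y" "x \<in> V'" "y \<in> V'"
    then have "nxt x \<le> y" using nxt(3) assms(2) by (auto simp: V'_def)
    then show "nxt x \<noteq> nxt y" using nxt(2)[OF \<open>y \<in> V'\<close>] by simp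
  qed auto
  ultimately have "card V' \<le> card (X - V)" using card_inj_on_le assms(1) by blast
  moreover have "card V \<le> card V' + 1" using finV unfolding V'_def by (cases "V = {}") simp_all
  moreover have "card X = card V + card (X - V)"
    using card_Diff_subset[OF finV assms(2)] card_mono[OF assms(1,2)] by simp
  ultimately show ?thesis by simp
qed

lemma int_dvd_range:
  assumes "i \<in> {0..<int m}" "j \<in> {0..<int m}" "int m dvd i - j"
  shows "i = j"
proof -
  have "\<bar>i - j\<bar> < int m" using assms by auto
  then show ?thesis using assms(3) zdvd_not_zless[of "\<bar>i - j\<bar>" "int m"] by (cases "i = j") auto
qed

text \<open>\<open>S i\<close> and \<open>a j\<close> are covectors of the sides (outer normal at angle \<open>t + (2 i + 1) \<pi> / m\<close>) and of
  the axes (direction at angle \<open>t + j \<pi> / m\<close>) of the polygon, \<open>N j\<close> is the point at infinity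
  orthogonal to the axis \<open>j\<close>, \<open>M i\<close> the midpoint of side \<open>i\<close>, and \<open>O_pt\<close> the centre. The reflection in
  the axis \<open>j\<close> acts on covectors by \<open>f \<mapsto> f - 2 (f \<bullet> N j) a j\<close>.\<close>

locale mirror_system =
  fixes m :: nat and S a N M :: "int \<Rightarrow> real^3" and O_pt :: "real^3"
  assumes m: "m \<ge> 3"
    and aN: "a j \<bullet> N j = 1"
    and S_eq_iff: "pline (S i) = pline (S j) \<longleftrightarrow> int m dvd i - j"
    and a_eq_iff: "pline (a i) = pline (a j) \<longleftrightarrow> int m dvd i - j"
    and mirror_S: "S i - (2 * (S i \<bullet> N j)) *\<^sub>R a j = S (j - i - 1)"
    and mirror_a: "a i - (2 * (a i \<bullet> N j)) *\<^sub>R a j = - a (2 * j - i)"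
    and mirror_M: "M i - (2 * (a j \<bullet> M i)) *\<^sub>R N j = M (j - i - 1)"
    and O_nz: "O_pt \<noteq> 0" and aO: "a j \<bullet> O_pt = 0" and SO: "S i \<bullet> O_pt \<noteq> 0"
    and SM: "S i \<bullet> M i = 0" and aM: "a (2 * i + 1) \<bullet> M i = 0" and M_nz: "M i \<noteq> 0"
begin

definition R :: "rp2 set set" where
  "R = range (\<lambda>i. pline (S i)) \<union> range (\<lambda>j. pline (a j))"

text \<open>Indices of sides and axes run through all integers, so that reflections act by
  \<open>j - i - 1\<close> and \<open>2 * j - i\<close> without reduction; \<open>I\<close>
  represents the residue classes modulo \<open>m\<close>.\<close>

definition I :: "int set" where "I = {0..<int m}"

lemma finite_I: "finite I" and card_I: "card I = m"
  by (simp_all add: I_def)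

lemma S_nz: "S i \<noteq> 0" and a_nz: "a j \<noteq> 0"
  using SO[of i] aN[of j] by auto

lemma Sa_neq: "pline (S i) \<noteq> pline (a j)"
proof
  assume "pline (S i) = pline (a j)"
  then obtain s where "S i = s *\<^sub>R a j" using pline_eq_iff[OF a_nz S_nz] by metis
  then show False using aO[of j] SO[of i] by simp
qed

lemma index_in_I: "\<exists>i'\<in>I. int m dvd i - i'"
proof
  show "i mod int m \<in> I" using m by (simp add: I_def)
  show "int m dvd i - i mod int m" by (simp add: minus_mod_eq_mult_div)
qed

lemma I_eq: "i \<in> I \<Longrightarrow> j \<in> I \<Longrightarrow> int m dvd i - j \<Longrightarrow> i = j"
  unfolding I_def by (rule int_dvd_range)

lemma R_I: "R = (\<lambda>i. pline (S i)) ` I \<union> (\<lambda>j. pline (a j)) ` I"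
proof -
  have "pline (S i) \<in> (\<lambda>i. pline (S i)) ` I" for i using index_in_I[of i] S_eq_iff by auto
  moreover have "pline (a i) \<in> (\<lambda>i. pline (a i)) ` I" for i using index_in_I[of i] a_eq_iff by auto
  ultimately show ?thesis unfolding R_def by blast
qed

lemma inj_S: "inj_on (\<lambda>i. pline (S i)) I" and inj_a: "inj_on (\<lambda>i. pline (a i)) I"
  using I_eq S_eq_iff a_eq_iff by (auto intro!: inj_onI)

lemma finite_R: "finite R" and card_R: "card R = 2 * m"
proof -
  show "finite R" unfolding R_I using finite_I by simp
  have "(\<lambda>i. pline (S i)) ` I \<inter> (\<lambda>j. pline (a j)) ` I = {}" using Sa_neq by auto
  then show "card R = 2 * m" unfolding R_I
    using finite_I by (simp add: card_Un_disjoint card_image[OF inj_S] card_image[OF inj_a] card_I)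
qed

lemma R_cases:
  assumes "pline f \<in> R" "f \<noteq> 0"
  obtains i s where "s \<noteq> 0" "f = s *\<^sub>R S i" "pline f = pline (S i)"
  | j s where "s \<noteq> 0" "f = s *\<^sub>R a j" "pline f = pline (a j)"
proof -
  consider i where "pline f = pline (S i)" | j where "pline f = pline (a j)"
    using assms(1) by (auto simp: R_def)
  then show thesis
  proof cases
    case 1
    then obtain s where "s \<noteq> 0" "f = s *\<^sub>R S i" using pline_eq_iff[OF S_nz assms(2)] by metis
    then show ?thesis using that(1) 1 by simp
  next
    case 2
    then obtain s where "s \<noteq> 0" "f = s *\<^sub>R a j" using pline_eq_iff[OF a_nz assms(2)] by metis
    then show ?thesis using that(2) 2 by simp
  qed
qed

lemma S_in_R: "pline (S i) \<in> R" and a_in_R: "pline (a j) \<in> R"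
  by (auto simp: R_def)

text \<open>The reflection in the axis \<open>i + j + 1\<close> exchanges the sides \<open>i\<close>
  and \<open>j\<close>, so their covectors differ by a nonzero multiple of that of the axis.\<close>

lemma sides_meet_on_axis:
  assumes "S i \<bullet> x = 0" "S j \<bullet> x = 0" "\<not> int m dvd i - j"
  shows "a (i + j + 1) \<bullet> x = 0"
proof -
  have eq: "S i - (2 * (S i \<bullet> N (i + j + 1))) *\<^sub>R a (i + j + 1) = S j"
    using mirror_S[of i "i + j + 1"] by simp
  have "S i \<bullet> N (i + j + 1) \<noteq> 0"
  proof
    assume "S i \<bullet> N (i + j + 1) = 0"
    then have "S i = S j" using eq by simp
    then show False using S_eq_iff assms(3) by metis
  qed
  moreover have "S j \<bullet> x = S i \<bullet> x - 2 * (S i \<bullet> N (i + j + 1)) * (a (i + j + 1) \<bullet> x)"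
    unfolding eq[symmetric] by (simp add: inner_diff_left)
  ultimately show ?thesis using assms by simp
qed

lemma mirror_side_through:
  assumes "S i \<bullet> x = 0" "a j \<bullet> x = 0"
  shows "S (j - i - 1) \<bullet> x = 0"
  unfolding mirror_S[symmetric] using assms by (simp add: inner_diff_left)

lemma axes_meet_at_O:
  assumes "a i \<bullet> x = 0" "a j \<bullet> x = 0" "\<not> int m dvd i - j"
  shows "\<exists>s. x = s *\<^sub>R O_pt"
  using meet_unique[OF a_nz a_nz _ O_nz aO aO assms(1,2)] a_eq_iff assms(3) by blast

lemma side_axes_meet:
  assumes "a i \<bullet> x = 0" "a j \<bullet> x = 0" "S k \<bullet> x = 0" "x \<noteq> 0"
  shows "int m dvd i - j"
proof (rule ccontr)
  assume "\<not> int m dvd i - j"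
  then obtain s where "x = s *\<^sub>R O_pt" using axes_meet_at_O assms by metis
  then show False using SO[of k] assms by auto
qed

text \<open>Three distinct sides would put the distinct axes \<open>i + j + 1\<close> and
  \<open>i + k + 1\<close> through \<open>x\<close>, but axes meet only in the centre, which lies on
  no side.\<close>

lemma no_three_sides:
  assumes "S i \<bullet> x = 0" "S j \<bullet> x = 0" "S k \<bullet> x = 0" "x \<noteq> 0"
  shows "int m dvd i - j \<or> int m dvd j - k \<or> int m dvd i - k"
proof (rule ccontr)
  assume *: "\<not> ?thesis"
  then have "a (i + j + 1) \<bullet> x = 0" "a (i + k + 1) \<bullet> x = 0"
    using sides_meet_on_axis assms by blast+
  then have "int m dvd (i + j + 1) - (i + k + 1)" using side_axes_meet assms by blast
  then show False using * by simp
qed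

text \<open>The solutions are the sides orthogonal to the axis \<open>j\<close>; two different ones
  are exactly \<open>m / 2\<close> apart, so a third does not fit.\<close>

lemma card_half_index: "card {i \<in> I. int m dvd 2 * i + 1 - j} \<le> 2"
proof (rule card_le_2I, rule ccontr)
  fix x y z
  assume "x \<in> {i \<in> I. int m dvd 2 * i + 1 - j}" "y \<in> {i \<in> I. int m dvd 2 * i + 1 - j}"
    "z \<in> {i \<in> I. int m dvd 2 * i + 1 - j}" and ne: "\<not> (x = y \<or> y = z \<or> x = z)"
  then have I: "x \<in> I" "y \<in> I" "z \<in> I" and d: "int m dvd 2 * x + 1 - j" "int m dvd 2 * y + 1 - j" "int m dvd 2 * z + 1 - j"
    by auto
  have *: "2 * p - 2 * q = int m \<or> 2 * p - 2 * q = - int m"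
    if "p \<in> I" "q \<in> I" "p \<noteq> q" "int m dvd 2 * p + 1 - j" "int m dvd 2 * q + 1 - j" for p q
  proof -
    have "int m dvd (2 * p + 1 - j) - (2 * q + 1 - j)" by (rule dvd_diff[OF that(4,5)])
    then obtain k where k: "2 * p - 2 * q = int m * k" by (auto elim!: dvdE)
    have "\<bar>2 * p - 2 * q\<bar> < 2 * int m" using that by (auto simp: I_def)
    then have "int m * \<bar>k\<bar> < int m * 2" using k by (simp add: abs_mult mult.commute)
    then have "\<bar>k\<bar> < 2" using m by simp
    moreover have "k \<noteq> 0" using k that by auto
    ultimately have "k = 1 \<or> k = -1" by auto
    then show ?thesis using k by auto
  qed
  show False using *[OF I(1,2) _ d(1,2)] *[OF I(2,3) _ d(2,3)] *[OF I(1,3) _ d(1,3)] ne m by auto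
qed

text \<open>By mirror symmetry, a point of a line of the system that lies on exactly one further line of
  the system is the midpoint of a side.\<close>

lemma card_simple_points:
  assumes L: "pline l \<in> R" "l \<noteq> 0"
    and B: "\<And>x. B1 + x *\<^sub>R B2 \<noteq> 0" "\<And>x. l \<bullet> (B1 + x *\<^sub>R B2) = 0"
    and pts: "\<And>f. f \<noteq> 0 \<Longrightarrow> pline f \<noteq> pline l \<Longrightarrow> card {x. f \<bullet> (B1 + x *\<^sub>R B2) = 0} \<le> 1
        \<and> finite {x. f \<bullet> (B1 + x *\<^sub>R B2) = 0}"
  defines "X \<equiv> {x. \<exists>f. f \<noteq> 0 \<and> pline f \<in> R \<and> pline f \<noteq> pline l \<and> f \<bullet> (B1 + x *\<^sub>R B2) = 0 \<and>
      (\<forall>g. g \<noteq> 0 \<and> pline g \<in> R \<and> g \<bullet> (B1 + x *\<^sub>R B2) = 0 \<longrightarrow> pline g = pline f \<or> pline g = pline l)}"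
  shows "card X \<le> 2 \<and> finite X"
  using L
proof (cases rule: R_cases)
  case (1 j s)
  have lS: "S j \<bullet> (B1 + x *\<^sub>R B2) = 0" for x using B(2)[of x] 1 by simp
  \<comment> \<open>A further side \<open>i\<close> would bring the axis \<open>i + j + 1\<close>
    along as a third line. A further axis must map the side \<open>j\<close> to itself, hence be its
    perpendicular bisector.\<close>
  have sub: "X \<subseteq> {x. a (2 * j + 1) \<bullet> (B1 + x *\<^sub>R B2) = 0}"
  proof
    fix x assume "x \<in> X"
    define p where "p = B1 + x *\<^sub>R B2"
    obtain f where f: "f \<noteq> 0" "pline f \<in> R" "pline f \<noteq> pline l" "f \<bullet> p = 0"
      and only: "\<And>g. g \<noteq> 0 \<Longrightarrow> pline g \<in> R \<Longrightarrow> g \<bullet> p = 0 \<Longrightarrow> pline g = pline f \<or> pline g = pline l"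
      using \<open>x \<in> X\<close> unfolding X_def p_def by blast
    have p: "p \<noteq> 0" "S j \<bullet> p = 0" using B(1) lS by (simp_all add: p_def)
    from f(2,1) have "a (2 * j + 1) \<bullet> p = 0"
    proof (cases rule: R_cases)
      case (1 i t)
      then have "S i \<bullet> p = 0" using f by auto
      have "\<not> int m dvd i - j" using 1 f(3) \<open>pline l = pline (S j)\<close> S_eq_iff by auto
      then have "a (i + j + 1) \<bullet> p = 0" using sides_meet_on_axis \<open>S i \<bullet> p = 0\<close> p by blast
      then have "pline (a (i + j + 1)) = pline f \<or> pline (a (i + j + 1)) = pline l"
        using only[OF a_nz a_in_R] by blast
      then show ?thesis using 1 \<open>pline l = pline (S j)\<close> Sa_neq by metis
    next
      case (2 k t)
      then have k: "a k \<bullet> p = 0" using f by auto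
      then have "S (k - j - 1) \<bullet> p = 0" using mirror_side_through p by blast
      then have "pline (S (k - j - 1)) = pline f \<or> pline (S (k - j - 1)) = pline l"
        using only[OF S_nz S_in_R] by blast
      then have "pline (S (k - j - 1)) = pline (S j)"
        using 2 \<open>pline l = pline (S j)\<close> Sa_neq by metis
      then have "int m dvd k - (2 * j + 1)" unfolding S_eq_iff by (simp add: algebra_simps)
      then have "pline (a k) = pline (a (2 * j + 1))" unfolding a_eq_iff .
      then show ?thesis using k proj_in_pline[OF p(1)] by metis
    qed
    then show "x \<in> {x. a (2 * j + 1) \<bullet> (B1 + x *\<^sub>R B2) = 0}" by (simp add: p_def)
  qed
  have "card {x. a (2 * j + 1) \<bullet> (B1 + x *\<^sub>R B2) = 0} \<le> 1 \<and> finite {x. a (2 * j + 1) \<bullet> (B1 + x *\<^sub>R B2) = 0}"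
    using pts[OF a_nz] 1(3) Sa_neq by metis
  then show ?thesis using card_subset_le[OF sub, of 1] by simp
next
  case (2 j s)
  have la: "a j \<bullet> (B1 + x *\<^sub>R B2) = 0" for x using B(2)[of x] 2 by simp
  let ?H = "{i \<in> I. int m dvd 2 * i + 1 - j}"
  \<comment> \<open>A further side must be its own mirror image in the axis \<open>j\<close>. A
    further axis meets it in the centre, through which at least three axes pass.\<close>
  have sub: "X \<subseteq> (\<Union>i\<in>?H. {x. S i \<bullet> (B1 + x *\<^sub>R B2) = 0})"
  proof
    fix x assume "x \<in> X"
    define p where "p = B1 + x *\<^sub>R B2"
    obtain f where f: "f \<noteq> 0" "pline f \<in> R" "pline f \<noteq> pline l" "f \<bullet> p = 0"
      and only: "\<And>g. g \<noteq> 0 \<Longrightarrow> pline g \<in> R \<Longrightarrow> g \<bullet> p = 0 \<Longrightarrow> pline g = pline f \<or> pline g = pline l"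
      using \<open>x \<in> X\<close> unfolding X_def p_def by blast
    have p: "p \<noteq> 0" "a j \<bullet> p = 0" using B(1) la by (simp_all add: p_def)
    from f(2,1) have "\<exists>i\<in>?H. S i \<bullet> p = 0"
    proof (cases rule: R_cases)
      case (1 i t)
      then have i: "S i \<bullet> p = 0" using f by auto
      then have "S (j - i - 1) \<bullet> p = 0" using mirror_side_through p by blast
      then have "pline (S (j - i - 1)) = pline f \<or> pline (S (j - i - 1)) = pline l"
        using only[OF S_nz S_in_R] by blast
      then have "pline (S i) = pline (S (j - i - 1))"
        using 1 \<open>pline l = pline (a j)\<close> Sa_neq by metis
      then have d: "int m dvd 2 * i + 1 - j" unfolding S_eq_iff by (simp add: algebra_simps)
      obtain i' where i': "i' \<in> I" "int m dvd i - i'" using index_in_I by blast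
      then have "pline (S i) = pline (S i')" using S_eq_iff by blast
      then have "S i' \<bullet> p = 0" using i proj_in_pline[OF p(1)] by metis
      moreover have "int m dvd (2 * i + 1 - j) - 2 * (i - i')" by (rule dvd_diff[OF d dvd_mult[OF i'(2)]])
      then have "int m dvd 2 * i' + 1 - j" by (simp add: algebra_simps)
      ultimately show ?thesis using i'(1) by auto
    next
      case (2 k t)
      then have k: "a k \<bullet> p = 0" using f by auto
      have kj: "\<not> int m dvd k - j" using 2 f(3) \<open>pline l = pline (a j)\<close> a_eq_iff by auto
      then obtain r where r: "p = r *\<^sub>R O_pt" using axes_meet_at_O k p by metis
      have ax: "int m dvd i - k \<or> int m dvd i - j" for i
      proof -
        have "a i \<bullet> p = 0" using r aO by simp
        then have "pline (a i) = pline f \<or> pline (a i) = pline l" using only[OF a_nz a_in_R] by blast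
        then show ?thesis using 2 \<open>pline l = pline (a j)\<close> a_eq_iff by metis
      qed
      have "\<exists>i\<in>I. \<not> int m dvd i - k \<and> \<not> int m dvd i - j"
      proof (rule ccontr)
        assume "\<not> ?thesis"
        have "card I \<le> 2"
        proof (rule card_le_2I)
          fix x y z assume I: "x \<in> I" "y \<in> I" "z \<in> I"
          have same: "x = y" if "x \<in> I" "y \<in> I" "int m dvd x - q" "int m dvd y - q" for x y q
            using dvd_diff[OF that(3,4)] I_eq[OF that(1,2)] by simp
          show "x = y \<or> y = z \<or> x = z"
            using ax[of x] ax[of y] ax[of z] same[OF I(1,2), of k] same[OF I(1,2), of j]
              same[OF I(2,3), of k] same[OF I(2,3), of j] same[OF I(1,3), of k] same[OF I(1,3), of j]
            by argo
        qed
        then show False using m card_I by simp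
      qed
      then show ?thesis using ax by blast
    qed
    then show "x \<in> (\<Union>i\<in>?H. {x. S i \<bullet> (B1 + x *\<^sub>R B2) = 0})" by (auto simp: p_def)
  qed
  have *: "card {x. S i \<bullet> (B1 + x *\<^sub>R B2) = 0} \<le> 1 \<and> finite {x. S i \<bullet> (B1 + x *\<^sub>R B2) = 0}" for i
    using pts[OF S_nz] 2(3) Sa_neq by metis
  have finH: "finite ?H" using finite_I by simp
  have fin: "finite (\<Union>i\<in>?H. {x. S i \<bullet> (B1 + x *\<^sub>R B2) = 0})"
    by (rule finite_UN_I[OF finH]) (simp add: *)
  have "card (\<Union>i\<in>?H. {x. S i \<bullet> (B1 + x *\<^sub>R B2) = 0}) \<le> 1 * card ?H"
    by (rule card_UN_le_mult[OF finH]) (rule conjunct1[OF *])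
  from card_subset_le[OF sub this fin] have "card X \<le> 1 * card ?H \<and> finite X" .
  then show ?thesis using card_half_index[of j] by simp
qed

end

text \<open>Sending \<open>x\<close> to \<open>B1 + x *\<^sub>R B2\<close> parametrises the line
  without the point \<open>B2\<close>, which gives a meaning to consecutive points. The last clause
  ensures that any other line meets the chart at most once.\<close>

lemma line_chart:
  fixes l :: "real^3"
  assumes "l \<noteq> 0"
  shows "\<exists>B1 B2. l \<bullet> B1 = 0 \<and> l \<bullet> B2 = 0 \<and> B2 \<noteq> 0 \<and> (\<forall>x. B1 + x *\<^sub>R B2 \<noteq> 0) \<and>
     (\<forall>f. f \<noteq> 0 \<longrightarrow> pline f \<noteq> pline l \<longrightarrow> \<not> (f \<bullet> B1 = 0 \<and> f \<bullet> B2 = 0))"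
proof -
  obtain B1 where B1: "B1 \<noteq> 0" "l \<bullet> B1 = 0"
    using orthogonal_to_vector_exists[of l] by (auto simp: orthogonal_def)
  define B2 where "B2 = cross3 l B1"
  have B2: "B2 \<noteq> 0" "l \<bullet> B2 = 0" "B1 \<bullet> B2 = 0"
  proof -
    show "l \<bullet> B2 = 0" "B1 \<bullet> B2 = 0" by (simp_all add: B2_def dot_cross_self)
    show "B2 \<noteq> 0"
    proof
      assume "B2 = 0"
      then obtain s where "B1 = s *\<^sub>R l" using assms by (auto simp: B2_def cross_eq_0 collinear_lemma)
      then show False using B1 assms by auto
    qed
  qed
  have "B1 + x *\<^sub>R B2 \<noteq> 0" for x
  proof
    assume "B1 + x *\<^sub>R B2 = 0"
    then have "B1 \<bullet> (B1 + x *\<^sub>R B2) = 0" by simp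
    then show False using B1 B2 by (simp add: inner_add_right)
  qed
  moreover have "\<not> (f \<bullet> B1 = 0 \<and> f \<bullet> B2 = 0)" if f: "f \<noteq> 0" "pline f \<noteq> pline l" for f
  proof
    assume "f \<bullet> B1 = 0 \<and> f \<bullet> B2 = 0"
    then obtain s where "B2 = s *\<^sub>R B1" using meet_unique[OF f(1) assms f(2) B1(1)] B1 B2 by metis
    then show False using B2 B1 by auto
  qed
  ultimately show ?thesis using B1 B2 by metis
qed

section \<open>No line of the system is missing\<close>

text \<open>\<open>L_inf\<close> is described by \<open>N_inf\<close> alone: it is the line that
  contains two different points \<open>N j\<close>.\<close>

locale near_mirror_system = mirror_system +
  fixes A :: "rp2 set set" and L_inf :: "rp2 set"
  assumes arr: "line_arrangement A" and smp: "simplicial A"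
    and close: "m > 7 * card (R - A) + 6 * card (A - R) + 7"
    and N_inf: "\<And>l i j. l \<noteq> 0 \<Longrightarrow> l \<bullet> N i = 0 \<Longrightarrow> l \<bullet> N j = 0 \<Longrightarrow> \<not> int m dvd i - j \<Longrightarrow> pline l = L_inf"
begin

lemma finite_A: "finite A"
  using arr by (simp add: line_arrangement_def)

lemma A_line: "L \<in> A \<Longrightarrow> \<exists>f. f \<in> cov A \<and> L = pline f"
  using arr by (auto simp: line_arrangement_def is_line_pline cov_def)

lemma R_line: "L \<in> R \<Longrightarrow> \<exists>f. f \<noteq> 0 \<and> L = pline f"
  using S_nz a_nz by (auto simp: R_def)

text \<open>Let \<open>X\<close> be the points in a chart of the missing line that lie on lines of
  \<open>A\<close>, and \<open>V\<close> those on at least two of them. Since \<open>V\<close> has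
  no neighbours, |X| \<le> 2 |X - V| + 1. A point outside \<open>V\<close> lies on an additional
  line, on another missing line, or is one of at most two simple points of the system, so |X - V|
  \<le> |E| + (|D| - 1) + 2. As a point carries at most two sides, m \<le> 2 |X| + |D| + 2. Together
  m \<le> 5 |D| + 4 |E| + 8, which contradicts \<open>close\<close> because |D| \<ge> 1.\<close>

lemma R_subset: "R \<subseteq> A"
proof (rule ccontr)
  assume "\<not> R \<subseteq> A"
  then obtain L where L: "L \<in> R" "L \<notin> A" by blast
  then obtain l where l: "l \<noteq> 0" "L = pline l" using R_line by metis
  obtain B1 B2 where B: "l \<bullet> B1 = 0" "l \<bullet> B2 = 0" "B2 \<noteq> 0" "\<And>x. B1 + x *\<^sub>R B2 \<noteq> 0"
      "\<And>f. f \<noteq> 0 \<Longrightarrow> pline f \<noteq> pline l \<Longrightarrow> \<not> (f \<bullet> B1 = 0 \<and> f \<bullet> B2 = 0)"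
    using line_chart[OF l(1)] by metis
  define p where "p x = B1 + x *\<^sub>R B2" for x :: real
  have p_nz: "p x \<noteq> 0" for x using B(4) by (simp add: p_def)
  have lp: "l \<bullet> p x = 0" for x using B by (simp add: p_def inner_add_right)
  have val: "f \<bullet> p x = f \<bullet> B1 + x * (f \<bullet> B2)" for f x by (simp add: p_def inner_add_right)
  have one: "x = y" if "f \<noteq> 0" "pline f \<noteq> L" "f \<bullet> p x = 0" "f \<bullet> p y = 0" for f x y
  proof -
    have "f \<bullet> B2 \<noteq> 0" using that B(5)[of f] l val[of f x] by auto
    moreover have "x * (f \<bullet> B2) = y * (f \<bullet> B2)" using that val[of f x] val[of f y] by linarith
    ultimately show ?thesis by simp
  qed
  define pts where "pts K = {x. proj (p x) \<in> K}" for K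
  have pts: "pts (pline f) = {x. f \<bullet> p x = 0}" for f
    unfolding pts_def using proj_in_pline[OF p_nz] by simp
  have pts1: "card (pts K) \<le> 1 \<and> finite (pts K)" if K: "K \<in> A \<union> R" "K \<noteq> L" for K
  proof -
    have "\<exists>f. f \<noteq> 0 \<and> K = pline f" using K(1) A_line R_line unfolding cov_def by blast
    then obtain f where f: "f \<noteq> 0" "K = pline f" by metis
    have u: "x \<in> pts K \<Longrightarrow> y \<in> pts K \<Longrightarrow> x = y" for x y
      using one[OF f(1)] K(2) unfolding f(2) pts by simp
    have "finite (pts K)"
    proof (cases "pts K = {}")
      case False
      then obtain x where "x \<in> pts K" by blast
      then have "pts K \<subseteq> {x}" using u by blast
      then show ?thesis using finite_subset by blast
    qed simp
    then show ?thesis using card_le_1I[of "pts K"] u by blast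
  qed
  define X where "X = (\<Union>K\<in>A. pts K)"
  define V where "V = {x. \<exists>K\<in>A. \<exists>K'\<in>A. K \<noteq> K' \<and> x \<in> pts K \<and> x \<in> pts K'}"
  have KL: "K \<noteq> L" if "K \<in> A" for K using that L by blast
  have finX: "finite X" unfolding X_def
    by (rule finite_UN_I[OF finite_A]) (use pts1 KL in blast)
  have VX: "V \<subseteq> X" by (auto simp: V_def X_def)
  have nonempty: "A \<noteq> {}"
  proof
    assume "A = {}"
    then show False using close card_R by simp
  qed
  have X_iff: "x \<in> X \<longleftrightarrow> (\<exists>f\<in>cov A. f \<bullet> p x = 0)" for x
  proof
    assume "x \<in> X"
    then obtain K where "K \<in> A" "x \<in> pts K" by (auto simp: X_def)
    then show "\<exists>f\<in>cov A. f \<bullet> p x = 0" using A_line pts by fastforce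
  next
    assume "\<exists>f\<in>cov A. f \<bullet> p x = 0"
    then show "x \<in> X" using pts by (auto simp: X_def cov_def)
  qed
  have V_D: "\<exists>f\<in>cov A. \<exists>g\<in>cov A. pline f \<noteq> pline g \<and> f \<bullet> p x = 0 \<and> g \<bullet> p x = 0" if x: "x \<in> V" for x
  proof -
    obtain K K' where K: "K \<in> A" "K' \<in> A" "K \<noteq> K'" "x \<in> pts K" "x \<in> pts K'" using x by (auto simp: V_def)
    obtain f g where fg: "f \<in> cov A" "K = pline f" "g \<in> cov A" "K' = pline g" using A_line K by metis
    have "pline f \<noteq> pline g" "f \<bullet> p x = 0" "g \<bullet> p x = 0" using K(3-5) unfolding fg pts by simp_all
    then show ?thesis using fg(1,3) by metis
  qed
  have gap: "\<exists>z\<in>X. x < z \<and> z < y" if xy: "x \<in> V" "y \<in> V" "x < y" for x y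
  proof (rule ccontr)
    assume none: "\<not> (\<exists>z\<in>X. x < z \<and> z < y)"
    obtain f1 f2 where f: "f1 \<in> cov A" "f2 \<in> cov A" "pline f1 \<noteq> pline f2" "f1 \<bullet> p x = 0" "f2 \<bullet> p x = 0"
      using V_D[OF xy(1)] by metis
    obtain g1 g2 where g: "g1 \<in> cov A" "g2 \<in> cov A" "pline g1 \<noteq> pline g2" "g1 \<bullet> p y = 0" "g2 \<bullet> p y = 0"
      using V_D[OF xy(2)] by metis
    have same: "(f \<bullet> p x) * (f \<bullet> p y) \<ge> 0" if fA: "f \<in> cov A" for f
    proof (rule ccontr)
      assume "\<not> ?thesis"
      then have neg: "(f \<bullet> p x) * (f \<bullet> p y) < 0" by simp
      then have d: "f \<bullet> p x - f \<bullet> p y \<noteq> 0" by (auto simp: mult_less_0_iff)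
      \<comment> \<open>The fraction of the way from \<open>x\<close> to \<open>y\<close> at which
        the affine function \<open>f \<bullet> p\<close> vanishes.\<close>
      define r where "r = (f \<bullet> p x) / (f \<bullet> p x - f \<bullet> p y)"
      have r: "0 < r" "r < 1" using neg by (auto simp: r_def mult_less_0_iff field_simps)
      define z where "z = x + r * (y - x)"
      have "f \<bullet> p z = f \<bullet> p x - r * (f \<bullet> p x - f \<bullet> p y)"
        by (simp add: z_def val algebra_simps)
      then have "f \<bullet> p z = 0" using d by (simp add: r_def)
      then have "z \<in> X" using X_iff fA by blast
      moreover have "x < z" using r xy(3) by (simp add: z_def)
      moreover have "z < y"
      proof -
        have "r * (y - x) < 1 * (y - x)" using r xy(3) by (intro mult_strict_right_mono) auto
        then show ?thesis by (simp add: z_def)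
      qed
      ultimately show False using none by blast
    qed
    have off: "f \<bullet> (p x + p y) \<noteq> 0" if fA: "f \<in> cov A" for f
    proof
      assume "f \<bullet> (p x + p y) = 0"
      \<comment> \<open>\<open>p x + p y\<close> is twice the point whose parameter is the mean of
        \<open>x\<close> and \<open>y\<close>.\<close>
      then have "f \<bullet> p ((x + y) / 2) = 0" by (simp add: val inner_add_right field_simps)
      then have "(x + y) / 2 \<in> X" using X_iff fA by blast
      moreover have "x < (x + y) / 2" "(x + y) / 2 < y" using xy(3) by simp_all
      ultimately show False using none by blast
    qed
    show False
      by (rule adjacent_vertices_impossible[OF arr smp nonempty p_nz p_nz same off f g])
  qed
  have cardX: "card X \<le> 2 * card (X - V) + 1"
    by (rule card_no_consecutive[OF finX VX gap])
  let ?Xs = "{x. \<exists>f. f \<noteq> 0 \<and> pline f \<in> R \<and> pline f \<noteq> pline l \<and> f \<bullet> (B1 + x *\<^sub>R B2) = 0 \<and>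
      (\<forall>g. g \<noteq> 0 \<and> pline g \<in> R \<and> g \<bullet> (B1 + x *\<^sub>R B2) = 0 \<longrightarrow> pline g = pline f \<or> pline g = pline l)}"
  have Xs: "card ?Xs \<le> 2 \<and> finite ?Xs"
  proof (rule card_simple_points)
    show "pline l \<in> R" "l \<noteq> 0" using L l by simp_all
    show "B1 + x *\<^sub>R B2 \<noteq> 0" for x by (rule B(4))
    show "l \<bullet> (B1 + x *\<^sub>R B2) = 0" for x using lp by (simp add: p_def)
    fix f :: "real^3" assume f: "f \<noteq> 0" "pline f \<noteq> pline l"
    have u: "x = y" if "f \<bullet> (B1 + x *\<^sub>R B2) = 0" "f \<bullet> (B1 + y *\<^sub>R B2) = 0" for x y
      using one[OF f(1)] f(2) that by (simp add: l p_def)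
    have fin: "finite {x. f \<bullet> (B1 + x *\<^sub>R B2) = 0}"
    proof (cases "\<exists>x. f \<bullet> (B1 + x *\<^sub>R B2) = 0")
      case True
      then obtain x where "f \<bullet> (B1 + x *\<^sub>R B2) = 0" by blast
      then have "{x. f \<bullet> (B1 + x *\<^sub>R B2) = 0} \<subseteq> {x}" using u by blast
      then show ?thesis using finite_subset by blast
    qed simp
    show "card {x. f \<bullet> (B1 + x *\<^sub>R B2) = 0} \<le> 1 \<and> finite {x. f \<bullet> (B1 + x *\<^sub>R B2) = 0}"
      using fin by (intro conjI card_le_1I) (auto intro: u)
  qed
  define E where "E = A - R"
  define D where "D = R - A"
  have finE: "finite E" and finD: "finite D" using finite_A finite_R by (simp_all add: E_def D_def)
  have LD: "L \<in> D" using L by (simp add: D_def)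
  have sub: "X - V \<subseteq> (\<Union>K\<in>E. pts K) \<union> (\<Union>K\<in>D - {L}. pts K) \<union> ?Xs"
  proof
    fix x assume x: "x \<in> X - V"
    then obtain K where K: "K \<in> A" "x \<in> pts K" by (auto simp: X_def)
    show "x \<in> (\<Union>K\<in>E. pts K) \<union> (\<Union>K\<in>D - {L}. pts K) \<union> ?Xs"
    proof (cases "K \<in> R \<and> x \<notin> (\<Union>K\<in>D - {L}. pts K)")
      case True
      obtain f where f: "f \<noteq> 0" "K = pline f" using R_line True by metis
      have "pline f \<in> R" "pline f \<noteq> pline l" using True f K KL l by auto
      moreover have "f \<bullet> (B1 + x *\<^sub>R B2) = 0" using K(2) unfolding f(2) pts p_def by simp
      moreover have "pline g = pline f \<or> pline g = pline l"
        if "g \<noteq> 0 \<and> pline g \<in> R \<and> g \<bullet> (B1 + x *\<^sub>R B2) = 0" for g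
      proof (rule ccontr)
        assume ne: "\<not> ?thesis"
        have xg: "x \<in> pts (pline g)" using that pts by (simp add: p_def)
        show False
        proof (cases "pline g \<in> A")
          case True
          then have "x \<in> V" using K xg ne f unfolding V_def by blast
          then show False using x by blast
        next
          case False
          then have "pline g \<in> D - {L}" using that ne l by (simp add: D_def)
          then show False using xg \<open>K \<in> R \<and> x \<notin> (\<Union>K\<in>D - {L}. pts K)\<close> by blast
        qed
      qed
      ultimately have "x \<in> ?Xs" using f(1) by blast
      then show ?thesis by blast
    next
      case False
      then show ?thesis using K by (auto simp: E_def)
    qed
  qed
  have "card (X - V) \<le> card E + card (D - {L}) + 2"
  proof -
    have "card (\<Union>K\<in>E. pts K) \<le> 1 * card E"
      by (rule card_UN_le_mult[OF finE]) (use pts1 KL in \<open>auto simp: E_def\<close>)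
    moreover have "card (\<Union>K\<in>D - {L}. pts K) \<le> 1 * card (D - {L})"
      by (rule card_UN_le_mult) (use finD pts1 in \<open>auto simp: D_def\<close>)
    moreover have "finite (\<Union>K\<in>E. pts K)"
      by (rule finite_UN_I[OF finE]) (use pts1 KL in \<open>auto simp: E_def\<close>)
    moreover have "finite (\<Union>K\<in>D - {L}. pts K)"
      by (rule finite_UN_I) (use finD pts1 in \<open>auto simp: D_def\<close>)
    ultimately have "card ((\<Union>K\<in>E. pts K) \<union> (\<Union>K\<in>D - {L}. pts K) \<union> ?Xs) \<le> card E + card (D - {L}) + 2"
      "finite ((\<Union>K\<in>E. pts K) \<union> (\<Union>K\<in>D - {L}. pts K) \<union> ?Xs)"
      using Xs card_Un_le[of "(\<Union>K\<in>E. pts K) \<union> (\<Union>K\<in>D - {L}. pts K)" ?Xs]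
        card_Un_le[of "\<Union>K\<in>E. pts K" "\<Union>K\<in>D - {L}. pts K"] by (linarith, blast)
    then show ?thesis using card_subset_le[OF sub] by blast
  qed
  moreover have "card (D - {L}) + 1 = card D" using card_Suc_Diff1[OF finD LD] by simp
  \<comment> \<open>The summand \<open>card D\<close> allows for the missing sides, and 2 for the
    sides through the point \<open>B2\<close> outside the chart.\<close>
  moreover have "m \<le> 2 * card X + card D + 2"
  proof -
    let ?T = "{i \<in> I. pline (S i) \<in> A}"
    let ?T2 = "{i \<in> I. S i \<bullet> B2 = 0}"
    have "I \<subseteq> {i \<in> I. pline (S i) \<in> D} \<union> ?T" using S_in_R by (auto simp: D_def)
    moreover have "card {i \<in> I. pline (S i) \<in> D} \<le> card D"
      by (rule card_inj_on_le[of "\<lambda>i. pline (S i)"]) (use inj_S finD in \<open>auto simp: inj_on_def\<close>)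
    moreover have "finite ({i \<in> I. pline (S i) \<in> D} \<union> ?T)" using finite_I by simp
    ultimately have 1: "m \<le> card D + card ?T"
      using card_mono[of "{i \<in> I. pline (S i) \<in> D} \<union> ?T" I] card_Un_le[of "{i \<in> I. pline (S i) \<in> D}" ?T] card_I
      by linarith
    have no3: "card {i \<in> I. S i \<bullet> y = 0} \<le> 2" if "y \<noteq> 0" for y
    proof (rule card_le_2I)
      fix i j k assume "i \<in> {i \<in> I. S i \<bullet> y = 0}" "j \<in> {i \<in> I. S i \<bullet> y = 0}" "k \<in> {i \<in> I. S i \<bullet> y = 0}"
      then show "i = j \<or> j = k \<or> i = k" using no_three_sides[of i y j k] that I_eq by blast
    qed
    have "?T \<subseteq> ?T2 \<union> (\<Union>x\<in>X. {i \<in> I. S i \<bullet> p x = 0})"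
    proof
      fix i assume i: "i \<in> ?T"
      show "i \<in> ?T2 \<union> (\<Union>x\<in>X. {i \<in> I. S i \<bullet> p x = 0})"
      proof (cases "S i \<bullet> B2 = 0")
        case False
        define x where "x = - (S i \<bullet> B1) / (S i \<bullet> B2)"
        have "S i \<bullet> p x = 0" using False by (simp add: val x_def)
        moreover have "S i \<in> cov A" using i S_nz by (simp add: cov_def)
        ultimately show ?thesis using X_iff i by blast
      qed (use i in simp)
    qed
    moreover have "card (\<Union>x\<in>X. {i \<in> I. S i \<bullet> p x = 0}) \<le> 2 * card X"
      by (rule card_UN_le_mult[OF finX]) (rule no3[OF p_nz])
    moreover have "finite (?T2 \<union> (\<Union>x\<in>X. {i \<in> I. S i \<bullet> p x = 0}))" using finite_I finX by simp
    ultimately have "card ?T \<le> 2 + 2 * card X"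
      using card_mono[of "?T2 \<union> (\<Union>x\<in>X. {i \<in> I. S i \<bullet> p x = 0})" ?T]
        card_Un_le[of ?T2 "\<Union>x\<in>X. {i \<in> I. S i \<bullet> p x = 0}"] no3[OF B(3)] by linarith
    then show ?thesis using 1 by linarith
  qed
  moreover have "m > 7 * card D + 6 * card E + 7" using close by (simp add: D_def E_def)
  ultimately show False using cardX by linarith
qed

end

section \<open>Additional lines\<close>

text \<open>The line \<open>\<mu>\<close> spoils the point where \<open>b\<close> meets \<open>l\<close>: it passes through that point or
  meets \<open>l\<close> in a neighbouring vertex.\<close>

definition spoils :: "rp2 set set \<Rightarrow> real^3 \<Rightarrow> real^3 \<Rightarrow> real^3 \<Rightarrow> bool" where
  "spoils A l \<mu> b \<longleftrightarrow> (\<exists>U P. U \<noteq> 0 \<and> P \<noteq> 0 \<and> l \<bullet> U = 0 \<and> \<mu> \<bullet> U = 0 \<and> l \<bullet> P = 0 \<and> b \<bullet> P = 0 \<and>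
     (b \<bullet> U = 0 \<or> (\<forall>f\<in>cov A. (f \<bullet> P) * (f \<bullet> U) \<ge> 0)))"

text \<open>With \<open>U0\<close> the intersection of \<open>l\<close> and \<open>\<mu>\<close>, a
  spoiled point on \<open>l\<close> either is \<open>U0\<close> or is adjacent to \<open>U0\<close>
  in one of two directions; each case admits at most one index.\<close>

lemma card_spoiled:
  fixes b :: "int \<Rightarrow> real^3"
  assumes l: "l \<noteq> 0" "\<mu> \<noteq> 0" "pline l \<noteq> pline \<mu>"
    and b: "\<And>i. i \<in> J \<Longrightarrow> b i \<in> cov A" "\<And>i. i \<in> J \<Longrightarrow> pline (b i) \<noteq> pline l"
    and dist: "\<And>i j P. i \<in> J \<Longrightarrow> j \<in> J \<Longrightarrow> P \<noteq> 0 \<Longrightarrow> l \<bullet> P = 0 \<Longrightarrow> b i \<bullet> P = 0 \<Longrightarrow> b j \<bullet> P = 0 \<Longrightarrow> i = j"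
    and fin: "finite J"
  shows "card {i \<in> J. spoils A l \<mu> (b i)} \<le> 3"
proof -
  obtain U0 where U0: "U0 \<noteq> 0" "l \<bullet> U0 = 0" "\<mu> \<bullet> U0 = 0" using meet_exists[OF l] by metis
  have line: "\<exists>s. y = s *\<^sub>R U0" if "l \<bullet> y = 0" "\<mu> \<bullet> y = 0" for y
    using meet_unique[OF l U0] that by metis
  define Z where "Z = {i \<in> J. b i \<bullet> U0 = 0}"
  \<comment> \<open>Fixing \<open>\<mu> \<bullet> P = 1\<close> removes the sign ambiguity of
    \<open>P\<close>, so \<open>U0\<close> and \<open>- U0\<close> stand for the two
    directions.\<close>
  define Near where "Near U = {i \<in> J. b i \<bullet> U0 \<noteq> 0 \<and> (\<exists>P. l \<bullet> P = 0 \<and> b i \<bullet> P = 0 \<and> \<mu> \<bullet> P = 1 \<and>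
      (\<forall>f\<in>cov A. (f \<bullet> P) * (f \<bullet> U) \<ge> 0))}" for U
  have Z1: "card Z \<le> 1" by (rule card_le_1I) (use dist U0 in \<open>auto simp: Z_def\<close>)
  have N1: "card (Near U) \<le> 1" if U: "U = U0 \<or> U = - U0" for U
  proof (rule card_le_1I)
    fix i j assume ij: "i \<in> Near U" "j \<in> Near U"
    obtain P where P: "l \<bullet> P = 0" "b i \<bullet> P = 0" "\<mu> \<bullet> P = 1" "\<forall>f\<in>cov A. (f \<bullet> P) * (f \<bullet> U) \<ge> 0"
      using ij(1) unfolding Near_def by blast
    obtain Q where Q: "l \<bullet> Q = 0" "b j \<bullet> Q = 0" "\<mu> \<bullet> Q = 1" "\<forall>f\<in>cov A. (f \<bullet> Q) * (f \<bullet> U) \<ge> 0"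
      using ij(2) unfolding Near_def by blast
    obtain s where "Q - P = s *\<^sub>R U0" using line[of "Q - P"] P Q by (auto simp: inner_diff_right)
    then have Q_eq: "Q = P + s *\<^sub>R U0" by (simp add: algebra_simps)
    have "\<exists>r. Q = P + r *\<^sub>R U"
      using U
    proof
      assume "U = - U0"
      then have "Q = P + (- s) *\<^sub>R U" using Q_eq by simp
      then show ?thesis ..
    qed (use Q_eq in blast)
    then obtain r where r: "Q = P + r *\<^sub>R U" ..
    have iJ: "i \<in> J" "j \<in> J" and nz: "b i \<bullet> U \<noteq> 0" "b j \<bullet> U \<noteq> 0" using ij U unfolding Near_def by auto
    \<comment> \<open>\<open>b i\<close> vanishes at \<open>P\<close> and \<open>b j\<close> at
      \<open>Q\<close>, so these two sign conditions give \<open>r \<ge> 0\<close> and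
      \<open>r \<le> 0\<close>.\<close>
    have "(b i \<bullet> Q) * (b i \<bullet> U) \<ge> 0" "(b j \<bullet> P) * (b j \<bullet> U) \<ge> 0" using P(4) Q(4) b(1) iJ by blast+
    moreover have "b i \<bullet> Q = r * (b i \<bullet> U)" "b j \<bullet> P = - r * (b j \<bullet> U)"
      using P(2) Q(2) unfolding r by (simp_all add: inner_add_right)
    ultimately have "r * ((b i \<bullet> U) * (b i \<bullet> U)) \<ge> 0" "- r * ((b j \<bullet> U) * (b j \<bullet> U)) \<ge> 0"
      by (simp_all add: mult.assoc)
    moreover have "(b i \<bullet> U) * (b i \<bullet> U) > 0" "(b j \<bullet> U) * (b j \<bullet> U) > 0" using nz by (metis not_real_square_gt_zero)+
    ultimately have "r = 0" by (auto simp: zero_le_mult_iff mult_le_0_iff)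
    then have "b i \<bullet> P = 0" "b j \<bullet> P = 0" "P \<noteq> 0" using P Q r by auto
    then show "i = j" using dist iJ P(1) by metis
  qed
  have "{i \<in> J. spoils A l \<mu> (b i)} \<subseteq> Z \<union> Near U0 \<union> Near (- U0)"
  proof safe
    fix i assume i: "i \<in> J" "spoils A l \<mu> (b i)" "i \<notin> Near (- U0)" "i \<notin> Near U0"
    obtain U P where U: "U \<noteq> 0" "P \<noteq> 0" "l \<bullet> U = 0" "\<mu> \<bullet> U = 0" "l \<bullet> P = 0" "b i \<bullet> P = 0"
      "b i \<bullet> U = 0 \<or> (\<forall>f\<in>cov A. (f \<bullet> P) * (f \<bullet> U) \<ge> 0)" using i(2) unfolding spoils_def by metis
    obtain z where z: "U = z *\<^sub>R U0" using line U by metis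
    then have z0: "z \<noteq> 0" using U(1) by auto
    have "b i \<bullet> U0 = 0"
    proof (rule ccontr)
      assume nz: "b i \<bullet> U0 \<noteq> 0"
      then have pos: "\<And>f. f \<in> cov A \<Longrightarrow> (f \<bullet> P) * (f \<bullet> U) \<ge> 0" using U(7) z z0 by auto
      have muP: "\<mu> \<bullet> P \<noteq> 0"
      proof
        assume "\<mu> \<bullet> P = 0"
        then obtain s where s: "P = s *\<^sub>R U0" using line U by metis
        then have "s \<noteq> 0" using U(2) by auto
        then show False using s U(6) nz by simp
      qed
      define P' where "P' = (1 / (\<mu> \<bullet> P)) *\<^sub>R P"
      have P': "l \<bullet> P' = 0" "b i \<bullet> P' = 0" "\<mu> \<bullet> P' = 1" using U muP by (simp_all add: P'_def)
      have "(f \<bullet> P') * (f \<bullet> U0) = ((f \<bullet> P) * (f \<bullet> U)) / (z * (\<mu> \<bullet> P))" for f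
        using z0 muP by (simp add: P'_def z field_simps)
      moreover have "(f \<bullet> P') * (f \<bullet> (- U0)) = - ((f \<bullet> P') * (f \<bullet> U0))" for f by simp
      ultimately have "(\<forall>f\<in>cov A. (f \<bullet> P') * (f \<bullet> U0) \<ge> 0) \<or> (\<forall>f\<in>cov A. (f \<bullet> P') * (f \<bullet> (- U0)) \<ge> 0)"
      proof (cases "z * (\<mu> \<bullet> P) > 0")
        case True
        assume eq: "\<And>f. (f \<bullet> P') * (f \<bullet> U0) = ((f \<bullet> P) * (f \<bullet> U)) / (z * (\<mu> \<bullet> P))"
        show ?thesis unfolding eq using pos True by (intro disjI1 ballI divide_nonneg_pos)
      next
        case False
        assume eq: "\<And>f. (f \<bullet> P') * (f \<bullet> U0) = ((f \<bullet> P) * (f \<bullet> U)) / (z * (\<mu> \<bullet> P))"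
          and eq2: "\<And>f. (f \<bullet> P') * (f \<bullet> (- U0)) = - ((f \<bullet> P') * (f \<bullet> U0))"
        have "z * (\<mu> \<bullet> P) < 0" using False z0 muP by (metis linorder_neqE_linordered_idom mult_eq_0_iff)
        then have "((f \<bullet> P) * (f \<bullet> U)) / (z * (\<mu> \<bullet> P)) \<le> 0" if "f \<in> cov A" for f
          using pos[OF that] by (simp only: divide_nonneg_neg)
        then show ?thesis unfolding eq2 eq by simp
      qed
      then have "i \<in> Near U0 \<or> i \<in> Near (- U0)" using i(1) nz P' unfolding Near_def by blast
      then show False using i by blast
    qed
    then show "i \<in> Z" using i by (simp add: Z_def)
  qed
  moreover have "finite (Z \<union> Near U0 \<union> Near (- U0))" using fin by (simp add: Z_def Near_def)
  ultimately have "card {i \<in> J. spoils A l \<mu> (b i)} \<le> card (Z \<union> Near U0 \<union> Near (- U0))"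
    by (rule card_mono[rotated])
  also have "\<dots> \<le> 3"
    using card_Un_le[of "Z \<union> Near U0" "Near (- U0)"] card_Un_le[of Z "Near U0"] Z1 N1[of U0] N1[of "- U0"] by simp
  finally show ?thesis .
qed

context near_mirror_system
begin

lemma S_cov: "S i \<in> cov A" and a_cov: "a i \<in> cov A"
  using R_subset S_in_R a_in_R S_nz a_nz by (auto simp: cov_def)

definition E :: "rp2 set set" where "E = A - R"

lemma finite_E: "finite E"
  using finite_A by (simp add: E_def)

lemma m_large: "m > 6 * card E + 7"
  using close by (simp add: E_def)

lemma not_dvd_small: "\<not> int m dvd 0 - 1"
  using m zdvd_not_zless[of 1 "int m"] by simp

text \<open>A union bound over \<open>K\<close>, each line of which spoils at most three of the
  candidates.\<close>

lemma good_index: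
  assumes l: "l \<in> cov A" "finite K" "\<And>L. L \<in> K \<Longrightarrow> L \<in> A \<and> L \<noteq> pline l"
    and J: "J \<subseteq> I" and b: "\<And>i. i \<in> J \<Longrightarrow> b i \<in> cov A" "\<And>i. i \<in> J \<Longrightarrow> pline (b i) \<noteq> pline l"
    and dist: "\<And>i j P. i \<in> J \<Longrightarrow> j \<in> J \<Longrightarrow> P \<noteq> 0 \<Longrightarrow> l \<bullet> P = 0 \<Longrightarrow> b i \<bullet> P = 0 \<Longrightarrow> b j \<bullet> P = 0 \<Longrightarrow> i = j"
  shows "card J \<le> card {i \<in> J. \<forall>\<mu>\<in>cov A. pline \<mu> \<in> K \<longrightarrow> \<not> spoils A l \<mu> (b i)} + 3 * card K"
proof -
  have finJ: "finite J" using J finite_I finite_subset by blast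
  have l0: "l \<noteq> 0" using l by (simp add: cov_def)
  define bad where "bad L = {i \<in> J. \<exists>\<mu>\<in>cov A. pline \<mu> = L \<and> spoils A l \<mu> (b i)}" for L
  have "card (bad L) \<le> 3" if L: "L \<in> K" for L
  proof -
    obtain \<mu> where \<mu>: "\<mu> \<in> cov A" "L = pline \<mu>" using A_line l(3)[OF L] by metis
    have "bad L \<subseteq> {i \<in> J. spoils A l \<mu> (b i)}"
    proof safe
      fix i assume "i \<in> bad L"
      then obtain \<mu>' where \<mu>': "\<mu>' \<in> cov A" "pline \<mu>' = L" "spoils A l \<mu>' (b i)" "i \<in> J" by (auto simp: bad_def)
      have "\<mu> \<noteq> 0" "\<mu>' \<noteq> 0" "pline \<mu> = pline \<mu>'" using \<mu> \<mu>' by (simp_all add: cov_def)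
      then obtain s where "s \<noteq> 0" "\<mu>' = s *\<^sub>R \<mu>" using pline_eq_iff by metis
      then show "spoils A l \<mu> (b i)" using \<mu>'(3) unfolding spoils_def by simp
      show "i \<in> J" by fact
    qed
    moreover have "card {i \<in> J. spoils A l \<mu> (b i)} \<le> 3"
    proof (rule card_spoiled)
      show "\<mu> \<noteq> 0" using \<mu> by (simp add: cov_def)
      show "pline l \<noteq> pline \<mu>" using l(3)[OF L] \<mu>(2) by metis
      show "l \<noteq> 0" "finite J" by fact+
    qed (fact b dist)+
    moreover have "finite {i \<in> J. spoils A l \<mu> (b i)}" using finJ by simp
    ultimately show ?thesis using card_subset_le by metis
  qed
  then have badK: "card (\<Union>L\<in>K. bad L) \<le> 3 * card K" by (intro card_UN_le_mult[OF l(2)])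
  have "J \<subseteq> {i \<in> J. \<forall>\<mu>\<in>cov A. pline \<mu> \<in> K \<longrightarrow> \<not> spoils A l \<mu> (b i)} \<union> (\<Union>L\<in>K. bad L)"
    by (auto simp: bad_def)
  moreover have "finite (\<Union>L\<in>K. bad L)" by (rule finite_UN_I[OF l(2)]) (simp add: bad_def finJ)
  ultimately have "card J \<le> card ({i \<in> J. \<forall>\<mu>\<in>cov A. pline \<mu> \<in> K \<longrightarrow> \<not> spoils A l \<mu> (b i)} \<union> (\<Union>L\<in>K. bad L))"
    using finJ by (intro card_mono) simp_all
  also have "\<dots> \<le> card {i \<in> J. \<forall>\<mu>\<in>cov A. pline \<mu> \<in> K \<longrightarrow> \<not> spoils A l \<mu> (b i)} + card (\<Union>L\<in>K. bad L)"
    by (rule card_Un_le)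
  finally show ?thesis using badK by linarith
qed

lemma spoils_incident:
  assumes "P \<noteq> 0" "l \<bullet> P = 0" "\<mu> \<bullet> P = 0" "b \<bullet> P = 0"
  shows "spoils A l \<mu> b"
  unfolding spoils_def using assms by (intro exI[of _ P]) simp

lemma spoils_adjacent:
  assumes "P \<noteq> 0" "l \<bullet> P = 0" "b \<bullet> P = 0" "U \<noteq> 0" "l \<bullet> U = 0" "\<mu> \<bullet> U = 0" "\<forall>f\<in>cov A. (f \<bullet> P) * (f \<bullet> U) \<ge> 0"
  shows "spoils A l \<mu> b"
  unfolding spoils_def using assms by (intro exI[of _ U] exI[of _ P]) simp

text \<open>Choose a side whose intersection \<open>P\<close> with \<open>l\<close> is unspoiled. A
  neighbour \<open>U\<close> of \<open>P\<close> on \<open>l\<close> lies on two distinct lines of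
  the system and is not the centre, so both are sides. Then their mirror axis passes through
  \<open>U\<close> as well, and an axis meets \<open>l\<close> only in the centre.\<close>

lemma extra_line_not_through_O:
  assumes l: "l \<in> cov A" "pline l \<notin> R"
  shows "l \<bullet> O_pt \<noteq> 0"
proof
  assume lO: "l \<bullet> O_pt = 0"
  have l0: "l \<noteq> 0" using l by (simp add: cov_def)
  have lS: "pline (S i) \<noteq> pline l" and la: "pline (a i) \<noteq> pline l" for i using l S_in_R a_in_R by metis+
  have axis_O: "\<exists>s. P = s *\<^sub>R O_pt" if "l \<bullet> P = 0" "a j \<bullet> P = 0" for P j
    using meet_unique[OF a_nz l0 la O_nz aO lO] that by metis
  have two_sides: "\<exists>s. P = s *\<^sub>R O_pt" if "l \<bullet> P = 0" "S i \<bullet> P = 0" "S j \<bullet> P = 0" "pline (S i) \<noteq> pline (S j)" for P i j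
    using axis_O[OF that(1) sides_meet_on_axis[OF that(2,3)]] that(4) S_eq_iff by metis
  have not_O: "P = s *\<^sub>R O_pt \<Longrightarrow> P \<noteq> 0 \<Longrightarrow> S i \<bullet> P \<noteq> 0" for P s i using SO[of i] by auto
  \<comment> \<open>All axes meet \<open>l\<close> in the centre, so \<open>a 0\<close> represents
    them: if it does not spoil, the centre is not adjacent to \<open>P\<close>. It takes the place
    of \<open>l\<close> in \<open>E\<close>, hence \<open>card K \<le> card E\<close>.\<close>
  define K where "K = insert (pline (a 0)) (E - {pline l})"
  have "pline l \<in> E" using l by (simp add: E_def cov_def)
  have finK: "finite K" using finite_E by (simp add: K_def)
  have "card K \<le> card (E - {pline l}) + 1" unfolding K_def using card_insert_le_m1 by (simp add: card_insert_if finite_E)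
  then have cardK: "card K \<le> card E" using card_Suc_Diff1[OF finite_E \<open>pline l \<in> E\<close>] by simp
  have "card I \<le> card {i \<in> I. \<forall>\<mu>\<in>cov A. pline \<mu> \<in> K \<longrightarrow> \<not> spoils A l \<mu> (S i)} + 3 * card K"
  proof (rule good_index[OF l(1) finK _ subset_refl S_cov lS])
    show "L \<in> A \<and> L \<noteq> pline l" if "L \<in> K" for L
      using that la a_cov by (auto simp: K_def E_def cov_def)
    fix i j P assume "i \<in> I" "j \<in> I" "P \<noteq> 0" "l \<bullet> P = 0" "S i \<bullet> P = 0" "S j \<bullet> P = 0"
    then show "i = j" using two_sides[of P i j] not_O I_eq S_eq_iff by metis
  qed
  then have "card {i \<in> I. \<forall>\<mu>\<in>cov A. pline \<mu> \<in> K \<longrightarrow> \<not> spoils A l \<mu> (S i)} \<noteq> 0"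
    using cardK m_large card_I by linarith
  then obtain i where i: "i \<in> I" "\<And>\<mu>. \<mu> \<in> cov A \<Longrightarrow> pline \<mu> \<in> K \<Longrightarrow> \<not> spoils A l \<mu> (S i)"
    by (metis (mono_tags, lifting) card.empty ex_in_conv mem_Collect_eq)
  obtain P where P: "P \<noteq> 0" "l \<bullet> P = 0" "S i \<bullet> P = 0" using meet_exists[OF l0 S_nz] lS by metis
  have KE: "pline f \<in> K" if "f \<in> cov A" "pline f \<notin> R" "pline f \<noteq> pline l" for f
    using that by (auto simp: K_def E_def cov_def)
  have a0K: "pline (a 0) \<in> K" by (simp add: K_def)
  interpret dp: double_point A l "S i" P
  proof
    fix f assume f: "f \<in> cov A" "f \<bullet> P = 0"
    then have f0: "f \<noteq> 0" by (simp add: cov_def)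
    show "pline f = pline l \<or> pline f = pline (S i)"
    proof (cases "pline f \<in> R")
      case True
      then show ?thesis using f0
      proof (cases rule: R_cases)
        case (1 k s)
        then have "S k \<bullet> P = 0" using f by simp
        then show ?thesis using two_sides[of P i k] not_O P 1(3) by metis
      next
        case (2 k s)
        then have "a k \<bullet> P = 0" using f by simp
        then show ?thesis using axis_O not_O P by metis
      qed
    next
      case False
      then show ?thesis using KE f i(2) spoils_incident P by metis
    qed
  qed (use arr smp l S_cov lS[of i] P in simp_all)
  have "\<exists>f\<in>cov A. pline f \<noteq> pline l \<and> pline f \<noteq> pline (S i) \<and> f \<bullet> Y \<noteq> 0"
    if Y: "S i \<bullet> Y = 0" "l \<bullet> Y = 1" for Y
  proof (rule ccontr)
    assume "\<not> ?thesis"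
    then have "a 0 \<bullet> Y = 0" "a 1 \<bullet> Y = 0" using a_cov la Sa_neq by metis+
    then obtain s where "Y = s *\<^sub>R O_pt" using axes_meet_at_O not_dvd_small by metis
    then show False using not_O Y by force
  qed
  from dp.distinct_quadrant_lines[OF this] obtain U \<mu> \<mu>' where U: "U \<noteq> 0" "l \<bullet> U = 0" "\<forall>f\<in>cov A. (f \<bullet> P) * (f \<bullet> U) \<ge> 0"
    and \<mu>: "\<mu> \<in> cov A" "\<mu> \<bullet> U = 0" "\<mu> \<bullet> P \<noteq> 0" and \<mu>': "\<mu>' \<in> cov A" "\<mu>' \<bullet> U = 0" "\<mu>' \<bullet> P \<noteq> 0"
    and ne: "pline \<mu> \<noteq> pline \<mu>'" by metis
  have U_not_O: "U \<noteq> s *\<^sub>R O_pt" for s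
  proof
    assume "U = s *\<^sub>R O_pt"
    then have "a 0 \<bullet> U = 0" using aO by simp
    then have "spoils A l (a 0) (S i)" using spoils_adjacent[OF P(1,2,3) U(1,2) _ U(3)] by blast
    then show False using i(2)[OF a_cov a0K] by blast
  qed
  have side: "\<exists>k. S k \<bullet> U = 0 \<and> pline \<nu> = pline (S k)" if \<nu>: "\<nu> \<in> cov A" "\<nu> \<bullet> U = 0" "\<nu> \<bullet> P \<noteq> 0" for \<nu>
  proof -
    have \<nu>0: "\<nu> \<noteq> 0" using \<nu> by (simp add: cov_def)
    have "pline \<nu> \<noteq> pline l"
    proof
      assume "pline \<nu> = pline l"
      then show False using proj_in_pline[OF P(1)] P(2) \<nu>(3) by metis
    qed
    then have "pline \<nu> \<in> R"
      using KE[OF \<nu>(1)] i(2)[OF \<nu>(1)] spoils_adjacent[OF P(1,2,3) U(1,2) \<nu>(2) U(3)] by blast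
    then show ?thesis using \<nu>0
    proof (cases rule: R_cases)
      case (1 k s)
      then show ?thesis using \<nu> by auto
    next
      case (2 k s)
      then have "a k \<bullet> U = 0" using \<nu> by simp
      then show ?thesis using axis_O[OF U(2)] U_not_O by metis
    qed
  qed
  show False using side[OF \<mu>] side[OF \<mu>'] ne two_sides[OF U(2)] U_not_O by metis
qed

text \<open>Where an axis meets \<open>l\<close> on a side, the mirror image of that side passes
  through the same point. So the axis uses up two sides, or just one if the point is a midpoint
  \<open>M i\<close>. Different axes use different sides, and \<open>l\<close> contains at most two
  midpoints.\<close>

lemma card_axes_meeting_sides:
  assumes l: "l \<in> cov A" "pline l \<notin> R" "pline l \<noteq> L_inf"
  shows "2 * card {j \<in> I. \<exists>i P. P \<noteq> 0 \<and> l \<bullet> P = 0 \<and> a j \<bullet> P = 0 \<and> S i \<bullet> P = 0} \<le> m + 2"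
proof -
  let ?J = "{j \<in> I. \<exists>i P. P \<noteq> 0 \<and> l \<bullet> P = 0 \<and> a j \<bullet> P = 0 \<and> S i \<bullet> P = 0}"
  have l0: "l \<noteq> 0" using l by (simp add: cov_def)
  have lS: "pline (S i) \<noteq> pline l" and la: "pline (a i) \<noteq> pline l" for i using l S_in_R a_in_R by metis+
  define F where "F j = {i \<in> I. \<exists>P. P \<noteq> 0 \<and> l \<bullet> P = 0 \<and> a j \<bullet> P = 0 \<and> S i \<bullet> P = 0}" for j
  have finJ: "finite ?J" and finF: "finite (F j)" for j using finite_I by (simp_all add: F_def)
  have transfer: "\<exists>i'\<in>I. int m dvd i - i' \<and> S i' \<bullet> P = 0" if P: "S i \<bullet> P = 0" "P \<noteq> 0" for i P
  proof -
    obtain i' where "i' \<in> I" "int m dvd i - i'" using index_in_I by blast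
    moreover from this have "pline (S i) = pline (S i')" using S_eq_iff by blast
    ultimately show ?thesis using P proj_in_pline by metis
  qed
  have F_ne: "F j \<noteq> {}" if j: "j \<in> ?J" for j
  proof -
    obtain i P where "P \<noteq> 0" "l \<bullet> P = 0" "a j \<bullet> P = 0" "S i \<bullet> P = 0" using j by blast
    then show ?thesis using transfer[of i P] unfolding F_def by blast
  qed
  have F_disj: "F j \<inter> F k = {}" if jk: "j \<in> ?J" "k \<in> ?J" "j \<noteq> k" for j k
  proof (rule ccontr)
    assume "F j \<inter> F k \<noteq> {}"
    then obtain i P Q where P: "P \<noteq> 0" "l \<bullet> P = 0" "a j \<bullet> P = 0" "S i \<bullet> P = 0"
      and Q: "Q \<noteq> 0" "l \<bullet> Q = 0" "a k \<bullet> Q = 0" "S i \<bullet> Q = 0" unfolding F_def by blast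
    obtain s where s: "Q = s *\<^sub>R P" using meet_unique[OF S_nz l0 lS P(1) P(4,2) Q(4,2)] by metis
    then have "s \<noteq> 0" using Q(1) by auto
    then have "a k \<bullet> P = 0" using Q(3) s by simp
    then have "int m dvd j - k" using side_axes_meet P by metis
    then show False using I_eq jk by auto
  qed
  define T where "T = {j \<in> ?J. card (F j) = 1}"
  have TJ: "T \<subseteq> ?J" unfolding T_def by (rule Collect_restrict)
  \<comment> \<open>A single side is its own mirror image, so \<open>j\<close> is
    \<open>2 * i + 1\<close> modulo \<open>m\<close> and the point is \<open>M i\<close>.\<close>
  have mid: "i \<in> {i \<in> I. l \<bullet> M i = 0}" if ij: "j \<in> T" "i \<in> F j" for i j
  proof -
    have Fj: "F j = {i}" using ij by (auto simp: T_def card_1_singleton_iff)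
    obtain P where P: "P \<noteq> 0" "l \<bullet> P = 0" "a j \<bullet> P = 0" "S i \<bullet> P = 0" using ij by (auto simp: F_def)
    have "S (j - i - 1) \<bullet> P = 0" using mirror_side_through P by blast
    then obtain i' where i': "i' \<in> I" "int m dvd (j - i - 1) - i'" "S i' \<bullet> P = 0" using transfer P by metis
    then have "i' \<in> F j" using P unfolding F_def by blast
    then have "int m dvd j - (2 * i + 1)" using i' Fj by (simp add: algebra_simps)
    then have "pline (a j) = pline (a (2 * i + 1))" using a_eq_iff by blast
    then have "a (2 * i + 1) \<bullet> P = 0" using P proj_in_pline by metis
    then obtain s where s: "M i = s *\<^sub>R P"
      using meet_unique[OF S_nz a_nz Sa_neq P(1) P(4) _ SM aM] by metis
    then show ?thesis using P ij by (simp add: F_def)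
  qed
  have mid2: "card {i \<in> I. l \<bullet> M i = 0} \<le> 2"
  proof (rule card_le_2I, rule ccontr)
    fix x y z assume "x \<in> {i \<in> I. l \<bullet> M i = 0}" "y \<in> {i \<in> I. l \<bullet> M i = 0}" "z \<in> {i \<in> I. l \<bullet> M i = 0}"
      and ne: "\<not> (x = y \<or> y = z \<or> x = z)"
    then have I: "x \<in> I" "y \<in> I" "z \<in> I" and lM: "l \<bullet> M x = 0" "l \<bullet> M y = 0" "l \<bullet> M z = 0" by auto
    \<comment> \<open>The axis \<open>i + j + 1\<close> exchanges \<open>M i\<close> and
      \<open>M j\<close>, so they differ by a multiple of \<open>N (i + j + 1)\<close>. A third
      midpoint on \<open>l\<close> would yield a second such point at infinity.\<close>
    have N0: "l \<bullet> N (i + j + 1) = 0" if ij: "l \<bullet> M i = 0" "l \<bullet> M j = 0" "\<not> int m dvd i - j" for i j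
    proof -
      have eq: "M i - (2 * (a (i + j + 1) \<bullet> M i)) *\<^sub>R N (i + j + 1) = M j"
        using mirror_M[of i "i + j + 1"] by simp
      have "a (i + j + 1) \<bullet> M i \<noteq> 0"
      proof
        assume z: "a (i + j + 1) \<bullet> M i = 0"
        then have "int m dvd (i + j + 1) - (2 * i + 1)" using side_axes_meet[OF _ aM SM M_nz] by blast
        then have "int m dvd - (i - j)" by (simp add: algebra_simps)
        then show False using ij(3) by (simp only: dvd_minus_iff)
      qed
      moreover have "l \<bullet> M j = l \<bullet> M i - 2 * (a (i + j + 1) \<bullet> M i) * (l \<bullet> N (i + j + 1))"
        unfolding eq[symmetric] by (simp add: inner_diff_right)
      ultimately show ?thesis using ij by simp
    qed
    have nd: "\<not> int m dvd x - y" "\<not> int m dvd x - z" "\<not> int m dvd y - z" using I I_eq ne by blast+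
    then have "l \<bullet> N (x + y + 1) = 0" "l \<bullet> N (x + z + 1) = 0" using N0 lM by blast+
    moreover have "\<not> int m dvd (x + y + 1) - (x + z + 1)" using nd by simp
    ultimately show False using N_inf[OF l0] l(3) by blast
  qed
  have T_le: "card T \<le> 2"
  proof -
    have "card T = (\<Sum>j\<in>T. card (F j))" by (simp add: T_def)
    also have "\<dots> = card (\<Union>j\<in>T. F j)"
    proof (rule card_UN_disjoint[symmetric])
      show "finite T" by (rule finite_subset[OF TJ finJ])
      show "\<forall>j\<in>T. finite (F j)" using finF by simp
      show "\<forall>j\<in>T. \<forall>k\<in>T. j \<noteq> k \<longrightarrow> F j \<inter> F k = {}" by (intro ballI impI F_disj subsetD[OF TJ])
    qed
    also have "\<dots> \<le> card {i \<in> I. l \<bullet> M i = 0}"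
      by (rule card_mono) (use finite_I mid in auto)
    finally show ?thesis using mid2 by linarith
  qed
  have "2 * card ?J \<le> (\<Sum>j\<in>?J. card (F j) + (if j \<in> T then 1 else 0))"
  proof -
    have "2 \<le> card (F j) + (if j \<in> T then 1 else 0)" if j: "j \<in> ?J" for j
    proof -
      have "card (F j) \<noteq> 0" using F_ne[OF j] finF by simp
      then show ?thesis using j by (auto simp: T_def)
    qed
    then have "(\<Sum>j\<in>?J. 2) \<le> (\<Sum>j\<in>?J. card (F j) + (if j \<in> T then 1 else 0))" by (rule sum_mono)
    then show ?thesis by simp
  qed
  also have "\<dots> = (\<Sum>j\<in>?J. card (F j)) + (\<Sum>j\<in>?J. if j \<in> T then 1 else 0)" by (rule sum.distrib)
  also have "(\<Sum>j\<in>?J. if j \<in> T then 1 else 0) = card T"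
  proof -
    have "?J \<inter> T = T" using TJ by (rule Int_absorb1)
    then show ?thesis using sum.inter_restrict[OF finJ, of "\<lambda>_. 1::nat" T] by simp
  qed
  also have "(\<Sum>j\<in>?J. card (F j)) = card (\<Union>j\<in>?J. F j)"
  proof (rule card_UN_disjoint[symmetric])
    show "finite ?J" by (rule finJ)
    show "\<forall>j\<in>?J. finite (F j)" using finF by simp
    show "\<forall>j\<in>?J. \<forall>k\<in>?J. j \<noteq> k \<longrightarrow> F j \<inter> F k = {}" by (intro ballI impI F_disj)
  qed
  also have "\<dots> \<le> card I" by (rule card_mono) (use finite_I in \<open>auto simp: F_def\<close>)
  finally show ?thesis using T_le card_I by linarith
qed

text \<open>At least (m - 2) / 2 - 3 (|E| - 1) usable axes remain, which is at least 2 by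
  \<open>m_large\<close>. Two are required because a single point \<open>N j\<close> does not
  determine a line.\<close>

lemma extra_line_is_L_inf:
  assumes l: "l \<in> cov A" "pline l \<notin> R"
  shows "pline l = L_inf"
proof (rule ccontr)
  assume inf: "pline l \<noteq> L_inf"
  have l0: "l \<noteq> 0" using l by (simp add: cov_def)
  have lS: "pline (S i) \<noteq> pline l" and la: "pline (a i) \<noteq> pline l" for i using l S_in_R a_in_R by metis+
  have lO: "l \<bullet> O_pt \<noteq> 0" using extra_line_not_through_O l by blast
  have axes: "pline (a i) = pline (a j)" if ij: "l \<bullet> P = 0" "P \<noteq> 0" "a i \<bullet> P = 0" "a j \<bullet> P = 0" for P i j
  proof (rule ccontr)
    assume "pline (a i) \<noteq> pline (a j)"
    then obtain s where "P = s *\<^sub>R O_pt" using axes_meet_at_O ij a_eq_iff by metis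
    then show False using ij lO by auto
  qed
  let ?J = "{j \<in> I. \<exists>i P. P \<noteq> 0 \<and> l \<bullet> P = 0 \<and> a j \<bullet> P = 0 \<and> S i \<bullet> P = 0}"
  define K where "K = E - {pline l}"
  have lE: "pline l \<in> E" using l by (simp add: E_def cov_def)
  have finK: "finite K" using finite_E by (simp add: K_def)
  have cardK: "card K + 1 = card E" using card_Suc_Diff1[OF finite_E lE] by (simp add: K_def)
  define G where "G = {j \<in> I - ?J. \<forall>\<mu>\<in>cov A. pline \<mu> \<in> K \<longrightarrow> \<not> spoils A l \<mu> (a j)}"
  have "card (I - ?J) \<le> card G + 3 * card K"
    unfolding G_def
  proof (rule good_index[OF l(1) finK _ _ a_cov la])
    show "L \<in> A \<and> L \<noteq> pline l" if "L \<in> K" for L using that by (auto simp: K_def E_def)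
    show "I - ?J \<subseteq> I" by blast
    fix i j P assume "i \<in> I - ?J" "j \<in> I - ?J" "P \<noteq> 0" "l \<bullet> P = 0" "a i \<bullet> P = 0" "a j \<bullet> P = 0"
    then show "i = j" using axes[of P i j] I_eq a_eq_iff by blast
  qed
  moreover have "card (I - ?J) = m - card ?J"
    using card_Diff_subset[of ?J I] finite_I card_I by simp
  moreover have "2 * card ?J \<le> m + 2" by (rule card_axes_meeting_sides[OF l inf])
  ultimately have "2 \<le> card G" using cardK m_large by linarith
  then obtain G' where "G' \<subseteq> G" "card G' = 2" by (metis obtain_subset_with_card_n)
  then obtain j k where jk: "j \<in> G" "k \<in> G" "j \<noteq> k" by (auto simp: card_2_iff)
  have "l \<bullet> N j = 0" if j: "j \<in> G" for j
  proof -
    have good: "\<And>\<mu>. \<mu> \<in> cov A \<Longrightarrow> pline \<mu> \<in> K \<Longrightarrow> \<not> spoils A l \<mu> (a j)"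
      and noside: "\<And>i P. P \<noteq> 0 \<Longrightarrow> l \<bullet> P = 0 \<Longrightarrow> a j \<bullet> P = 0 \<Longrightarrow> S i \<bullet> P \<noteq> 0"
      using j unfolding G_def by auto
    obtain P where P: "P \<noteq> 0" "l \<bullet> P = 0" "a j \<bullet> P = 0" using meet_exists[OF l0 a_nz] la by metis
    have KE: "pline f \<in> K" if "f \<in> cov A" "pline f \<notin> R" "pline f \<noteq> pline l" for f
      using that by (auto simp: K_def E_def cov_def)
    interpret dp: double_point A l "a j" P
    proof
      fix f assume f: "f \<in> cov A" "f \<bullet> P = 0"
      then have f0: "f \<noteq> 0" by (simp add: cov_def)
      show "pline f = pline l \<or> pline f = pline (a j)"
      proof (cases "pline f \<in> R")
        case True
        then show ?thesis using f0
        proof (cases rule: R_cases)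
          case (1 k s)
          then have "S k \<bullet> P = 0" using f by simp
          then show ?thesis using noside P by metis
        next
          case (2 k s)
          then have "a k \<bullet> P = 0" using f by simp
          then show ?thesis using axes[OF P(2,1,3)] 2(3) by metis
        qed
      next
        case False
        then show ?thesis using KE f good spoils_incident P by metis
      qed
    qed (use arr smp l a_cov la[of j] P in simp_all)
    show ?thesis
    proof (rule dp.orthogonal_if_mirror[OF aN])
      fix Y assume Y: "a j \<bullet> Y = 0" "l \<bullet> Y = 1"
      have "\<not> int m dvd (j + 1) - j" using not_dvd_small by simp
      then have nj: "pline (a (j + 1)) \<noteq> pline (a j)" using a_eq_iff by blast
      \<comment> \<open>Either the next axis avoids \<open>Y\<close>, or \<open>Y\<close> is the
        centre and every side avoids it.\<close>
      show "\<exists>f\<in>cov A. pline f \<noteq> pline l \<and> pline f \<noteq> pline (a j) \<and> f \<bullet> Y \<noteq> 0"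
      proof (cases "a (j + 1) \<bullet> Y = 0")
        case True
        then obtain s where s: "Y = s *\<^sub>R O_pt" using axes_meet_at_O[OF True Y(1)] nj a_eq_iff by metis
        then have "s \<noteq> 0" using Y(2) by auto
        then have "S 0 \<bullet> Y \<noteq> 0" using s SO by simp
        then show ?thesis using S_cov lS Sa_neq by metis
      next
        case False
        then show ?thesis using a_cov la nj by metis
      qed
    next
      fix \<mu> U assume \<mu>: "\<mu> \<in> cov A" "\<mu> \<bullet> U = 0" "\<mu> \<bullet> P \<noteq> 0" and U: "U \<noteq> 0" "l \<bullet> U = 0"
        "\<forall>f\<in>cov A. (f \<bullet> P) * (f \<bullet> U) \<ge> 0"
      have \<mu>0: "\<mu> \<noteq> 0" using \<mu> by (simp add: cov_def)
      have "pline \<mu> \<noteq> pline l"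
      proof
        assume "pline \<mu> = pline l"
        then show False using proj_in_pline[OF P(1)] P(2) \<mu>(3) by metis
      qed
      \<comment> \<open>An additional \<open>\<mu>\<close> would spoil the axis \<open>j\<close>. As
        a line of the system, \<open>\<mu>\<close> has its mirror image in \<open>R\<close> and
        hence in \<open>A\<close>.\<close>
      then have "pline \<mu> \<in> R"
        using KE[OF \<mu>(1)] good[OF \<mu>(1)] spoils_adjacent[OF P U(1,2) \<mu>(2) U(3)] by blast
      then show "\<mu> - (2 * (\<mu> \<bullet> N j)) *\<^sub>R a j \<in> cov A" using \<mu>0
      proof (cases rule: R_cases)
        case (1 i s)
        have "\<mu> - (2 * (\<mu> \<bullet> N j)) *\<^sub>R a j = s *\<^sub>R (S i - (2 * (S i \<bullet> N j)) *\<^sub>R a j)"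
          by (simp add: 1(2) algebra_simps)
        then show ?thesis unfolding mirror_S using cov_scale[OF S_cov] 1(1) by simp
      next
        case (2 i s)
        have "\<mu> - (2 * (\<mu> \<bullet> N j)) *\<^sub>R a j = s *\<^sub>R (a i - (2 * (a i \<bullet> N j)) *\<^sub>R a j)"
          by (simp add: 2(2) algebra_simps)
        also have "\<dots> = (- s) *\<^sub>R a (2 * j - i)" unfolding mirror_a by simp
        finally show ?thesis using cov_scale[OF a_cov, of "- s"] 2(1) by simp
      qed
    qed
  qed
  then have "l \<bullet> N j = 0" "l \<bullet> N k = 0" using jk by blast+
  moreover have "\<not> int m dvd j - k" using jk I_eq unfolding G_def by blast
  ultimately show False using N_inf[OF l0] inf by blast
qed

theorem A_eq: "A = R \<or> A = R \<union> {L_inf}"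
proof -
  have "A \<subseteq> R \<union> {L_inf}" using A_line extra_line_is_L_inf by blast
  then show ?thesis using R_subset by blast
qed

end

section \<open>The regular polygon\<close>

lemma inner_vector2: "vector [a, b] \<bullet> x = a * x $ 1 + b * x $ (2::2)" for x :: "real^2"
  by (simp add: inner_vec_def sum_2 vector_2)

lemma inner_vector3: "vector [a, b, c] \<bullet> x = a * x $ 1 + b * x $ 2 + c * x $ (3::3)" for x :: "real^3"
  by (simp add: inner_vec_def sum_3 vector_3)

lemma vector3_arith:
  "vector [a, b, c] - vector [a', b', c'] = (vector [a - a', b - b', c - c'] :: real^3)"
  "- vector [a, b, c] = (vector [- a, - b, - c] :: real^3)"
  "k *\<^sub>R vector [a, b, c] = (vector [k * a, k * b, k * c] :: real^3)"
  by (simp_all add: vec_eq_iff forall_3 vector_3)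

lemma vector3_eq_iff: "vector [a, b, c] = (vector [a', b', c'] :: real^3) \<longleftrightarrow> a = a' \<and> b = b' \<and> c = c'"
  by (simp add: vec_eq_iff forall_3 vector_3)

section \<open>Homogeneous coordinates of the polygon and the mirror relations\<close>

locale regular_ngon =
  fixes m :: nat and c :: "real^2" and r t :: real
  assumes m: "m \<ge> 3" and r: "r > 0"
begin

text \<open>The apothem, that is, the distance from the centre to the sides.\<close>

definition "\<rho> = r * cos (pi / real m)"
definition "\<theta> i = t + pi * (2 * real_of_int i + 1) / real m"
definition "\<beta> j = t + pi * real_of_int j / real m"

definition side_covector :: "int \<Rightarrow> real^3" where
  "side_covector i = vector [cos (\<theta> i), sin (\<theta> i), - (c $ 1 * cos (\<theta> i) + c $ 2 * sin (\<theta> i)) - \<rho>]"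
definition axis_covector :: "int \<Rightarrow> real^3" where
  "axis_covector j = vector [- sin (\<beta> j), cos (\<beta> j), c $ 1 * sin (\<beta> j) - c $ 2 * cos (\<beta> j)]"
definition axis_normal :: "int \<Rightarrow> real^3" where
  "axis_normal j = vector [- sin (\<beta> j), cos (\<beta> j), 0]"
definition side_midpoint :: "int \<Rightarrow> real^3" where
  "side_midpoint i = vector [c $ 1 + \<rho> * cos (\<theta> i), c $ 2 + \<rho> * sin (\<theta> i), 1]"
definition centre :: "real^3" where
  "centre = vector [c $ 1, c $ 2, 1]"

lemma m_pos: "real m > 0" using m by simp

lemma rho_pos: "\<rho> > 0"
proof -
  have "pi / real m < pi / 2" using m by (intro divide_strict_left_mono) auto
  then have "cos (pi / real m) > 0" using m_pos by (intro cos_gt_zero) simp_all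
  then show ?thesis using r by (simp add: \<rho>_def)
qed

lemma theta_mirror: "\<theta> (j - i - 1) = 2 * \<beta> j - \<theta> i"
  using m_pos by (simp add: \<theta>_def \<beta>_def field_simps)

lemma beta_mirror: "\<beta> (2 * j - i) = 2 * \<beta> j - \<beta> i"
  using m_pos by (simp add: \<beta>_def field_simps)

lemma beta_theta: "\<beta> (2 * i + 1) = \<theta> i"
  by (simp add: \<theta>_def \<beta>_def)

text \<open>The first two equations reflect the unit vector at angle \<open>x\<close> in the
  direction \<open>b\<close>; the last two reflect the normal of an axis at angle \<open>x\<close>,
  which comes back reversed.\<close>

lemma trig_mirror:
  "cos x + 2 * sin (x - b) * sin b = cos (2 * b - x)"
  "sin x - 2 * sin (x - b) * cos b = sin (2 * b - x)"
  "- sin x + 2 * cos (x - b) * sin b = sin (2 * b - x)"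
  "cos x - 2 * cos (x - b) * cos b = - cos (2 * b - x)"
  for x b :: real
proof -
  have *: "cos x = cos ((x - b) + b)" "sin x = sin ((x - b) + b)"
    "cos (2 * b - x) = cos (b - (x - b))" "sin (2 * b - x) = sin (b - (x - b))" by simp_all
  show "cos x + 2 * sin (x - b) * sin b = cos (2 * b - x)" "sin x - 2 * sin (x - b) * cos b = sin (2 * b - x)"
    "- sin x + 2 * cos (x - b) * sin b = sin (2 * b - x)"
    "cos x - 2 * cos (x - b) * cos b = - cos (2 * b - x)"
    unfolding *(1-4) cos_add sin_add cos_diff[of b] sin_diff[of b] by (simp_all add: algebra_simps)
qed

lemma side_covector_axis_normal: "side_covector i \<bullet> axis_normal j = sin (\<theta> i - \<beta> j)"
  by (simp add: side_covector_def axis_normal_def inner_vector3 vector_3 sin_diff)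

lemma axis_covector_axis_normal: "axis_covector i \<bullet> axis_normal j = cos (\<beta> i - \<beta> j)"
  by (simp add: axis_covector_def axis_normal_def inner_vector3 vector_3 cos_diff)

lemma axis_covector_side_midpoint: "axis_covector j \<bullet> side_midpoint i = \<rho> * sin (\<theta> i - \<beta> j)"
  by (simp add: axis_covector_def side_midpoint_def inner_vector3 vector_3 sin_diff algebra_simps)

lemma mirror_side_covector: "side_covector i - (2 * (side_covector i \<bullet> axis_normal j)) *\<^sub>R axis_covector j = side_covector (j - i - 1)"
proof -
  let ?s = "2 * sin (\<theta> i - \<beta> j)"
  \<comment> \<open>The third coordinate is kept as an expression in the first two, so that
    \<open>trig_mirror\<close> rewrites all three.\<close>
  have "side_covector i - ?s *\<^sub>R axis_covector j = vector [cos (\<theta> i) + ?s * sin (\<beta> j), sin (\<theta> i) - ?s * cos (\<beta> j),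
      - (c $ 1 * (cos (\<theta> i) + ?s * sin (\<beta> j)) + c $ 2 * (sin (\<theta> i) - ?s * cos (\<beta> j))) - \<rho>]"
    unfolding side_covector_def axis_covector_def vector3_arith vector3_eq_iff by (simp add: algebra_simps)
  then show ?thesis unfolding side_covector_axis_normal trig_mirror theta_mirror[symmetric] by (simp add: side_covector_def)
qed

lemma mirror_axis_covector: "axis_covector i - (2 * (axis_covector i \<bullet> axis_normal j)) *\<^sub>R axis_covector j = - axis_covector (2 * j - i)"
proof -
  let ?s = "2 * cos (\<beta> i - \<beta> j)"
  have "axis_covector i - ?s *\<^sub>R axis_covector j = vector [- sin (\<beta> i) + ?s * sin (\<beta> j), cos (\<beta> i) - ?s * cos (\<beta> j),
      - (c $ 1 * (- sin (\<beta> i) + ?s * sin (\<beta> j)) + c $ 2 * (cos (\<beta> i) - ?s * cos (\<beta> j)))]"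
    unfolding axis_covector_def vector3_arith vector3_eq_iff by (simp add: algebra_simps)
  then show ?thesis unfolding axis_covector_axis_normal trig_mirror beta_mirror[symmetric] by (simp add: axis_covector_def vector3_arith vector3_eq_iff)
qed

lemma mirror_side_midpoint: "side_midpoint i - (2 * (axis_covector j \<bullet> side_midpoint i)) *\<^sub>R axis_normal j = side_midpoint (j - i - 1)"
proof -
  let ?s = "2 * sin (\<theta> i - \<beta> j)"
  have "side_midpoint i - (2 * (\<rho> * sin (\<theta> i - \<beta> j))) *\<^sub>R axis_normal j =
      vector [c $ 1 + \<rho> * (cos (\<theta> i) + ?s * sin (\<beta> j)), c $ 2 + \<rho> * (sin (\<theta> i) - ?s * cos (\<beta> j)), 1]"
    unfolding side_midpoint_def axis_normal_def vector3_arith vector3_eq_iff by (simp add: algebra_simps)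
  then show ?thesis unfolding axis_covector_side_midpoint trig_mirror theta_mirror[symmetric] by (simp add: side_midpoint_def)
qed

lemma side_covector_nz: "side_covector i \<noteq> 0"
proof
  assume "side_covector i = 0"
  then have "cos (\<theta> i) = 0" "sin (\<theta> i) = 0" by (simp_all add: side_covector_def vec_eq_iff forall_3 vector_3)
  then show False using sin_cos_squared_add[of "\<theta> i"] by simp
qed

lemma axis_covector_nz: "axis_covector i \<noteq> 0"
proof
  assume "axis_covector i = 0"
  then have "cos (\<beta> i) = 0" "sin (\<beta> i) = 0" by (simp_all add: axis_covector_def vec_eq_iff forall_3 vector_3)
  then show False using sin_cos_squared_add[of "\<beta> i"] by simp
qed

lemma multiple_iff: "(\<exists>n::int. pi * of_int (i - j) / real m = pi * of_int n) \<longleftrightarrow> int m dvd i - j"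
proof -
  have "pi * of_int (i - j) / real m = pi * of_int n \<longleftrightarrow> i - j = int m * n" for n
  proof -
    have "pi * of_int (i - j) / real m = pi * of_int n \<longleftrightarrow> of_int (i - j) / real m = of_int n"
      unfolding times_divide_eq_right[symmetric] mult_cancel_left using pi_neq_zero by simp
    also have "\<dots> \<longleftrightarrow> of_int (i - j) = real m * of_int n"
      using m_pos by (simp add: divide_eq_eq mult.commute)
    also have "\<dots> \<longleftrightarrow> (of_int (i - j) :: real) = of_int (int m * n)" by simp
    also have "\<dots> \<longleftrightarrow> i - j = int m * n" by (rule of_int_eq_iff)
    finally show ?thesis .
  qed
  then show ?thesis by (simp add: dvd_def)
qed

lemma theta_eq_iff: "cos (\<theta> i) = cos (\<theta> j) \<and> sin (\<theta> i) = sin (\<theta> j) \<longleftrightarrow> int m dvd i - j"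
proof -
  have "cos (\<theta> i) = cos (\<theta> j) \<and> sin (\<theta> i) = sin (\<theta> j) \<longleftrightarrow> (\<exists>n::int. \<theta> i = \<theta> j + 2 * pi * of_int n)"
    using sin_cos_eq_iff[of "\<theta> i" "\<theta> j"] by blast
  also have "\<dots> \<longleftrightarrow> (\<exists>n::int. pi * of_int (i - j) / real m = pi * of_int n)"
  proof (rule ex_cong1)
    fix n :: int
    have "\<theta> i = \<theta> j + 2 * (pi * of_int (i - j) / real m)"
      using m_pos by (simp add: \<theta>_def field_simps)
    then show "\<theta> i = \<theta> j + 2 * pi * of_int n \<longleftrightarrow> pi * of_int (i - j) / real m = pi * of_int n"
      by (intro iffI; linarith)
  qed
  also have "\<dots> \<longleftrightarrow> int m dvd i - j" by (rule multiple_iff)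
  finally show ?thesis .
qed

lemma sin_beta_zero_iff: "sin (\<beta> i - \<beta> j) = 0 \<longleftrightarrow> int m dvd i - j"
proof -
  have "\<beta> i - \<beta> j = pi * of_int (i - j) / real m" by (simp add: \<beta>_def field_simps diff_divide_distrib)
  then show ?thesis using multiple_iff[of i j] by (simp add: sin_zero_iff_int2 mult.commute)
qed

lemma side_covector_eq_iff: "pline (side_covector i) = pline (side_covector j) \<longleftrightarrow> int m dvd i - j"
proof
  assume "pline (side_covector i) = pline (side_covector j)"
  then obtain s where s: "side_covector j = s *\<^sub>R side_covector i" using pline_eq_iff[OF side_covector_nz side_covector_nz] by metis
  then have eq: "cos (\<theta> j) = s * cos (\<theta> i)" "sin (\<theta> j) = s * sin (\<theta> i)"
    "- (c $ 1 * cos (\<theta> j) + c $ 2 * sin (\<theta> j)) - \<rho> = s * (- (c $ 1 * cos (\<theta> i) + c $ 2 * sin (\<theta> i)) - \<rho>)"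
    unfolding side_covector_def vector3_arith vector3_eq_iff by blast+
  \<comment> \<open>All side covectors take the value \<open>- \<rho>\<close> at the centre. This
    excludes the factor -1, which the normals of opposite sides would allow.\<close>
  have "\<rho> = s * \<rho>" using eq(3) unfolding eq(1,2) by (simp add: algebra_simps)
  then have "s = 1" using rho_pos by simp
  then show "int m dvd i - j" using eq theta_eq_iff[of i j] by simp
next
  assume "int m dvd i - j"
  then have "cos (\<theta> i) = cos (\<theta> j)" "sin (\<theta> i) = sin (\<theta> j)" using theta_eq_iff by blast+
  then have "side_covector i = side_covector j" by (simp add: side_covector_def)
  then show "pline (side_covector i) = pline (side_covector j)" by simp
qed

lemma axis_covector_eq_iff: "pline (axis_covector i) = pline (axis_covector j) \<longleftrightarrow> int m dvd i - j"
proof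
  assume "pline (axis_covector i) = pline (axis_covector j)"
  then obtain s where s: "axis_covector j = s *\<^sub>R axis_covector i" using pline_eq_iff[OF axis_covector_nz axis_covector_nz] by metis
  then have "sin (\<beta> j) = s * sin (\<beta> i)" "cos (\<beta> j) = s * cos (\<beta> i)"
    by (simp_all add: axis_covector_def vector3_arith vector3_eq_iff)
  then have "sin (\<beta> i - \<beta> j) = 0" by (simp add: sin_diff)
  then show "int m dvd i - j" using sin_beta_zero_iff by blast
next
  assume "int m dvd i - j"
  then have d: "sin (\<beta> i - \<beta> j) = 0" using sin_beta_zero_iff by blast
  \<comment> \<open>\<open>s\<close> is 1 or -1: turning an axis by a multiple of \<pi> may reverse
    its normal.\<close>
  define s where "s = cos (\<beta> i - \<beta> j)"
  have "s\<^sup>2 = 1" using d sin_cos_squared_add[of "\<beta> i - \<beta> j"] by (simp add: s_def)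
  then have "s \<noteq> 0" by auto
  have "sin (\<beta> i) = sin (\<beta> j + (\<beta> i - \<beta> j))" "cos (\<beta> i) = cos (\<beta> j + (\<beta> i - \<beta> j))" by simp_all
  then have "sin (\<beta> i) = s * sin (\<beta> j)" "cos (\<beta> i) = s * cos (\<beta> j)"
    unfolding sin_add cos_add d s_def by simp_all
  then have "axis_covector i = s *\<^sub>R axis_covector j" by (simp add: axis_covector_def vector3_arith vector3_eq_iff algebra_simps)
  then show "pline (axis_covector i) = pline (axis_covector j)" using \<open>s \<noteq> 0\<close> by (simp add: pline_scale)
qed

sublocale mirror_system m side_covector axis_covector axis_normal side_midpoint centre
proof
  show "axis_covector j \<bullet> axis_normal j = 1" for j by (simp add: axis_covector_axis_normal)
  show "pline (side_covector i) = pline (side_covector j) \<longleftrightarrow> int m dvd i - j" for i j by (rule side_covector_eq_iff)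
  show "pline (axis_covector i) = pline (axis_covector j) \<longleftrightarrow> int m dvd i - j" for i j by (rule axis_covector_eq_iff)
  show "side_covector i - (2 * (side_covector i \<bullet> axis_normal j)) *\<^sub>R axis_covector j = side_covector (j - i - 1)" for i j by (rule mirror_side_covector)
  show "axis_covector i - (2 * (axis_covector i \<bullet> axis_normal j)) *\<^sub>R axis_covector j = - axis_covector (2 * j - i)" for i j by (rule mirror_axis_covector)
  show "side_midpoint i - (2 * (axis_covector j \<bullet> side_midpoint i)) *\<^sub>R axis_normal j = side_midpoint (j - i - 1)" for i j by (rule mirror_side_midpoint)
  show "centre \<noteq> 0" by (simp add: centre_def vec_eq_iff forall_3 vector_3)
  show "axis_covector j \<bullet> centre = 0" for j by (simp add: axis_covector_def centre_def inner_vector3 vector_3)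
  show "side_covector i \<bullet> centre \<noteq> 0" for i using rho_pos by (simp add: side_covector_def centre_def inner_vector3 vector_3)
  show "side_covector i \<bullet> side_midpoint i = 0" for i
  proof -
    have "side_covector i \<bullet> side_midpoint i = \<rho> * (cos (\<theta> i) * cos (\<theta> i) + sin (\<theta> i) * sin (\<theta> i)) - \<rho>"
    proof -
      have "A * (c $ 1 + \<rho> * A) + B * (c $ 2 + \<rho> * B) + (- (c $ 1 * A + c $ 2 * B) - \<rho>) * 1 = \<rho> * (A * A + B * B) - \<rho>"
        for A B by (simp add: algebra_simps)
      then show ?thesis unfolding side_covector_def side_midpoint_def inner_vector3 vector_3 .
    qed
    then show ?thesis by (simp only: sin_cos_squared_add3 mult_1_right diff_self)
  qed
  show "axis_covector (2 * i + 1) \<bullet> side_midpoint i = 0" for i by (simp add: axis_covector_side_midpoint beta_theta)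
  show "side_midpoint i \<noteq> 0" for i by (simp add: side_midpoint_def vec_eq_iff forall_3 vector_3)
qed (rule m)

end

lemma line_at_infinity_eq: "line_at_infinity = pline (vector [0, 0, 1])"
proof (rule set_eqI)
  fix p
  obtain x where x: "x \<noteq> 0" "p = proj x" using proj_surj by metis
  have "p \<in> range embed \<longleftrightarrow> x $ 3 \<noteq> 0"
  proof
    assume "p \<in> range embed"
    then obtain y :: "real^2" where "p = proj (vector [y $ 1, y $ 2, 1])" by (auto simp: embed_def)
    moreover have "(vector [y $ 1, y $ 2, 1] :: real^3) \<noteq> 0" by (simp add: vec_eq_iff forall_3 vector_3)
    ultimately obtain s where "s \<noteq> 0" "x = s *\<^sub>R vector [y $ 1, y $ 2, 1]" using x proj_eq_iff by metis
    then show "x $ 3 \<noteq> 0" by (simp add: vector_3)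
  next
    assume x3: "x $ 3 \<noteq> 0"
    define y :: "real^2" where "y = vector [x $ 1 / x $ 3, x $ 2 / x $ 3]"
    have eq: "x = x $ 3 *\<^sub>R vector [y $ 1, y $ 2, 1]"
      using x3 by (simp add: y_def vec_eq_iff forall_3 vector_3 vector_2)
    have "(vector [y $ 1, y $ 2, 1] :: real^3) \<noteq> 0" by (simp add: vec_eq_iff forall_3 vector_3)
    then have "proj (vector [y $ 1, y $ 2, 1]) = proj x" using proj_eq_iff x(1) x3 eq by metis
    then have "p = embed y" using x by (simp add: embed_def)
    then show "p \<in> range embed" by blast
  qed
  moreover have "p \<in> pline (vector [0, 0, 1]) \<longleftrightarrow> x $ 3 = 0"
    unfolding x(2) proj_in_pline[OF x(1)] by (simp add: inner_vector3)
  ultimately show "p \<in> line_at_infinity \<longleftrightarrow> p \<in> pline (vector [0, 0, 1])"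
    by (simp add: line_at_infinity_def)
qed

context regular_ngon
begin

text \<open>Discharges \<open>N_inf\<close>. The first two coordinates of \<open>l\<close> solve a
  homogeneous linear system whose determinant is, up to sign,
  \<open>sin (\<beta> i - \<beta> j)\<close>.\<close>

lemma orthogonal_two_normals:
  assumes "l \<noteq> 0" "l \<bullet> axis_normal i = 0" "l \<bullet> axis_normal j = 0" "\<not> int m dvd i - j"
  shows "pline l = line_at_infinity"
proof -
  have s: "sin (\<beta> i - \<beta> j) \<noteq> 0" using sin_beta_zero_iff assms(4) by blast
  have e: "l $ 2 * cos (\<beta> i) = l $ 1 * sin (\<beta> i)" "l $ 2 * cos (\<beta> j) = l $ 1 * sin (\<beta> j)"
    using assms(2,3) by (simp_all add: axis_normal_def inner_commute[of l] inner_vector3 algebra_simps)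
  have "l $ 1 * sin (\<beta> i - \<beta> j) = (l $ 1 * sin (\<beta> i)) * cos (\<beta> j) - (l $ 1 * sin (\<beta> j)) * cos (\<beta> i)"
    by (simp add: sin_diff algebra_simps)
  also have "\<dots> = 0" unfolding e[symmetric] by simp
  finally have l1: "l $ 1 = 0" using s by simp
  have "l $ 2 * sin (\<beta> i - \<beta> j) = (l $ 2 * cos (\<beta> j)) * sin (\<beta> i) - (l $ 2 * cos (\<beta> i)) * sin (\<beta> j)"
    by (simp add: sin_diff algebra_simps)
  also have "\<dots> = 0" unfolding e by simp
  finally have l2: "l $ 2 = 0" using s by simp
  have "l = l $ 3 *\<^sub>R vector [0, 0, 1]" using l1 l2 by (simp add: vec_eq_iff forall_3 vector_3)
  moreover from this have "l $ 3 \<noteq> 0" using assms(1) by auto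
  ultimately show ?thesis unfolding line_at_infinity_eq using pline_scale by metis
qed

end

section \<open>Euclidean lines and reflections in the affine chart\<close>

definition lift :: "real^2 \<Rightarrow> real^3" where
  "lift x = vector [x $ 1, x $ 2, 1]"

lemma lift_nz: "lift x \<noteq> 0"
  by (simp add: lift_def vec_eq_iff forall_3 vector_3)

lemma embed_in_pline: "embed x \<in> pline f \<longleftrightarrow> f \<bullet> lift x = 0"
  unfolding embed_def lift_def[symmetric] by (rule proj_in_pline[OF lift_nz])

lemma lift_proportional: "lift y = s *\<^sub>R lift x \<Longrightarrow> y = x"
  by (simp add: lift_def vec_eq_iff forall_3 forall_2 vector_3)

text \<open>\<open>meet_unique\<close> read dually: the two points serve as covectors and the two
  lines as their common zeros.\<close>

lemma line_through_two_points:
  assumes "x \<noteq> y" "f \<noteq> 0" "g \<noteq> 0" "f \<bullet> lift x = 0" "f \<bullet> lift y = 0" "g \<bullet> lift x = 0" "g \<bullet> lift y = 0"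
  shows "pline f = pline g"
proof -
  have "pline (lift x) \<noteq> pline (lift y)"
  proof
    assume "pline (lift x) = pline (lift y)"
    then obtain s where "lift y = s *\<^sub>R lift x" using pline_eq_iff[OF lift_nz lift_nz] by metis
    then show False using lift_proportional assms(1) by metis
  qed
  then obtain s where s: "g = s *\<^sub>R f"
    using meet_unique[OF lift_nz lift_nz _ assms(2)] assms by (metis inner_commute)
  then have "s \<noteq> 0" using assms(3) by auto
  then show ?thesis using s pline_scale by metis
qed

lemma closest_point_hyperplane:
  fixes \<nu> x :: "'a::euclidean_space"
  assumes "norm \<nu> = 1"
  shows "closest_point {y. \<nu> \<bullet> y = d} x = x - (\<nu> \<bullet> x - d) *\<^sub>R \<nu>"
proof (rule closest_point_unique[symmetric])
  have \<nu>\<nu>: "\<nu> \<bullet> \<nu> = 1" using assms by (simp add: norm_eq_1)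
  show "convex {y. \<nu> \<bullet> y = d}" by (rule convex_hyperplane)
  show "closed {y. \<nu> \<bullet> y = d}" by (rule closed_hyperplane)
  show "x - (\<nu> \<bullet> x - d) *\<^sub>R \<nu> \<in> {y. \<nu> \<bullet> y = d}" using \<nu>\<nu> by (simp add: inner_diff_right)
  show "\<forall>z\<in>{y. \<nu> \<bullet> y = d}. dist x (x - (\<nu> \<bullet> x - d) *\<^sub>R \<nu>) \<le> dist x z"
  proof
    fix z assume "z \<in> {y. \<nu> \<bullet> y = d}"
    then have "\<nu> \<bullet> x - d = \<nu> \<bullet> (x - z)" by (simp add: inner_diff_right)
    then have "\<bar>\<nu> \<bullet> x - d\<bar> \<le> norm (x - z)" using Cauchy_Schwarz_ineq2[of \<nu> "x - z"] assms by simp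
    then show "dist x (x - (\<nu> \<bullet> x - d) *\<^sub>R \<nu>) \<le> dist x z" using assms by (simp add: dist_norm)
  qed
qed

lemma reflection_hyperplane:
  assumes "norm \<nu> = 1"
  shows "reflection {y. \<nu> \<bullet> y = d} x = x - (2 * (\<nu> \<bullet> x - d)) *\<^sub>R \<nu>"
  unfolding reflection_def closest_point_hyperplane[OF assms] scaleR_diff_right scaleR_scaleR
  by (simp add: scaleR_2)

lemma affine_line_iff_hyperplane:
  fixes l :: "(real^2) set"
  shows "affine l \<and> aff_dim l = 1 \<longleftrightarrow> (\<exists>\<nu> d. norm \<nu> = 1 \<and> l = {y. \<nu> \<bullet> y = d})"
proof
  assume l: "affine l \<and> aff_dim l = 1"
  then have "\<exists>a b. a \<noteq> 0 \<and> affine hull l = {x. a \<bullet> x = b}"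
    using aff_dim_eq_hyperplane[of l] by simp
  then obtain a b where ab: "a \<noteq> 0" "affine hull l = {x. a \<bullet> x = b}" by (elim exE conjE)
  have "l = affine hull l" using l by (simp add: hull_same)
  then have "l = {x. a \<bullet> x = b}" by (rule trans[OF _ ab(2)])
  also have "\<dots> = {y. ((1 / norm a) *\<^sub>R a) \<bullet> y = b / norm a}" using ab(1) by (simp add: field_simps)
  finally show "\<exists>\<nu> d. norm \<nu> = 1 \<and> l = {y. \<nu> \<bullet> y = d}"
    using ab(1) by (intro exI[of _ "(1 / norm a) *\<^sub>R a"] exI[of _ "b / norm a"]) simp
next
  assume "\<exists>\<nu> d. norm \<nu> = 1 \<and> l = {y. \<nu> \<bullet> y = d}"
  then obtain \<nu> d where \<nu>: "norm \<nu> = 1" "l = {y. \<nu> \<bullet> y = d}" by metis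
  then have "\<nu> \<noteq> 0" by auto
  then show "affine l \<and> aff_dim l = 1" unfolding \<nu>(2) using affine_hyperplane by simp
qed

definition mirror_map :: "real^2 \<Rightarrow> real \<Rightarrow> real^2 \<Rightarrow> real^2" where
  "mirror_map \<nu> d x = x - (2 * (\<nu> \<bullet> x - d)) *\<^sub>R \<nu>"

text \<open>Splits the reflection into a linear map and a translation, for which images of convex
  sets and hulls are known.\<close>

lemma mirror_map_affine: "mirror_map \<nu> d x = (2 * d) *\<^sub>R \<nu> + mirror_map \<nu> 0 x"
  by (simp add: mirror_map_def algebra_simps)

lemma linear_mirror_map: "linear (mirror_map \<nu> 0)"
  by (rule linearI) (simp_all add: mirror_map_def inner_add_right algebra_simps)

lemma mirror_map_image: "mirror_map \<nu> d ` S = (\<lambda>x. (2 * d) *\<^sub>R \<nu> + x) ` (mirror_map \<nu> 0 ` S)"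
  unfolding image_image using mirror_map_affine[of \<nu> d] by simp

lemma mirror_map_convex_hull: "mirror_map \<nu> d ` (convex hull S) = convex hull (mirror_map \<nu> d ` S)"
proof -
  have "mirror_map \<nu> d ` (convex hull S) = (\<lambda>x. (2 * d) *\<^sub>R \<nu> + x) ` (convex hull (mirror_map \<nu> 0 ` S))"
    unfolding mirror_map_image[of \<nu> d "convex hull S"] convex_hull_linear_image[OF linear_mirror_map] ..
  also have "\<dots> = convex hull ((\<lambda>x. (2 * d) *\<^sub>R \<nu> + x) ` (mirror_map \<nu> 0 ` S))"
    by (rule convex_hull_translation[symmetric])
  finally show ?thesis unfolding mirror_map_image[of \<nu> d S] .
qed

lemma mirror_map_mirror_map: "norm \<nu> = 1 \<Longrightarrow> mirror_map \<nu> d (mirror_map \<nu> d x) = x"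
  by (simp add: mirror_map_def norm_eq_1 inner_diff_right algebra_simps)

text \<open>Extreme points are those whose removal leaves a convex set, and the reflection, an
  affine bijection of \<open>P\<close>, is compatible with removing a point.\<close>

lemma mirror_map_extreme_point:
  assumes "norm \<nu> = 1" "convex P" "mirror_map \<nu> d ` P = P" "x extreme_point_of P"
  shows "mirror_map \<nu> d x extreme_point_of P"
proof -
  have inj: "inj (mirror_map \<nu> d)" using mirror_map_mirror_map[OF assms(1)] by (metis injI)
  have "convex (P - {x})" "x \<in> P" using assms by (simp_all add: extreme_point_of_stillconvex)
  then have "convex (mirror_map \<nu> d ` (P - {x}))"
    unfolding mirror_map_image[of \<nu> d "P - {x}"] by (intro convex_translation convex_linear_image linear_mirror_map)
  moreover have "mirror_map \<nu> d ` (P - {x}) = P - {mirror_map \<nu> d x}"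
    using assms(3) image_set_diff[OF inj, of P "{x}"] by simp
  moreover have "mirror_map \<nu> d x \<in> P" using assms(3) \<open>x \<in> P\<close> by blast
  ultimately show ?thesis using assms(2) by (simp add: extreme_point_of_stillconvex)
qed

section \<open>Sides and symmetry axes of the polygon\<close>

context regular_ngon
begin

text \<open>Integer indices let a reflection act by sending \<open>i\<close> to
  \<open>j - i\<close>; the values repeat with period \<open>m\<close>.\<close>

definition vertex :: "int \<Rightarrow> real^2" where
  "vertex j = c + r *\<^sub>R vector [cos (t + 2 * pi * real_of_int j / real m), sin (t + 2 * pi * real_of_int j / real m)]"

lemma vertex_angle: "t + 2 * pi * real_of_int j / real m = \<beta> (2 * j)"
  by (simp add: \<beta>_def)

lemma vertex_eq: "vertex j = c + r *\<^sub>R vector [cos (\<beta> (2 * j)), sin (\<beta> (2 * j))]"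
  unfolding vertex_def vertex_angle ..

lemma ngon_vertex_eq: "ngon_vertex m c r t j = vertex (int j)"
  by (simp add: ngon_vertex_def vertex_def)

lemma vertex_periodic: "int m dvd i - j \<Longrightarrow> vertex i = vertex j"
proof -
  assume "int m dvd i - j"
  then obtain k where k: "i = j + int m * k" by (metis dvdE add.commute diff_add_cancel)
  have "\<beta> (2 * i) = \<beta> (2 * j) + 2 * pi * real_of_int k"
    using m_pos by (simp add: \<beta>_def k field_simps)
  then have "cos (\<beta> (2 * i)) = cos (\<beta> (2 * j))" "sin (\<beta> (2 * i)) = sin (\<beta> (2 * j))"
    using sin_cos_eq_iff[of "\<beta> (2 * i)" "\<beta> (2 * j)"] by blast+
  then show "vertex i = vertex j" by (simp add: vertex_eq)
qed

lemma vertices: "ngon_vertex m c r t ` {..<m} = range vertex"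
proof
  show "ngon_vertex m c r t ` {..<m} \<subseteq> range vertex" by (auto simp: ngon_vertex_eq)
  show "range vertex \<subseteq> ngon_vertex m c r t ` {..<m}"
  proof safe
    fix i
    have "i mod int m \<ge> 0" "i mod int m < int m" using m by simp_all
    then have "nat (i mod int m) \<in> {..<m}" by (simp add: nat_less_iff)
    moreover have "vertex i = vertex (i mod int m)"
      by (rule vertex_periodic) (simp add: minus_mod_eq_mult_div)
    then have "vertex i = ngon_vertex m c r t (nat (i mod int m))"
      using \<open>i mod int m \<ge> 0\<close> by (simp add: ngon_vertex_eq)
    ultimately show "vertex i \<in> ngon_vertex m c r t ` {..<m}" by blast
  qed
qed

lemma side_covector_lift: "side_covector i \<bullet> lift x = cos (\<theta> i) * (x $ 1 - c $ 1) + sin (\<theta> i) * (x $ 2 - c $ 2) - \<rho>"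
  by (simp add: side_covector_def lift_def inner_vector3 vector_3 algebra_simps)

lemma axis_covector_lift: "axis_covector j \<bullet> lift x = - sin (\<beta> j) * (x $ 1 - c $ 1) + cos (\<beta> j) * (x $ 2 - c $ 2)"
  by (simp add: axis_covector_def lift_def inner_vector3 vector_3 algebra_simps)

lemma side_covector_vertex: "side_covector i \<bullet> lift (vertex j) = r * cos (\<beta> (2 * j) - \<theta> i) - \<rho>"
  by (simp add: side_covector_lift vertex_eq vector_2 cos_diff algebra_simps)

lemma side_vertices: "side_covector i \<bullet> lift (vertex i) = 0" "side_covector i \<bullet> lift (vertex (i + 1)) = 0"
proof -
  have "\<beta> (2 * i) - \<theta> i = - (pi / real m)" "\<beta> (2 * (i + 1)) - \<theta> i = pi / real m"
    using m_pos by (simp_all add: \<beta>_def \<theta>_def field_simps)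
  then show "side_covector i \<bullet> lift (vertex i) = 0" "side_covector i \<bullet> lift (vertex (i + 1)) = 0"
    unfolding side_covector_vertex by (simp_all add: \<rho>_def)
qed

text \<open>If they were equal, this vertex would lie on the three sides \<open>i - 1\<close>,
  \<open>i\<close> and \<open>i + 1\<close>, against \<open>no_three_sides\<close>.\<close>

lemma consecutive_vertices_neq: "vertex i \<noteq> vertex (i + 1)"
proof
  assume "vertex i = vertex (i + 1)"
  then have "side_covector i \<bullet> lift (vertex (i + 1)) = 0" "side_covector (i + 1) \<bullet> lift (vertex (i + 1)) = 0"
    "side_covector (i - 1) \<bullet> lift (vertex (i + 1)) = 0"
    using side_vertices(1)[of i] side_vertices(1)[of "i + 1"] side_vertices(2)[of "i - 1"] by simp_all
  from no_three_sides[OF this lift_nz]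
  have "int m dvd 1 \<or> int m dvd 2" by (simp add: dvd_diff_commute, blast)
  then show False using m by (auto dest: zdvd_imp_le)
qed

lemma side_lines:
  "{L. is_line L \<and> (\<exists>s\<in>ngon_sides m c r t. embed ` s \<subseteq> L)} = range (\<lambda>i. pline (side_covector i))"
proof (intro equalityI subsetI)
  fix L assume "L \<in> {L. is_line L \<and> (\<exists>s\<in>ngon_sides m c r t. embed ` s \<subseteq> L)}"
  then obtain f j where f: "f \<noteq> 0" "L = pline f" "j < m"
    and sub: "embed ` closed_segment (vertex (int j)) (vertex (int j + 1)) \<subseteq> L"
    by (auto simp: is_line_pline ngon_sides_def ngon_vertex_eq add.commute)
  have "embed (vertex (int j)) \<in> L" "embed (vertex (int j + 1)) \<in> L" using sub by auto
  then have "f \<bullet> lift (vertex (int j)) = 0" "f \<bullet> lift (vertex (int j + 1)) = 0"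
    unfolding f(2) embed_in_pline .
  then have "pline f = pline (side_covector (int j))"
    using line_through_two_points[OF consecutive_vertices_neq f(1) side_covector_nz _ _ side_vertices] by blast
  then show "L \<in> range (\<lambda>i. pline (side_covector i))" using f(2) by blast
next
  fix L assume "L \<in> range (\<lambda>i. pline (side_covector i))"
  then obtain i where i: "i \<in> I" "L = pline (side_covector i)" using index_in_I side_covector_eq_iff by blast
  define j where "j = nat i"
  have j: "j < m" "int j = i" using i(1) by (auto simp: I_def j_def)
  have "embed ` closed_segment (vertex i) (vertex (i + 1)) \<subseteq> L"
  proof safe
    fix x assume "x \<in> closed_segment (vertex i) (vertex (i + 1))"
    then obtain u where u: "x = (1 - u) *\<^sub>R vertex i + u *\<^sub>R vertex (i + 1)" by (auto simp: in_segment)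
    have "lift x = (1 - u) *\<^sub>R lift (vertex i) + u *\<^sub>R lift (vertex (i + 1))"
      by (simp add: u lift_def vec_eq_iff forall_3 vector_3)
    then have "side_covector i \<bullet> lift x = 0" using side_vertices[of i] by (simp add: inner_add_right)
    then show "embed x \<in> L" unfolding i(2) embed_in_pline .
  qed
  moreover have "closed_segment (vertex i) (vertex (i + 1)) \<in> ngon_sides m c r t"
    unfolding ngon_sides_def using j by (auto simp: ngon_vertex_eq add.commute image_iff intro!: bexI[of _ j])
  moreover have "is_line L" using i(2) side_covector_nz is_line_pline by metis
  ultimately show "L \<in> {L. is_line L \<and> (\<exists>s\<in>ngon_sides m c r t. embed ` s \<subseteq> L)}" by blast
qed

definition nrm :: "int \<Rightarrow> real^2" where
  "nrm j = vector [- sin (\<beta> j), cos (\<beta> j)]"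

definition axis :: "int \<Rightarrow> (real^2) set" where
  "axis j = {y. nrm j \<bullet> y = nrm j \<bullet> c}"

lemma norm_nrm: "norm (nrm j) = 1"
proof -
  have "nrm j \<bullet> nrm j = sin (\<beta> j) * sin (\<beta> j) + cos (\<beta> j) * cos (\<beta> j)"
    by (simp add: nrm_def inner_vector2 vector_2)
  also have "\<dots> = cos (\<beta> j) * cos (\<beta> j) + sin (\<beta> j) * sin (\<beta> j)" by (rule add.commute)
  also have "\<dots> = 1" by (rule sin_cos_squared_add3)
  finally show ?thesis by (simp add: norm_eq_1)
qed

lemma mirror_map_vertex:
  "mirror_map (vector [- sin b, cos b]) (vector [- sin b, cos b] \<bullet> c) (c + r *\<^sub>R vector [cos x, sin x]) =
    c + r *\<^sub>R vector [cos (2 * b - x), sin (2 * b - x)]"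
proof -
  let ?n = "vector [- sin b, cos b] :: real^2"
  have "?n \<bullet> (c + r *\<^sub>R vector [cos x, sin x]) - ?n \<bullet> c = r * sin (x - b)"
    by (simp add: inner_add_right inner_vector2 vector_2 sin_diff algebra_simps)
  then have "mirror_map ?n (?n \<bullet> c) (c + r *\<^sub>R vector [cos x, sin x]) =
      c + r *\<^sub>R vector [cos x, sin x] - (2 * (r * sin (x - b))) *\<^sub>R ?n"
    unfolding mirror_map_def by simp
  also have "\<dots> = c + r *\<^sub>R vector [cos x + 2 * sin (x - b) * sin b, sin x - 2 * sin (x - b) * cos b]"
    by (simp add: vec_eq_iff forall_2 vector_2 algebra_simps)
  finally show ?thesis unfolding trig_mirror .
qed

lemma ngon_eq: "ngon m c r t = convex hull (range vertex)"
  unfolding ngon_def vertices ..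

text \<open>The reflection in \<open>axis j\<close> sends \<open>vertex i\<close> to
  \<open>vertex (j - i)\<close>, so it permutes the vertices and preserves their convex
  hull.\<close>

lemma axis_is_symmetry_axis: "symmetry_axis (ngon m c r t) (axis j)"
proof -
  have "affine (axis j) \<and> aff_dim (axis j) = 1"
    unfolding affine_line_iff_hyperplane axis_def using norm_nrm by blast
  moreover have "reflection (axis j) = mirror_map (nrm j) (nrm j \<bullet> c)"
    unfolding axis_def by (rule ext) (simp add: reflection_hyperplane[OF norm_nrm] mirror_map_def)
  moreover have "mirror_map (nrm j) (nrm j \<bullet> c) ` range vertex = range vertex"
  proof -
    have "mirror_map (nrm j) (nrm j \<bullet> c) (vertex i) = vertex (j - i)" for i
    proof -
      have "2 * \<beta> j - \<beta> (2 * i) = \<beta> (2 * (j - i))" using beta_mirror[of j "2 * i"] by (simp add: algebra_simps)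
      then show ?thesis unfolding nrm_def vertex_eq mirror_map_vertex by simp
    qed
    then have "mirror_map (nrm j) (nrm j \<bullet> c) ` range vertex = range (\<lambda>i. vertex (j - i))" by (simp add: image_image)
    also have "\<dots> = vertex ` range (\<lambda>i. j - i)" by (simp only: image_image)
    also have "range (\<lambda>i. j - i) = UNIV" by (rule surjI[of _ "\<lambda>i. j - i"]) simp
    finally show ?thesis .
  qed
  ultimately show ?thesis unfolding symmetry_axis_def ngon_eq by (simp add: mirror_map_convex_hull)
qed

lemma vertex_norm: "(vertex i - c) \<bullet> (vertex i - c) = r\<^sup>2"
  by (simp add: vertex_eq inner_vec_def sum_2 vector_2 power2_eq_square algebra_simps flip: distrib_left)

text \<open>The tangent to the circumcircle at the vertex supports the polygon and touches it there
  only; \<open>key\<close> bounds the squared distance to the vertex in terms of the height below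
  this tangent.\<close>

lemma vertex_extreme: "vertex i extreme_point_of ngon m c r t"
proof (rule extreme_point_of_Int_supporting_hyperplane_le)
  let ?a = "vertex i - c"
  have sub: "ngon m c r t \<subseteq> cball c r"
    unfolding ngon_eq
  proof (rule hull_minimal)
    show "range vertex \<subseteq> cball c r"
    proof safe
      fix j
      have "norm (vertex j - c) = r" using vertex_norm[of j] r by (simp add: norm_eq_sqrt_inner)
      then show "vertex j \<in> cball c r" by (simp add: dist_norm norm_minus_commute)
    qed
  qed (rule convex_cball)
  have key: "(x - vertex i) \<bullet> (x - vertex i) \<le> 2 * (?a \<bullet> vertex i - ?a \<bullet> x)" if x: "x \<in> ngon m c r t" for x
  proof -
    have "norm (x - c) \<le> r" using sub x by (auto simp: dist_norm norm_minus_commute)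
    then have "(x - c) \<bullet> (x - c) \<le> r\<^sup>2" by (simp add: norm_le_square)
    moreover have "(x - vertex i) \<bullet> (x - vertex i) = (x - c) \<bullet> (x - c) - 2 * (?a \<bullet> (x - c)) + ?a \<bullet> ?a"
      by (simp add: inner_diff_left inner_diff_right inner_commute algebra_simps)
    moreover have "?a \<bullet> (x - c) = ?a \<bullet> x - ?a \<bullet> vertex i + ?a \<bullet> ?a"
      by (simp add: inner_diff_right)
    moreover have "X \<le> 2 * (D - C)"
      if "Q \<le> rr" "X = Q - 2 * B + V" "B = C - D + V" "V = rr" for Q rr X B V C D :: real
      using that by simp
    ultimately show ?thesis using vertex_norm[of i] by metis
  qed
  show "?a \<bullet> x \<le> ?a \<bullet> vertex i" if "x \<in> ngon m c r t" for x
  proof -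
    have "C \<le> D" if "0 \<le> X" "X \<le> 2 * (D - C)" for X C D :: real using that by simp
    then show ?thesis using inner_ge_zero key[OF that] by metis
  qed
  have "vertex i \<in> ngon m c r t" unfolding ngon_eq by (rule hull_inc) simp
  moreover have "x = vertex i" if "x \<in> ngon m c r t" "?a \<bullet> x = ?a \<bullet> vertex i" for x
    using key[OF that(1)] that(2) inner_ge_zero[of "x - vertex i"] by simp
  ultimately show "ngon m c r t \<inter> {x. ?a \<bullet> x = ?a \<bullet> vertex i} = {vertex i}" by blast
qed

text \<open>A reflection that preserves the polygon permutes its extreme points, which are the
  vertices. This places the mirror through the centre, and then the image of \<open>vertex 0\<close>
  determines its direction.\<close>

lemma symmetry_axis_is_axis:
  assumes "symmetry_axis (ngon m c r t) l"
  shows "\<exists>j. l = axis j"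
proof -
  obtain \<nu> d where \<nu>: "norm \<nu> = 1" "l = {y. \<nu> \<bullet> y = d}"
    using assms affine_line_iff_hyperplane[of l] unfolding symmetry_axis_def by metis
  have "reflection l = mirror_map \<nu> d"
    unfolding \<nu>(2) by (rule ext) (simp add: reflection_hyperplane[OF \<nu>(1)] mirror_map_def)
  then have P: "mirror_map \<nu> d ` ngon m c r t = ngon m c r t" using assms by (simp add: symmetry_axis_def)
  have to_vertex: "\<exists>j. mirror_map \<nu> d (vertex i) = vertex j" for i
  proof -
    have "mirror_map \<nu> d (vertex i) extreme_point_of ngon m c r t"
      by (rule mirror_map_extreme_point[OF \<nu>(1) _ P vertex_extreme]) (simp add: ngon_eq)
    then show ?thesis unfolding ngon_eq using extreme_point_of_convex_hull by blast
  qed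
  have \<nu>\<nu>: "\<nu> \<bullet> \<nu> = 1" using \<nu>(1) by (simp add: norm_eq_1)
  have d: "d = \<nu> \<bullet> c"
  proof (rule ccontr)
    assume dc: "d \<noteq> \<nu> \<bullet> c"
    \<comment> \<open>A vertex and its image are equally far from \<open>c\<close>; if they differ,
      the mirror is their perpendicular bisector and contains \<open>c\<close>. As it does not,
      every vertex lies on the mirror.\<close>
    have on: "\<nu> \<bullet> vertex i = d" for i
    proof (rule ccontr)
      assume ne: "\<nu> \<bullet> vertex i \<noteq> d"
      define h where "h = \<nu> \<bullet> vertex i - d"
      define y where "y = vertex i - c"
      obtain j where "vertex i - (2 * h) *\<^sub>R \<nu> = vertex j" using to_vertex[of i] unfolding mirror_map_def h_def by metis
      then have shift: "y - (2 * h) *\<^sub>R \<nu> = vertex j - c" by (simp add: y_def algebra_simps)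
      have "(y - (2 * h) *\<^sub>R \<nu>) \<bullet> (y - (2 * h) *\<^sub>R \<nu>) = y \<bullet> y"
        unfolding shift unfolding y_def vertex_norm ..
      then have "4 * h * h = 4 * h * (\<nu> \<bullet> y)"
        using \<nu>\<nu> by (simp add: inner_diff_left inner_diff_right inner_commute algebra_simps)
      then have "h = \<nu> \<bullet> y" using ne by (simp add: h_def)
      then show False using dc by (simp add: h_def y_def inner_diff_right)
    qed
    define f :: "real^3" where "f = vector [\<nu> $ 1, \<nu> $ 2, - d]"
    have fl: "f \<bullet> lift x = \<nu> \<bullet> x - d" for x
      by (simp add: f_def lift_def inner_vector3 vector_3 inner_vec_def[of \<nu>] sum_2)
    have "f \<noteq> 0"
    proof
      assume "f = 0"
      then have "\<nu> = 0" by (simp add: f_def vec_eq_iff forall_3 forall_2 vector_3)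
      then show False using \<nu>\<nu> by simp
    qed
    \<comment> \<open>All side lines would coincide with the mirror.\<close>
    then have "pline f = pline (side_covector i)" for i
      using line_through_two_points[OF consecutive_vertices_neq _ side_covector_nz _ _ side_vertices] fl on by simp
    then have "int m dvd 0 - 1" using side_covector_eq_iff by metis
    then show False using m zdvd_not_zless[of 1 "int m"] by simp
  qed
  have "(\<nu> $ 2)\<^sup>2 + (- \<nu> $ 1)\<^sup>2 = 1" using \<nu>\<nu> by (simp add: inner_vec_def sum_2 power2_eq_square)
  then obtain b where b: "\<nu> $ 2 = cos b" "- \<nu> $ 1 = sin b" by (rule sincos_total_2pi)
  have \<nu>b: "\<nu> = vector [- sin b, cos b]" using b by (simp add: vec_eq_iff forall_2 vector_2)
  obtain j where "mirror_map \<nu> d (vertex 0) = vertex j" using to_vertex by metis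
  then have "c + r *\<^sub>R vector [cos (2 * b - \<beta> 0), sin (2 * b - \<beta> 0)] = vertex j"
    unfolding d vertex_eq[of 0] by (simp add: \<nu>b mirror_map_vertex)
  then have "cos (2 * b - \<beta> 0) = cos (\<beta> (2 * j)) \<and> sin (2 * b - \<beta> 0) = sin (\<beta> (2 * j))"
    using r by (simp add: vertex_eq vec_eq_iff forall_2 vector_2)
  then obtain k :: int where k: "2 * b - \<beta> 0 = \<beta> (2 * j) + 2 * pi * of_int k"
    using sin_cos_eq_iff[of "2 * b - \<beta> 0" "\<beta> (2 * j)"] by blast
  \<comment> \<open>The angle \<open>2 * b\<close> is known modulo 2 \<pi> only, hence
    \<open>b\<close> modulo \<pi>, which shifts the index of the axis by a multiple of
    \<open>m\<close>.\<close>
  have "2 * b = 2 * \<beta> (j + int m * k)"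
    using k m_pos by (simp add: \<beta>_def field_simps)
  then have "\<nu> = nrm (j + int m * k)" by (simp add: \<nu>b nrm_def)
  then have "l = axis (j + int m * k)" unfolding \<nu>(2) d axis_def by simp
  then show ?thesis by blast
qed

lemma axis_iff: "x \<in> axis j \<longleftrightarrow> axis_covector j \<bullet> lift x = 0"
proof -
  have "axis_covector j \<bullet> lift x = nrm j \<bullet> x - nrm j \<bullet> c"
    by (simp add: axis_covector_lift nrm_def inner_vector2 algebra_simps)
  then show ?thesis by (simp add: axis_def)
qed

lemma axis_lines:
  "{L. is_line L \<and> (\<exists>l. symmetry_axis (ngon m c r t) l \<and> embed ` l \<subseteq> L)} = range (\<lambda>j. pline (axis_covector j))"
proof (intro equalityI subsetI)
  fix L assume "L \<in> {L. is_line L \<and> (\<exists>l. symmetry_axis (ngon m c r t) l \<and> embed ` l \<subseteq> L)}"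
  then obtain f l where f: "f \<noteq> 0" "L = pline f" and l: "symmetry_axis (ngon m c r t) l" "embed ` l \<subseteq> L"
    unfolding is_line_pline by blast
  obtain j where j: "l = axis j" using symmetry_axis_is_axis[OF l(1)] by blast
  define q where "q = c + vector [cos (\<beta> j), sin (\<beta> j)]"
  have "c \<noteq> q"
  proof
    assume "c = q"
    then have "cos (\<beta> j) = 0" "sin (\<beta> j) = 0" by (simp_all add: q_def vec_eq_iff forall_2 vector_2)
    then show False using sin_cos_squared_add[of "\<beta> j"] by simp
  qed
  have a: "axis_covector j \<bullet> lift c = 0" "axis_covector j \<bullet> lift q = 0" by (simp_all add: axis_covector_lift q_def vector_2)
  then have "c \<in> l" "q \<in> l" unfolding j axis_iff .
  then have "f \<bullet> lift c = 0" "f \<bullet> lift q = 0" using l(2) embed_in_pline unfolding f(2) by blast+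
  then have "pline f = pline (axis_covector j)" using line_through_two_points[OF \<open>c \<noteq> q\<close> f(1) axis_covector_nz _ _ a] by blast
  then show "L \<in> range (\<lambda>j. pline (axis_covector j))" using f(2) by blast
next
  fix L assume "L \<in> range (\<lambda>j. pline (axis_covector j))"
  then obtain j where j: "L = pline (axis_covector j)" by blast
  have "embed ` axis j \<subseteq> L" unfolding j using embed_in_pline axis_iff by blast
  moreover have "is_line L" using j axis_covector_nz is_line_pline by metis
  ultimately show "L \<in> {L. is_line L \<and> (\<exists>l. symmetry_axis (ngon m c r t) l \<and> embed ` l \<subseteq> L)}"
    using axis_is_symmetry_axis by blast
qed

lemma regular_arrangement_eq_R: "regular_arrangement m c r t = R"
  unfolding regular_arrangement_def side_lines axis_lines R_def ..

end

theorem proposition5p3: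
  fixes A :: "rp2 set set" and n k m :: nat and c :: "real^2" and r t :: real
  assumes "line_arrangement A" and "simplicial A" and "card A = n" and "n \<ge> 15"
    and "m \<ge> 3" and "r > 0"
    and "card (sym_diff A (regular_arrangement m c r t)) \<le> k"
    and "real k < 1 / 13 * real n - 14 / 13"
  shows "A = regular_arrangement m c r t \<or>
         A = regular_arrangement m c r t \<union> {line_at_infinity}"
proof -
  interpret regular_ngon m c r t
    by unfold_locales (use assms in simp_all)
  have fin: "finite A" "finite R" using assms(1) finite_R by (simp_all add: line_arrangement_def)
  have "card (sym_diff A R) = card (A - R) + card (R - A)"
    by (rule card_Un_disjoint) (use fin in auto)
  then have "card (A - R) + card (R - A) \<le> k" using assms(7) by (simp add: regular_arrangement_eq_R)
  moreover have "13 * k + 14 < n"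
  proof -
    have "real (13 * k + 14) < real n" using assms(8) by simp
    then show ?thesis by (simp only: of_nat_less_iff)
  qed
  moreover have "card A = card (A \<inter> R) + card (A - R)" "card R = card (R \<inter> A) + card (R - A)"
    using fin by (metis card_Int_Diff)+
  \<comment> \<open>From n = 2 m + |A - R| - |R - A| and 13 (|A - R| + |R - A|) + 14 < n one gets 2
    m > 14 |R - A| + 12 |A - R| + 14.\<close>
  ultimately have "m > 7 * card (R - A) + 6 * card (A - R) + 7"
    using assms(3) card_R by (simp add: Int_commute)
  then interpret near_mirror_system m side_covector axis_covector axis_normal side_midpoint centre A line_at_infinity
    using assms(1,2) orthogonal_two_normals by unfold_locales
  show ?thesis using A_eq unfolding regular_arrangement_eq_R .
qed

end
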